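(* Consider initial data at $t=0$ for the system $$R_{xx}-R_{tt}=0,$$ $$W_{tt}-W_{xx}+\frac{R_t}{R}W_t-\frac{R_x}{R}W_x+\frac{q_t^2-q_x^2}{2}e^{-4W}=0,$$ $$q_{tt}-q_{xx}+\frac{R_t}{R}q_t-\frac{R_x}{R}q_x-4q_tW_t+4q_xW_x=0,$$ such that $R(0,\cdot),W(0,\cdot),q(0,\cdot)\in C^2(\mathbb{R})$ and $R_t(0,\cdot),W_t(0,\cdot),q_t(0,\cdot)\in C^1(\mathbb{R})$. Suppose additionally that $m_0(0)<2R_0/3$. Then there is a unique $C^2$ solution $(R,W,q)$ with these initial data defined for all $t\ge 0$ (and $x\in\mathbb{R}$).
   Context: The unknowns $R,W,q$ are real functions of $(t,x)$, $x\in\mathbb{R}$. $R_0>0$ is a fixed constant and $R_b(t,x)=R_0e^{2t}\cosh(2x)$. The quantity $m_0$ is $$m_0(t)=\|R(t,\cdot)-R_b(t,\cdot)\|_{C^0}+\|R_t(t,\cdot)-\partial_tR_b(t,\cdot)\|_{C^0},$$ where $\|\cdot\|_{C^0}$ is the supremum norm over $x\in\mathbb{R}$. *)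

theory Defs
  imports "HOL-Analysis.Analysis"
begin

primrec Ck_line :: "nat \<Rightarrow> (real \<Rightarrow> real) \<Rightarrow> bool" where
  "Ck_line 0 f \<longleftrightarrow> continuous_on UNIV f"
| "Ck_line (Suc k) f \<longleftrightarrow>
     continuous_on UNIV f \<and> (\<forall>x. f differentiable (at x)) \<and> Ck_line k (deriv f)"

text \<open>
  Functions of \<open>(t, x)\<close> are written in curried form; only their values for \<open>t \<ge> 0\<close> matter.
  The time derivative is taken within \<open>[0, \<infinity>)\<close>: it is the usual one for
  \<open>t > 0\<close> and the right derivative at \<open>t = 0\<close>.
\<close>

definition dt :: "(real \<Rightarrow> real \<Rightarrow> real) \<Rightarrow> real \<Rightarrow> real \<Rightarrow> real" where
  "dt f t x = vector_derivative (\<lambda>s. f s x) (at t within {0..})"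

definition dx :: "(real \<Rightarrow> real \<Rightarrow> real) \<Rightarrow> real \<Rightarrow> real \<Rightarrow> real" where
  "dx f t x = deriv (\<lambda>y. f t y) x"

text \<open>
  \<open>C\<^sup>k\<close> on the closed half-plane \<open>[0, \<infinity>) \<times> \<real>\<close>: all partial derivatives of order at most
  \<open>k\<close> (mixed ones in either order) exist and are jointly continuous up to \<open>t = 0\<close>.
\<close>

primrec Ck_halfplane :: "nat \<Rightarrow> (real \<Rightarrow> real \<Rightarrow> real) \<Rightarrow> bool" where
  "Ck_halfplane 0 f \<longleftrightarrow> continuous_on ({0..} \<times> UNIV) (\<lambda>(t, x). f t x)"
| "Ck_halfplane (Suc k) f \<longleftrightarrow>
     continuous_on ({0..} \<times> UNIV) (\<lambda>(t, x). f t x) \<and>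
     (\<forall>t\<ge>0. \<forall>x. (\<lambda>s. f s x) differentiable (at t within {0..})) \<and>
     (\<forall>t\<ge>0. \<forall>x. (\<lambda>y. f t y) differentiable (at x)) \<and>
     Ck_halfplane k (dt f) \<and> Ck_halfplane k (dx f)"

text \<open>The supremum norm is extended-real valued, so it is \<open>\<infinity>\<close> for unbounded functions.\<close>

definition C0_norm :: "(real \<Rightarrow> real) \<Rightarrow> ereal" where
  "C0_norm f = (SUP x. ereal \<bar>f x\<bar>)"

definition R_b :: "real \<Rightarrow> real \<Rightarrow> real \<Rightarrow> real" where
  "R_b R\<^sub>0 t x = R\<^sub>0 * exp (2 * t) * cosh (2 * x)"

text \<open>
  \<open>m\<^sub>0(t)\<close> depends on \<open>R\<close> only through the profiles \<open>r = R(t, \<sqdot>)\<close> and \<open>r' = R\<^sub>t(t, \<sqdot>)\<close>; taking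
  these as arguments lets \<open>m\<^sub>0(0)\<close> be formed from the initial data alone.
\<close>

definition m_0 :: "real \<Rightarrow> real \<Rightarrow> (real \<Rightarrow> real) \<Rightarrow> (real \<Rightarrow> real) \<Rightarrow> ereal" where
  "m_0 R\<^sub>0 t r r' =
     C0_norm (\<lambda>x. r x - R_b R\<^sub>0 t x) + C0_norm (\<lambda>x. r' x - dt (R_b R\<^sub>0) t x)"

text \<open>
  The condition \<open>R \<noteq> 0\<close> is what makes the quotients by \<open>R\<close> in the system meaningful
  (division by zero is total in HOL).
\<close>

definition solves_system ::
  "(real \<Rightarrow> real \<Rightarrow> real) \<Rightarrow> (real \<Rightarrow> real \<Rightarrow> real) \<Rightarrow> (real \<Rightarrow> real \<Rightarrow> real) \<Rightarrow> bool" where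
  "solves_system R W q \<longleftrightarrow> (\<forall>t\<ge>0. \<forall>x.
     R t x \<noteq> 0 \<and>
     dx (dx R) t x - dt (dt R) t x = 0 \<and>
     dt (dt W) t x - dx (dx W) t x
       + dt R t x / R t x * dt W t x - dx R t x / R t x * dx W t x
       + ((dt q t x)\<^sup>2 - (dx q t x)\<^sup>2) / 2 * exp (- 4 * W t x) = 0 \<and>
     dt (dt q) t x - dx (dx q) t x
       + dt R t x / R t x * dt q t x - dx R t x / R t x * dx q t x
       - 4 * dt q t x * dt W t x + 4 * dx q t x * dx W t x = 0)"

definition has_initial_data ::
  "(real \<Rightarrow> real \<Rightarrow> real) \<Rightarrow> (real \<Rightarrow> real) \<Rightarrow> (real \<Rightarrow> real) \<Rightarrow> bool" where
  "has_initial_data f f\<^sub>0 f\<^sub>1 \<longleftrightarrow> (\<forall>x. f 0 x = f\<^sub>0 x \<and> dt f 0 x = f\<^sub>1 x)"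

definition C2_solution_with_data ::
  "(real \<Rightarrow> real) \<Rightarrow> (real \<Rightarrow> real) \<Rightarrow> (real \<Rightarrow> real) \<Rightarrow> (real \<Rightarrow> real) \<Rightarrow>
   (real \<Rightarrow> real) \<Rightarrow> (real \<Rightarrow> real) \<Rightarrow>
   (real \<Rightarrow> real \<Rightarrow> real) \<Rightarrow> (real \<Rightarrow> real \<Rightarrow> real) \<Rightarrow> (real \<Rightarrow> real \<Rightarrow> real) \<Rightarrow> bool" where
  "C2_solution_with_data r\<^sub>0 r\<^sub>1 w\<^sub>0 w\<^sub>1 q\<^sub>0 q\<^sub>1 R W q \<longleftrightarrow>
     Ck_halfplane 2 R \<and> Ck_halfplane 2 W \<and> Ck_halfplane 2 q \<and>
     solves_system R W q \<and>
     has_initial_data R r\<^sub>0 r\<^sub>1 \<and> has_initial_data W w\<^sub>0 w\<^sub>1 \<and> has_initial_data q q\<^sub>0 q\<^sub>1"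

end

theory Submission
  imports Defs
begin

text \<open>
  The equations have the characteristics \<open>t \<plusminus> x = const\<close>, and \<open>R\<close> decouples. By d'Alembert's formula
  \<open>R = F(t + x) + G(t - x)\<close>, and since \<open>R\<^sub>b\<close> is at least \<open>R\<^sub>0 (1 + 2 t)\<close>, the bound on \<open>m\<^sub>0(0)\<close> leaves
  \<open>R \<ge> R\<^sub>0 / 3\<close> for all \<open>t \<ge> 0\<close> (\<open>dAlembert_lower_bound\<close>). Hence the coefficients \<open>R\<^sub>t / R\<close> and
  \<open>R\<^sub>x / R\<close> are bounded on bounded sets.

  The equations for \<open>(W, q)\<close> are those of a damped wave map into the hyperbolic plane with metric
  \<open>dW\<^sup>2 + exp (-4 W) dq\<^sup>2 / 4\<close>. With \<open>D\<^sub>\<plusminus> = \<partial>\<^sub>t \<plusminus> \<partial>\<^sub>x\<close>, put the components of the null derivatives in the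
  orthonormal frame into two complex functions,
  \<open>z = D\<^sub>+W + (i/2) exp (-2 W) D\<^sub>+q\<close> and \<open>w = D\<^sub>-W + (i/2) exp (-2 W) D\<^sub>-q\<close>.
  In the coordinates \<open>u = t - x\<close>, \<open>v = t + x\<close> the system becomes
  \<open>\<partial>\<^sub>u z = \<alpha> w + \<beta> z + i Im(w) z\<close> and \<open>\<partial>\<^sub>v w = \<alpha> w + \<beta> z + i Im(z) w\<close>,
  with \<open>\<alpha> = -\<partial>\<^sub>vR / (2 R)\<close> and \<open>\<beta> = -\<partial>\<^sub>uR / (2 R)\<close>; neither \<open>W\<close> nor \<open>q\<close> occurs any more.

  The point is that the quadratic terms are infinitesimal rotations of \<open>z\<close> and \<open>w\<close>: they do not
  contribute to the derivatives of \<open>|z|\<^sup>2\<close> and \<open>|w|\<^sup>2\<close>, which therefore satisfy linear differential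
  inequalities and grow at most exponentially on every bounded square
  (\<open>characteristic_comparison\<close>). Solutions cannot blow up. To turn this into existence, the rotation
  speed and the rotated vector are truncated at the size allowed by that a priori bound; the truncated
  system is globally Lipschitz and is solved by a contraction (\<open>characteristic_picard\<close>), its
  solution obeys the bound, and so the truncation is never active (\<open>char_system_square_exists\<close>).
  Uniqueness on squares glues these solutions together (\<open>char_system_exists\<close>).

  These solutions are only known to be differentiable along their own characteristics. Once \<open>w\<close> is
  given, however, the equation for \<open>z\<close> is a scalar linear ordinary differential equation in \<open>u\<close>
  whose coefficients are continuously differentiable in \<open>v\<close>, because the equation for \<open>w\<close> says what
  \<open>\<partial>\<^sub>v w\<close> is. Its explicit solution is continuously differentiable in both variables
  (\<open>linear_transport_C1\<close>, \<open>char_system_C1\<close>). The functions \<open>W\<close> and \<open>q\<close> are then recovered as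
  potentials; the integrability conditions follow from the characteristic system
  (\<open>wave_map_from_null_components\<close>). Conversely any \<open>C\<^sup>2\<close> solution gives rise to \<open>z\<close> and \<open>w\<close>
  solving the characteristic system, so that uniqueness follows from the same comparison
  argument (\<open>solution_char_system\<close>, \<open>solution_unique\<close>).

  The construction takes place on the whole plane, which makes all derivatives two-sided: \<open>R\<close> is
  given by d'Alembert's formula for negative \<open>t\<close> too, and \<open>1 / R\<close> is replaced by a \<open>C\<^sup>1\<close> function
  of \<open>R\<close> that agrees with it where \<open>R \<ge> R\<^sub>0 / 3\<close>.
\<close>

section \<open>Calculus on the plane\<close>

definition C0_plane :: "(real \<Rightarrow> real \<Rightarrow> 'a::topological_space) \<Rightarrow> bool" where
  "C0_plane f \<longleftrightarrow> continuous_on UNIV (\<lambda>p. f (fst p) (snd p))"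

lemma C0_plane_compose:
  assumes "C0_plane f" "continuous_on S g" "continuous_on S h"
  shows "continuous_on S (\<lambda>x. f (g x) (h x))"
proof -
  have "continuous_on S (\<lambda>x. (g x, h x))"
    by (intro continuous_intros assms)
  from continuous_on_compose2[OF assms(1)[unfolded C0_plane_def] this] show ?thesis by simp
qed

text \<open>
  The integral of \<open>f\<close> from \<open>a\<close> to \<open>b\<close>, negative in the usual sense when \<open>b < a\<close>. Pulling it back
  to the unit interval covers both orientations at once and reduces the dependence on the limits
  of integration to a dependence on parameters.
\<close>

definition oriented_integral :: "(real \<Rightarrow> 'a::banach) \<Rightarrow> real \<Rightarrow> real \<Rightarrow> 'a" where
  "oriented_integral f a b = (b - a) *\<^sub>R integral {0..1} (\<lambda>\<sigma>. f (a + \<sigma> * (b - a)))"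

lemma oriented_integral_refl [simp]: "oriented_integral f a a = 0"
  by (simp add: oriented_integral_def)

lemma oriented_integral_antiderivative:
  assumes "\<And>x. (\<Phi> has_vector_derivative f x) (at x)"
  shows "oriented_integral f a b = \<Phi> b - \<Phi> a"
proof -
  have "((\<lambda>\<sigma>. (b - a) *\<^sub>R f (a + \<sigma> * (b - a))) has_integral
      (\<Phi> (a + 1 * (b - a)) - \<Phi> (a + 0 * (b - a)))) {0..1}"
  proof (rule fundamental_theorem_of_calculus)
    fix x :: real
    have "((\<Phi> \<circ> (\<lambda>\<sigma>. a + \<sigma> * (b - a))) has_vector_derivative
        (b - a) *\<^sub>R f (a + x * (b - a))) (at x)"
      by (rule vector_diff_chain_at) (auto intro!: derivative_eq_intros assms)
    then show "((\<lambda>\<sigma>. \<Phi> (a + \<sigma> * (b - a))) has_vector_derivative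
        (b - a) *\<^sub>R f (a + x * (b - a))) (at x within {0..1})"
      by (simp add: o_def has_vector_derivative_at_within)
  qed auto
  then have "integral {0..1} (\<lambda>\<sigma>. (b - a) *\<^sub>R f (a + \<sigma> * (b - a))) = \<Phi> b - \<Phi> a"
    by (intro integral_unique) simp
  then show ?thesis unfolding oriented_integral_def by simp
qed

lemma continuous_antiderivative:
  fixes f :: "real \<Rightarrow> 'a::banach"
  assumes "continuous_on UNIV f"
  obtains \<Phi> where "\<And>x. (\<Phi> has_vector_derivative f x) (at x)"
proof
  define \<Phi> where "\<Phi> x = integral {0..x} f - integral {x..0} f" for x
  fix x :: real
  define N where "N = \<bar>x\<bar> + 1"
  have ci: "f integrable_on {a..b}" for a b
    by (meson assms continuous_on_subset integrable_continuous_interval top_greatest)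
  have eq: "integral {-N..y} f - integral {-N..0} f = \<Phi> y" if "y \<in> {-N<..<N}" for y
  proof (cases "0 \<le> y")
    case True
    have "integral {-N..0} f + integral {0..y} f = integral {-N..y} f"
      using True that by (intro Henstock_Kurzweil_Integration.integral_combine ci) auto
    moreover have "integral {y..0} f = 0"
      using True by (cases "y = 0") auto
    ultimately show ?thesis by (simp add: \<Phi>_def algebra_simps)
  next
    case False
    have "integral {-N..y} f + integral {y..0} f = integral {-N..0} f"
      using False that by (intro Henstock_Kurzweil_Integration.integral_combine ci) auto
    moreover have "integral {0..y} f = 0" using False by simp
    ultimately show ?thesis by (simp add: \<Phi>_def algebra_simps)
  qed
  have x: "x \<in> {-N<..<N}" by (auto simp: N_def)
  have "((\<lambda>y. integral {-N..y} f) has_vector_derivative f x) (at x within {-N..N})"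
    using x by (intro integral_has_vector_derivative continuous_on_subset[OF assms]) auto
  then have "((\<lambda>y. integral {-N..y} f) has_vector_derivative f x) (at x)"
    using x by (simp add: at_within_Icc_at has_vector_derivative_def)
  then have "((\<lambda>y. integral {-N..y} f - integral {-N..0} f) has_vector_derivative f x) (at x)"
    by (auto intro!: derivative_eq_intros)
  then show "(\<Phi> has_vector_derivative f x) (at x)"
    by (rule has_vector_derivative_transform_within_open[OF _ _ x]) (auto simp: eq)
qed

lemma oriented_integral_has_derivative:
  assumes "continuous_on UNIV f"
  shows "((\<lambda>b. oriented_integral f a b) has_vector_derivative f x) (at x)"
proof -
  obtain \<Phi> where \<Phi>: "\<And>x. (\<Phi> has_vector_derivative f x) (at x)"
    using continuous_antiderivative[OF assms] by blast
  show ?thesis unfolding oriented_integral_antiderivative[OF \<Phi>]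
    by (auto intro!: derivative_eq_intros \<Phi>)
qed

lemma oriented_integral_diff:
  assumes "continuous_on UNIV f" "continuous_on UNIV g"
  shows "oriented_integral f a b - oriented_integral g a b = oriented_integral (\<lambda>s. f s - g s) a b"
proof -
  obtain \<Phi> \<Gamma> where \<Phi>: "\<And>x. (\<Phi> has_vector_derivative f x) (at x)"
    and \<Gamma>: "\<And>x. (\<Gamma> has_vector_derivative g x) (at x)"
    using continuous_antiderivative assms by metis
  have "((\<lambda>x. \<Phi> x - \<Gamma> x) has_vector_derivative f x - g x) (at x)" for x
    by (auto intro!: derivative_eq_intros \<Phi> \<Gamma>)
  from oriented_integral_antiderivative[OF this] show ?thesis
    unfolding oriented_integral_antiderivative[OF \<Phi>] oriented_integral_antiderivative[OF \<Gamma>] by simp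
qed

lemma continuous_oriented_integral:
  fixes f :: "'b::topological_space \<Rightarrow> real \<Rightarrow> 'a::banach"
  assumes f: "continuous_on UNIV (\<lambda>p. f (fst p) (snd p))"
    and a: "continuous_on UNIV a" and b: "continuous_on UNIV b"
  shows "continuous_on UNIV (\<lambda>p. oriented_integral (f p) (a p) (b p))"
proof -
  have "continuous_on UNIV
      (\<lambda>q. f (fst q) (a (fst q) + snd q * (b (fst q) - a (fst q))))"
  proof -
    have "continuous_on UNIV (\<lambda>q::'b \<times> real. (fst q, a (fst q) + snd q * (b (fst q) - a (fst q))))"
      by (intro continuous_intros continuous_on_compose2[OF a] continuous_on_compose2[OF b]) auto
    from continuous_on_compose2[OF f this] show ?thesis by simp
  qed
  then have "continuous_on (UNIV \<times> cbox 0 1) (\<lambda>(p, \<sigma>). f p (a p + \<sigma> * (b p - a p)))"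
    unfolding split_beta by (rule continuous_on_subset) auto
  from integral_continuous_on_param[OF this]
  show ?thesis unfolding oriented_integral_def
    by (intro continuous_intros a b) (simp add: cbox_interval)
qed

text \<open>
  This is the gain of a factor \<open>1 / l\<close> in a weighted norm; a large \<open>l\<close> makes the
  fixed point operator below contracting without a restriction on the size of the domain.
\<close>

lemma oriented_integral_exp_bound:
  fixes f :: "real \<Rightarrow> 'a::banach"
  assumes cont: "continuous_on UNIV f" and l: "l > 0"
    and bd: "\<And>s. norm (f s) \<le> C * exp (l * \<bar>s - a\<bar>)"
  shows "norm (oriented_integral f a b) \<le> C / l * exp (l * \<bar>b - a\<bar>)"
proof (cases "b = a")
  case True
  have "0 \<le> C" using order_trans[OF norm_ge_zero bd[of a]] by simp
  then show ?thesis using True l by simp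
next
  case False
  define c where "c = l * \<bar>b - a\<bar>"
  have c: "c > 0" using l False by (simp add: c_def)
  have C: "0 \<le> C" using order_trans[OF norm_ge_zero bd[of a]] by simp
  have ii: "((\<lambda>\<sigma>. C * exp (c * \<sigma>)) has_integral (C * exp (c * 1) / c - C * exp (c * 0) / c)) {0..1}"
    using c by (intro fundamental_theorem_of_calculus)
      (auto intro!: derivative_eq_intros simp flip: has_real_derivative_iff_has_vector_derivative)
  have "norm (integral {0..1} (\<lambda>\<sigma>. f (a + \<sigma> * (b - a)))) \<le> integral {0..1} (\<lambda>\<sigma>. C * exp (c * \<sigma>))"
  proof (rule integral_norm_bound_integral)
    show "(\<lambda>\<sigma>. f (a + \<sigma> * (b - a))) integrable_on {0..1}"
      by (intro integrable_continuous_real continuous_on_compose2[OF cont] continuous_intros) auto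
    show "(\<lambda>\<sigma>. C * exp (c * \<sigma>)) integrable_on {0..1}" using ii by blast
    show "norm (f (a + x * (b - a))) \<le> C * exp (c * x)" if "x \<in> {0..1}" for x
      using bd[of "a + x * (b - a)"] that by (simp add: c_def abs_mult mult_ac)
  qed
  also have "\<dots> = C * exp c / c - C / c" using integral_unique[OF ii] by simp
  also have "\<dots> \<le> C * exp c / c" using C c by simp
  finally have "norm (oriented_integral f a b) \<le> \<bar>b - a\<bar> * (C * exp c / c)"
    unfolding oriented_integral_def norm_scaleR by (intro mult_left_mono) auto
  also have "\<dots> = C / l * exp (l * \<bar>b - a\<bar>)"
    using False l by (simp add: c_def field_simps)
  finally show ?thesis .
qed

lemma oriented_integral_param_derivative:
  fixes f :: "real \<Rightarrow> real \<Rightarrow> 'a::banach"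
  assumes f: "C0_plane f" and f2: "C0_plane f2"
    and d: "\<And>s v. ((\<lambda>v. f s v) has_vector_derivative f2 s v) (at v)"
  shows "((\<lambda>v. oriented_integral (\<lambda>s. f s v) a b) has_vector_derivative oriented_integral (\<lambda>s. f2 s v) a b) (at v)"
proof -
  have "((\<lambda>v. integral (cbox 0 1) (\<lambda>\<sigma>. f (a + \<sigma> * (b - a)) v)) has_vector_derivative
      integral (cbox 0 1) (\<lambda>\<sigma>. f2 (a + \<sigma> * (b - a)) v)) (at v within UNIV)"
  proof (rule leibniz_rule_vector_derivative)
    show "(\<lambda>\<sigma>. f (a + \<sigma> * (b - a)) x) integrable_on cbox 0 1" for x
      by (intro integrable_continuous C0_plane_compose[OF f] continuous_intros)
    show "continuous_on (UNIV \<times> cbox 0 1) (\<lambda>(x, t). f2 (a + t * (b - a)) x)"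
      unfolding split_beta by (intro C0_plane_compose[OF f2] continuous_intros)
  qed (auto intro: d)
  then show ?thesis unfolding oriented_integral_def

    using bounded_linear.has_vector_derivative[OF bounded_linear_scaleR_right] by (simp add: cbox_interval)
qed

text \<open>
  The partial derivatives are arguments, so that their formulas can be carried along in calculations.
\<close>

definition C1_plane ::
  "(real \<Rightarrow> real \<Rightarrow> 'a::real_normed_vector) \<Rightarrow> (real \<Rightarrow> real \<Rightarrow> 'a) \<Rightarrow> (real \<Rightarrow> real \<Rightarrow> 'a) \<Rightarrow> bool"
  where "C1_plane f f1 f2 \<longleftrightarrow> C0_plane f1 \<and> C0_plane f2 \<and>
    (\<forall>u v. ((\<lambda>p. f (fst p) (snd p)) has_derivative (\<lambda>h. fst h *\<^sub>R f1 u v + snd h *\<^sub>R f2 u v)) (at (u, v)))"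

lemma C1_planeI:
  assumes c1: "C0_plane f1" and c2: "C0_plane f2"
    and d1: "\<And>u v. ((\<lambda>s. f s v) has_vector_derivative f1 u v) (at u)"
    and d2: "\<And>u v. ((\<lambda>s. f u s) has_vector_derivative f2 u v) (at v)"
  shows "C1_plane f f1 f2"
  unfolding C1_plane_def
proof (intro conjI allI c1 c2)
  fix u v
  define F where "F u v = blinfun_scaleR_left (f2 u v)" for u v
  have "((\<lambda>(x, y). f x y) has_derivative (\<lambda>(tx, ty). tx *\<^sub>R f1 u v + F u v ty)) (at (u, v) within UNIV \<times> UNIV)"
  proof (rule has_derivative_partialsI)
    show "((\<lambda>x. f x v) has_derivative (\<lambda>tx. tx *\<^sub>R f1 u v)) (at u)"
      using d1 by (simp add: has_vector_derivative_def)
    show "((\<lambda>y. f x y) has_derivative blinfun_apply (F x y)) (at y)" for x y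
      using d2 by (simp add: has_vector_derivative_def F_def)
    have "continuous_on UNIV (\<lambda>p. F (fst p) (snd p))"
      unfolding F_def by (intro bounded_linear.continuous_on[OF bounded_linear_blinfun_scaleR_left] c2[unfolded C0_plane_def])
    then show "continuous (at (u, v) within UNIV \<times> UNIV) (\<lambda>(x, y). F x y)"
      by (simp add: case_prod_unfold continuous_on_eq_continuous_within)
  qed auto
  then show "((\<lambda>p. f (fst p) (snd p)) has_derivative (\<lambda>h. fst h *\<^sub>R f1 u v + snd h *\<^sub>R f2 u v)) (at (u, v))"
    by (simp add: case_prod_unfold F_def)
qed

lemma C1_plane_path:
  assumes "C1_plane f f1 f2"
    and "(g has_vector_derivative g') (at t within S)" "(h has_vector_derivative h') (at t within S)"
  shows "((\<lambda>t. f (g t) (h t)) has_vector_derivative g' *\<^sub>R f1 (g t) (h t) + h' *\<^sub>R f2 (g t) (h t)) (at t within S)"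
proof -
  have "((\<lambda>t. (g t, h t)) has_derivative (\<lambda>x. (x *\<^sub>R g', x *\<^sub>R h'))) (at t within S)"
    using assms(2,3) by (auto intro!: derivative_eq_intros simp: has_vector_derivative_def)
  moreover have "((\<lambda>p. f (fst p) (snd p)) has_derivative
      (\<lambda>x. fst x *\<^sub>R f1 (g t) (h t) + snd x *\<^sub>R f2 (g t) (h t))) (at (g t, h t))"
    using assms(1) by (simp add: C1_plane_def)
  ultimately have "((\<lambda>t. f (fst (g t, h t)) (snd (g t, h t))) has_derivative
      (\<lambda>x. fst (x *\<^sub>R g', x *\<^sub>R h') *\<^sub>R f1 (g t) (h t) + snd (x *\<^sub>R g', x *\<^sub>R h') *\<^sub>R f2 (g t) (h t))) (at t within S)"
    by (rule has_derivative_compose)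
  then show ?thesis unfolding has_vector_derivative_def by (simp add: algebra_simps)
qed

lemma C1_plane_imp_C0_plane:
  assumes "C1_plane f f1 f2" shows "C0_plane f"
  using assms has_derivative_continuous
  by (fastforce simp: C0_plane_def C1_plane_def continuous_on_eq_continuous_within)

lemma C1_plane_partials:
  assumes "C1_plane f f1 f2"
  shows "((\<lambda>s. f s v) has_vector_derivative f1 u v) (at u within S)"
    and "((\<lambda>s. f u s) has_vector_derivative f2 u v) (at v within S)"
  using C1_plane_path[OF assms, of "\<lambda>s. s" 1 u S "\<lambda>_. v" 0]
    C1_plane_path[OF assms, of "\<lambda>_. u" 0 v S "\<lambda>s. s" 1]
  by (auto intro!: derivative_eq_intros)

section \<open>Comparison along characteristics\<close>

text \<open>
  A differential inequality \<open>P' < l P\<close> says that \<open>exp (- l s) P\<close> decreases, hence that this weighted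
  function was larger a short while earlier.
\<close>

lemma weighted_decrease:
  fixes P :: "real \<Rightarrow> real"
  assumes "(P has_real_derivative D) (at a)" "D < l * P a" "r > 0"
  shows "\<exists>h. 0 < h \<and> h \<le> r \<and> exp (- (l * (a + b))) * P a < exp (- (l * (a - h + b))) * P (a - h)"
proof -
  have "((\<lambda>s. exp (- (l * (s + b))) * P s) has_real_derivative
      exp (- (l * (a + b))) * (D - l * P a)) (at a)"
    by (auto intro!: derivative_eq_intros assms(1) simp: algebra_simps)
  moreover have "exp (- (l * (a + b))) * (D - l * P a) < 0"
    using assms(2) by (simp add: mult_less_0_iff)
  ultimately obtain d where "d > 0" and
    d: "\<And>h. 0 < h \<Longrightarrow> h < d \<Longrightarrow> exp (- (l * (a + b))) * P a < exp (- (l * (a - h + b))) * P (a - h)"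
    using DERIV_neg_dec_left by blast
  then show ?thesis
    using assms(3) by (intro exI[of _ "min (d/2) r"]) auto
qed

text \<open>
  A maximum principle. Consider a maximum over the triangle of the larger of
  \<open>exp (- l (u + v)) P\<close> and \<open>exp (- l (u + v)) M\<close> with \<open>l > 2 K\<close>. If it is positive and lies off the diagonal,
  then the larger function, say \<open>P\<close>, satisfies \<open>\<partial>\<^sub>u P \<le> 2 K P < l P\<close> there, so that its weighted
  version is larger at an earlier point of the same characteristic. That point belongs to the triangle
  because the triangle contains the backward characteristics of its points.
\<close>

lemma characteristic_comparison:
  fixes P M :: "real \<Rightarrow> real \<Rightarrow> real"
  assumes K: "K \<ge> 0" and B: "B \<ge> 0"
    and cP: "continuous_on {p. \<bar>fst p\<bar> \<le> L \<and> \<bar>snd p\<bar> \<le> L \<and> fst p + snd p \<ge> 0} (\<lambda>p. P (fst p) (snd p))"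
    and cM: "continuous_on {p. \<bar>fst p\<bar> \<le> L \<and> \<bar>snd p\<bar> \<le> L \<and> fst p + snd p \<ge> 0} (\<lambda>p. M (fst p) (snd p))"
    and dP: "\<And>u v. \<bar>u\<bar> \<le> L \<Longrightarrow> \<bar>v\<bar> \<le> L \<Longrightarrow> u + v > 0 \<Longrightarrow>
      \<exists>D. ((\<lambda>s. P s v) has_real_derivative D) (at u) \<and> D \<le> K * (P u v + M u v)"
    and dM: "\<And>u v. \<bar>u\<bar> \<le> L \<Longrightarrow> \<bar>v\<bar> \<le> L \<Longrightarrow> u + v > 0 \<Longrightarrow>
      \<exists>D. ((\<lambda>s. M u s) has_real_derivative D) (at v) \<and> D \<le> K * (P u v + M u v)"
    and init: "\<And>v. \<bar>v\<bar> \<le> L \<Longrightarrow> P (-v) v \<le> B \<and> M (-v) v \<le> B"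
    and uv: "\<bar>u\<bar> \<le> L" "\<bar>v\<bar> \<le> L" "u + v \<ge> 0"
  shows "P u v \<le> B * exp ((2*K+1) * (u + v)) \<and> M u v \<le> B * exp ((2*K+1) * (u + v))"
proof -
  define S where "S = {p::real \<times> real. \<bar>fst p\<bar> \<le> L \<and> \<bar>snd p\<bar> \<le> L \<and> fst p + snd p \<ge> 0}"
  define l where "l = 2*K+1"
  define f where "f p = exp (- (l * (fst p + snd p))) * P (fst p) (snd p)" for p
  define g where "g p = exp (- (l * (fst p + snd p))) * M (fst p) (snd p)" for p
  have S_eq: "S = {p \<in> {-L..L} \<times> {-L..L}. fst p + snd p \<ge> 0}"
    by (auto simp: S_def)
  have "compact S"
    unfolding S_eq Collect_conj_eq Collect_mem_eq
    by (intro compact_Int_closed compact_Times closed_Collect_le continuous_intros) auto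
  moreover have "(u, v) \<in> S" using uv by (simp add: S_def)
  moreover have "continuous_on S (\<lambda>p. max (f p) (g p))"
    unfolding f_def g_def by (intro continuous_intros cP[folded S_def] cM[folded S_def])
  ultimately obtain p where p: "p \<in> S" and pmax: "\<And>q. q \<in> S \<Longrightarrow> max (f q) (g q) \<le> max (f p) (g p)"
    using continuous_attains_sup[of S "\<lambda>p. max (f p) (g p)"] by (metis empty_iff)
  obtain a b where [simp]: "p = (a, b)" by (cases p)
  have ab: "\<bar>a\<bar> \<le> L" "\<bar>b\<bar> \<le> L" "a + b \<ge> 0" using p by (auto simp: S_def)
  have "max (f p) (g p) \<le> B"
  proof (rule ccontr)
    assume neg: "\<not> max (f p) (g p) \<le> B"
    have ab0: "a + b > 0"
    proof (rule ccontr)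
      assume "\<not> a + b > 0"
      then have "a = -b" using ab by simp
      then have "max (f p) (g p) \<le> B" using init[OF ab(2)] by (simp add: f_def g_def)
      with neg show False by simp
    qed
    have pos: "0 < exp (- (l * (a + b)))" by simp
    consider "f p \<ge> g p" | "g p \<ge> f p" by linarith
    then show False
    proof cases
      case 1
      then have MP: "M a b \<le> P a b" by (simp add: f_def g_def)
      have "f p > 0" using 1 neg B by auto
      then have P0: "P a b > 0" by (simp add: f_def zero_less_mult_iff)
      obtain D where D: "((\<lambda>s. P s b) has_real_derivative D) (at a)" "D \<le> K * (P a b + M a b)"
        using dP[OF ab(1,2) ab0] by blast
      have "K * (P a b + M a b) \<le> K * (2 * P a b)"
        using MP K by (intro mult_left_mono) auto
      then have "D < l * P a b" using D(2) P0 by (simp add: l_def algebra_simps)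
      from weighted_decrease[OF D(1) this ab0, of b] obtain h where
        h: "0 < h" "h \<le> a + b" "f p < f (a - h, b)" by (auto simp: f_def)
      moreover have "(a - h, b) \<in> S" using h(1,2) ab by (auto simp: S_def)
      ultimately show False using pmax[of "(a - h, b)"] 1 by auto
    next
      case 2
      then have MP: "P a b \<le> M a b" by (simp add: f_def g_def)
      have "g p > 0" using 2 neg B by auto
      then have P0: "M a b > 0" by (simp add: g_def zero_less_mult_iff)
      obtain D where D: "((\<lambda>s. M a s) has_real_derivative D) (at b)" "D \<le> K * (P a b + M a b)"
        using dM[OF ab(1,2) ab0] by blast
      have "K * (P a b + M a b) \<le> K * (2 * M a b)"
        using MP K by (intro mult_left_mono) auto
      then have "D < l * M a b" using D(2) P0 by (simp add: l_def algebra_simps)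
      from weighted_decrease[OF D(1) this ab0, of a] obtain h where
        h: "0 < h" "h \<le> a + b" "g p < g (a, b - h)" by (auto simp: g_def algebra_simps)
      moreover have "(a, b - h) \<in> S" using h(1,2) ab by (auto simp: S_def)
      ultimately show False using pmax[of "(a, b - h)"] 2 by auto
    qed
  qed
  with pmax[of "(u, v)"] \<open>(u, v) \<in> S\<close> have "f (u, v) \<le> B" "g (u, v) \<le> B" by auto
  then show ?thesis
    unfolding f_def g_def l_def exp_minus inverse_eq_divide by (simp add: pos_divide_le_eq)
qed

text \<open>
  The reflection \<open>(u, v) \<mapsto> (-v, -u)\<close>, which is time reversal, exchanges the two families of
  characteristics and hence the roles of \<open>P\<close> and \<open>M\<close>.
\<close>

lemma characteristic_comparison_two_sided:
  fixes P M :: "real \<Rightarrow> real \<Rightarrow> real"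
  assumes K: "K \<ge> 0" and B: "B \<ge> 0" and cP: "C0_plane P" and cM: "C0_plane M"
    and dP: "\<And>u v. \<bar>u\<bar> \<le> L \<Longrightarrow> \<bar>v\<bar> \<le> L \<Longrightarrow>
      \<exists>D. ((\<lambda>s. P s v) has_real_derivative D) (at u) \<and> \<bar>D\<bar> \<le> K * (P u v + M u v)"
    and dM: "\<And>u v. \<bar>u\<bar> \<le> L \<Longrightarrow> \<bar>v\<bar> \<le> L \<Longrightarrow>
      \<exists>D. ((\<lambda>s. M u s) has_real_derivative D) (at v) \<and> \<bar>D\<bar> \<le> K * (P u v + M u v)"
    and init: "\<And>v. \<bar>v\<bar> \<le> L \<Longrightarrow> P (-v) v \<le> B \<and> M (-v) v \<le> B"
    and uv: "\<bar>u\<bar> \<le> L" "\<bar>v\<bar> \<le> L"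
  shows "P u v \<le> B * exp ((2*K+1) * \<bar>u + v\<bar>) \<and> M u v \<le> B * exp ((2*K+1) * \<bar>u + v\<bar>)"
proof (cases "u + v \<ge> 0")
  case True
  have "P u v \<le> B * exp ((2*K+1) * (u + v)) \<and> M u v \<le> B * exp ((2*K+1) * (u + v))"
  proof (rule characteristic_comparison[OF K B])
    show "\<exists>D. ((\<lambda>s. P s v) has_real_derivative D) (at u) \<and> D \<le> K * (P u v + M u v)"
      if "\<bar>u\<bar> \<le> L" "\<bar>v\<bar> \<le> L" for u v using dP[OF that] by force
    show "\<exists>D. ((\<lambda>s. M u s) has_real_derivative D) (at v) \<and> D \<le> K * (P u v + M u v)"
      if "\<bar>u\<bar> \<le> L" "\<bar>v\<bar> \<le> L" for u v using dM[OF that] by force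
  qed (use True init uv in \<open>auto intro!: C0_plane_compose[OF cP] C0_plane_compose[OF cM] continuous_intros\<close>)
  with True show ?thesis by simp
next
  case False
  define P' where "P' u v = M (-v) (-u)" for u v
  define M' where "M' u v = P (-v) (-u)" for u v
  have "P' (-v) (-u) \<le> B * exp ((2*K+1) * (-v + -u)) \<and> M' (-v) (-u) \<le> B * exp ((2*K+1) * (-v + -u))"
  proof (rule characteristic_comparison[OF K B])
    fix u v assume b: "\<bar>u\<bar> \<le> L" "\<bar>v\<bar> \<le> L"
    obtain D where D: "((\<lambda>s. M (-v) s) has_real_derivative D) (at (-u))" "\<bar>D\<bar> \<le> K * (P (-v) (-u) + M (-v) (-u))"
      using dM[of "-v" "-u"] b by auto
    have "((\<lambda>s. P' s v) has_real_derivative D * (-1)) (at u)"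
      using D(1) unfolding P'_def DERIV_mirror[of "\<lambda>s. M (-v) s"] by simp
    then show "\<exists>D. ((\<lambda>s. P' s v) has_real_derivative D) (at u) \<and> D \<le> K * (P' u v + M' u v)"
      using D(2) by (intro exI[of _ "D * (-1)"]) (auto simp: P'_def M'_def add.commute)
    obtain D where D: "((\<lambda>s. P s (-u)) has_real_derivative D) (at (-v))" "\<bar>D\<bar> \<le> K * (P (-v) (-u) + M (-v) (-u))"
      using dP[of "-v" "-u"] b by auto
    have "((\<lambda>s. M' u s) has_real_derivative D * (-1)) (at v)"
      using D(1) unfolding M'_def DERIV_mirror[of "\<lambda>s. P s (-u)"] by simp
    then show "\<exists>D. ((\<lambda>s. M' u s) has_real_derivative D) (at v) \<and> D \<le> K * (P' u v + M' u v)"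
      using D(2) by (intro exI[of _ "D * (-1)"]) (auto simp: P'_def M'_def add.commute)
  next
    show "P' (- v) v \<le> B \<and> M' (- v) v \<le> B" if "\<bar>v\<bar> \<le> L" for v
      using init[of "v"] init[of "-v"] that by (simp add: P'_def M'_def)
  qed (use False uv in \<open>auto simp: P'_def M'_def intro!: C0_plane_compose[OF cP] C0_plane_compose[OF cM] continuous_intros\<close>)
  with False show ?thesis by (simp add: P'_def M'_def add.commute)
qed

section \<open>Successive approximation in characteristic coordinates\<close>

text \<open>
  The integral equations are a fixed point problem for the pair \<open>(z, w)\<close> divided by
  \<open>exp (l |u + v|)\<close>. By \<open>oriented_integral_exp_bound\<close> the operator is a contraction on the bounded
  continuous functions on the plane for \<open>l = 8 K\<close>.
\<close>

lemma characteristic_picard: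
  fixes F G :: "real \<Rightarrow> real \<Rightarrow> 'a::banach \<Rightarrow> 'a \<Rightarrow> 'a" and z0 w0 :: "real \<Rightarrow> 'a"
  assumes cF: "continuous_on UNIV (\<lambda>q. F (fst (fst q)) (snd (fst q)) (fst (snd q)) (snd (snd q)))"
    and cG: "continuous_on UNIV (\<lambda>q. G (fst (fst q)) (snd (fst q)) (fst (snd q)) (snd (snd q)))"
    and F0: "\<And>u v. F u v 0 0 = 0" and G0: "\<And>u v. G u v 0 0 = 0"
    and LF: "\<And>u v x y x' y'. norm (F u v x y - F u v x' y') \<le> K * (norm (x - x') + norm (y - y'))"
    and LG: "\<And>u v x y x' y'. norm (G u v x y - G u v x' y') \<le> K * (norm (x - x') + norm (y - y'))"
    and K: "K > 0"
    and cz0: "continuous_on UNIV z0" and bz0: "\<And>x. norm (z0 x) \<le> B"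
    and cw0: "continuous_on UNIV w0" and bw0: "\<And>x. norm (w0 x) \<le> B"
  obtains z w where "C0_plane z" "C0_plane w"
    "\<And>u v. z u v = z0 v + oriented_integral (\<lambda>s. F s v (z s v) (w s v)) (-v) u"
    "\<And>u v. w u v = w0 u + oriented_integral (\<lambda>s. G u s (z u s) (w u s)) (-u) v"
proof -
  define l where "l = 8 * K"
  have l: "l > 0" using K by (simp add: l_def)
  define E where "E u v = exp (l * \<bar>u + v\<bar>)" for u v :: real
  have E: "E u v > 0" for u v by (simp add: E_def)
  have E1: "E u v \<ge> 1" for u v using l by (simp add: E_def)
  define zz where "zz \<phi> u v = E u v *\<^sub>R fst (apply_bcontfun \<phi> (u, v))" for \<phi> :: "(real \<times> real) \<Rightarrow>\<^sub>C ('a \<times> 'a)" and u v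
  define ww where "ww \<phi> u v = E u v *\<^sub>R snd (apply_bcontfun \<phi> (u, v))" for \<phi> :: "(real \<times> real) \<Rightarrow>\<^sub>C ('a \<times> 'a)" and u v
  define FF where "FF \<phi> u v = F u v (zz \<phi> u v) (ww \<phi> u v)" for \<phi> u v
  define GG where "GG \<phi> u v = G u v (zz \<phi> u v) (ww \<phi> u v)" for \<phi> u v
  define Z where "Z \<phi> u v = z0 v + oriented_integral (\<lambda>s. FF \<phi> s v) (-v) u" for \<phi> u v
  define W where "W \<phi> u v = w0 u + oriented_integral (\<lambda>s. GG \<phi> u s) (-u) v" for \<phi> u v
  have czz: "C0_plane (zz \<phi>)" and cww: "C0_plane (ww \<phi>)" for \<phi>
    unfolding C0_plane_def zz_def ww_def E_def
    by (auto intro!: continuous_intros)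
  have cFF: "C0_plane (FF \<phi>)" for \<phi>
  proof -
    have "continuous_on UNIV (\<lambda>p. (p, (zz \<phi> (fst p) (snd p), ww \<phi> (fst p) (snd p))))"
      by (intro continuous_intros czz[unfolded C0_plane_def] cww[unfolded C0_plane_def])
    from continuous_on_compose2[OF cF this] show ?thesis by (simp add: C0_plane_def FF_def)
  qed
  have cGG: "C0_plane (GG \<phi>)" for \<phi>
  proof -
    have "continuous_on UNIV (\<lambda>p. (p, (zz \<phi> (fst p) (snd p), ww \<phi> (fst p) (snd p))))"
      by (intro continuous_intros czz[unfolded C0_plane_def] cww[unfolded C0_plane_def])
    from continuous_on_compose2[OF cG this] show ?thesis by (simp add: C0_plane_def GG_def)
  qed
  have cZ: "C0_plane (Z \<phi>)" for \<phi>
    unfolding C0_plane_def Z_def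
    by (intro continuous_intros continuous_on_compose2[OF cz0] continuous_oriented_integral C0_plane_compose[OF cFF]) auto
  have cW: "C0_plane (W \<phi>)" for \<phi>
    unfolding C0_plane_def W_def
    by (intro continuous_intros continuous_on_compose2[OF cw0] continuous_oriented_integral C0_plane_compose[OF cGG]) auto
  have diffs: "norm (zz \<phi> u v - zz \<psi> u v) \<le> dist \<phi> \<psi> * E u v" "norm (ww \<phi> u v - ww \<psi> u v) \<le> dist \<phi> \<psi> * E u v" for \<phi> \<psi> u v
  proof -
    have "norm (fst (apply_bcontfun \<phi> (u, v)) - fst (apply_bcontfun \<psi> (u, v))) \<le> dist \<phi> \<psi>"
      using dist_fst_le dist_bounded order_trans unfolding dist_norm[symmetric] by blast
    then show "norm (zz \<phi> u v - zz \<psi> u v) \<le> dist \<phi> \<psi> * E u v"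
      using E[of u v] by (simp add: zz_def mult.commute flip: scaleR_diff_right)
    have "norm (snd (apply_bcontfun \<phi> (u, v)) - snd (apply_bcontfun \<psi> (u, v))) \<le> dist \<phi> \<psi>"
      using dist_snd_le dist_bounded order_trans unfolding dist_norm[symmetric] by blast
    then show "norm (ww \<phi> u v - ww \<psi> u v) \<le> dist \<phi> \<psi> * E u v"
      using E[of u v] by (simp add: ww_def mult.commute flip: scaleR_diff_right)
  qed
  have FFd: "norm (FF \<phi> u v - FF \<psi> u v) \<le> 2 * K * dist \<phi> \<psi> * E u v" for \<phi> \<psi> u v
  proof -
    have "norm (FF \<phi> u v - FF \<psi> u v) \<le> K * (norm (zz \<phi> u v - zz \<psi> u v) + norm (ww \<phi> u v - ww \<psi> u v))"
      unfolding FF_def by (rule LF)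
    also have "\<dots> \<le> K * (dist \<phi> \<psi> * E u v + dist \<phi> \<psi> * E u v)"
      using K diffs by (intro mult_left_mono add_mono) auto
    finally show ?thesis by (simp only: mult_2 mult.assoc distrib_left distrib_right)
  qed
  have GGd: "norm (GG \<phi> u v - GG \<psi> u v) \<le> 2 * K * dist \<phi> \<psi> * E u v" for \<phi> \<psi> u v
  proof -
    have "norm (GG \<phi> u v - GG \<psi> u v) \<le> K * (norm (zz \<phi> u v - zz \<psi> u v) + norm (ww \<phi> u v - ww \<psi> u v))"
      unfolding GG_def by (rule LG)
    also have "\<dots> \<le> K * (dist \<phi> \<psi> * E u v + dist \<phi> \<psi> * E u v)"
      using K diffs by (intro mult_left_mono add_mono) auto
    finally show ?thesis by (simp only: mult_2 mult.assoc distrib_left distrib_right)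
  qed
  have slice: "continuous_on UNIV (\<lambda>s. FF \<phi> s v)" "continuous_on UNIV (\<lambda>s. GG \<phi> v s)" for \<phi> v
    by (intro C0_plane_compose[OF cFF] C0_plane_compose[OF cGG] continuous_intros)+
  have Zd: "norm (Z \<phi> u v - Z \<psi> u v) \<le> dist \<phi> \<psi> / 4 * E u v" for \<phi> \<psi> u v
  proof -
    have "norm (oriented_integral (\<lambda>s. FF \<phi> s v - FF \<psi> s v) (-v) u) \<le> (2 * K * dist \<phi> \<psi>) / l * exp (l * \<bar>u - (-v)\<bar>)"
      by (rule oriented_integral_exp_bound[OF _ l]) (auto intro!: continuous_intros slice order_trans[OF FFd] simp: E_def)
    then show ?thesis using K unfolding Z_def
      by (simp add: oriented_integral_diff[OF slice(1) slice(1)] E_def l_def)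
  qed
  have Wd: "norm (W \<phi> u v - W \<psi> u v) \<le> dist \<phi> \<psi> / 4 * E u v" for \<phi> \<psi> u v
  proof -
    have "norm (oriented_integral (\<lambda>s. GG \<phi> u s - GG \<psi> u s) (-u) v) \<le> (2 * K * dist \<phi> \<psi>) / l * exp (l * \<bar>v - (-u)\<bar>)"
      by (rule oriented_integral_exp_bound[OF _ l]) (auto intro!: continuous_intros slice order_trans[OF GGd] simp: E_def add.commute)
    then show ?thesis using K unfolding W_def
      by (simp add: oriented_integral_diff[OF slice(2) slice(2)] E_def l_def add.commute)
  qed
  have FF0: "FF 0 u v = 0" "GG 0 u v = 0" for u v
    by (simp_all add: FF_def GG_def zz_def ww_def F0 G0)
  have Z0: "Z 0 u v = z0 v" "W 0 u v = w0 u" for u v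
    by (simp_all add: Z_def W_def FF0 oriented_integral_def)
  have Zb: "norm (Z \<phi> u v /\<^sub>R E u v) \<le> B + dist \<phi> 0 / 4" for \<phi> u v
  proof -
    have "norm (Z \<phi> u v) \<le> B + dist \<phi> 0 / 4 * E u v"
      using norm_triangle_sub[of "Z \<phi> u v" "Z 0 u v"] Zd[of \<phi> u v 0] bz0[of v] by (simp add: Z0)
    also have "\<dots> \<le> B * E u v + dist \<phi> 0 / 4 * E u v"
      using mult_left_mono[OF E1[of u v], of B] order_trans[OF norm_ge_zero bz0] by simp
    finally show ?thesis using E[of u v] by (simp add: field_simps)
  qed
  have Wb: "norm (W \<phi> u v /\<^sub>R E u v) \<le> B + dist \<phi> 0 / 4" for \<phi> u v
  proof -
    have "norm (W \<phi> u v) \<le> B + dist \<phi> 0 / 4 * E u v"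
      using norm_triangle_sub[of "W \<phi> u v" "W 0 u v"] Wd[of \<phi> u v 0] bw0[of u] by (simp add: Z0)
    also have "\<dots> \<le> B * E u v + dist \<phi> 0 / 4 * E u v"
      using mult_left_mono[OF E1[of u v], of B] order_trans[OF norm_ge_zero bw0] by simp
    finally show ?thesis using E[of u v] by (simp add: field_simps)
  qed
  define T where "T \<phi> = Bcontfun (\<lambda>p. (Z \<phi> (fst p) (snd p) /\<^sub>R E (fst p) (snd p), W \<phi> (fst p) (snd p) /\<^sub>R E (fst p) (snd p)))" for \<phi>
  have T: "apply_bcontfun (T \<phi>) p = (Z \<phi> (fst p) (snd p) /\<^sub>R E (fst p) (snd p), W \<phi> (fst p) (snd p) /\<^sub>R E (fst p) (snd p))" for \<phi> p
    unfolding T_def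
  proof (subst Bcontfun_inverse)
    show "(\<lambda>p. (Z \<phi> (fst p) (snd p) /\<^sub>R E (fst p) (snd p), W \<phi> (fst p) (snd p) /\<^sub>R E (fst p) (snd p))) \<in> bcontfun"
    proof (rule bcontfun_normI)
      have "continuous_on UNIV (\<lambda>p. E (fst p) (snd p))" unfolding E_def by (intro continuous_intros)
      then show "continuous_on UNIV (\<lambda>p. (Z \<phi> (fst p) (snd p) /\<^sub>R E (fst p) (snd p), W \<phi> (fst p) (snd p) /\<^sub>R E (fst p) (snd p)))"
        using E by (intro continuous_intros cZ[unfolded C0_plane_def] cW[unfolded C0_plane_def]) (auto simp: less_imp_neq[symmetric])
      show "norm (Z \<phi> (fst p) (snd p) /\<^sub>R E (fst p) (snd p), W \<phi> (fst p) (snd p) /\<^sub>R E (fst p) (snd p))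
        \<le> (B + dist \<phi> 0 / 4) + (B + dist \<phi> 0 / 4)" for p
        by (rule order_trans[OF norm_Pair_le add_mono[OF Zb Wb]])
    qed
  qed simp
  have "dist (T \<phi>) (T \<psi>) \<le> 1/2 * dist \<phi> \<psi>" for \<phi> \<psi>
  proof (rule dist_bound)
    fix p :: "real \<times> real"
    have "norm (Z \<phi> (fst p) (snd p) /\<^sub>R E (fst p) (snd p) - Z \<psi> (fst p) (snd p) /\<^sub>R E (fst p) (snd p)) \<le> dist \<phi> \<psi> / 4"
      using Zd[of \<phi> "fst p" "snd p" \<psi>] E[of "fst p" "snd p"]
      by (simp add: divide_inverse_commute[symmetric] pos_divide_le_eq flip: scaleR_diff_right)
    moreover have "norm (W \<phi> (fst p) (snd p) /\<^sub>R E (fst p) (snd p) - W \<psi> (fst p) (snd p) /\<^sub>R E (fst p) (snd p)) \<le> dist \<phi> \<psi> / 4"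
      using Wd[of \<phi> "fst p" "snd p" \<psi>] E[of "fst p" "snd p"]
      by (simp add: divide_inverse_commute[symmetric] pos_divide_le_eq flip: scaleR_diff_right)
    ultimately show "dist (T \<phi> p) (T \<psi> p) \<le> 1/2 * dist \<phi> \<psi>"
      unfolding T dist_norm diff_Pair
      by (intro order_trans[OF norm_Pair_le]) simp
  qed
  then obtain \<phi> where fp: "T \<phi> = \<phi>"
    using banach_fix_type[of "1/2" T] by auto
  have eq: "zz \<phi> u v = Z \<phi> u v" "ww \<phi> u v = W \<phi> u v" for u v
    using T[of \<phi> "(u, v)"] E[of u v] by (simp_all add: zz_def ww_def fp)
  show ?thesis
    by (rule that[OF czz cww eq[unfolded Z_def W_def FF_def GG_def]])
qed

section \<open>The characteristic system\<close>

text \<open>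
  The wave map equation for the null components \<open>z\<close> and \<open>w\<close> described at the beginning, at a
  single point.
\<close>

definition char_system ::
  "(real \<Rightarrow> real \<Rightarrow> real) \<Rightarrow> (real \<Rightarrow> real \<Rightarrow> real) \<Rightarrow> (real \<Rightarrow> real \<Rightarrow> complex) \<Rightarrow> (real \<Rightarrow> real \<Rightarrow> complex)
    \<Rightarrow> real \<Rightarrow> real \<Rightarrow> bool" where
  "char_system al be z w u v \<longleftrightarrow>
    ((\<lambda>s. z s v) has_vector_derivative
      al u v *\<^sub>R w u v + be u v *\<^sub>R z u v + \<i> * complex_of_real (Im (w u v)) * z u v) (at u) \<and>
    ((\<lambda>s. w u s) has_vector_derivative
      al u v *\<^sub>R w u v + be u v *\<^sub>R z u v + \<i> * complex_of_real (Im (z u v)) * w u v) (at v)"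

lemma norm_square_derivative:
  fixes f :: "real \<Rightarrow> 'a::real_inner"
  assumes "(f has_vector_derivative f') (at x)"
  shows "((\<lambda>s. (norm (f s))\<^sup>2) has_real_derivative 2 * (f x \<bullet> f')) (at x)"
proof -
  have "((\<lambda>s. f s \<bullet> f s) has_derivative (\<lambda>h. f x \<bullet> (h *\<^sub>R f') + (h *\<^sub>R f') \<bullet> f x)) (at x)"
    using assms unfolding has_vector_derivative_def by (intro has_derivative_inner)
  moreover have "(\<lambda>h. f x \<bullet> (h *\<^sub>R f') + (h *\<^sub>R f') \<bullet> f x) = (*) (2 * (f x \<bullet> f'))"
    by (rule ext) (simp add: inner_commute)
  ultimately show ?thesis by (simp add: power2_norm_eq_inner has_field_derivative_def)
qed

text \<open>
  Bounds the derivative of \<open>|z|\<^sup>2\<close> when \<open>\<partial>\<^sub>u z\<close> is bounded by a multiple of \<open>|z| + |w|\<close>.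
\<close>

lemma quadratic_growth:
  fixes a b c :: real
  assumes "a \<ge> 0" "b \<ge> 0" "c \<ge> 0" "\<bar>d\<bar> \<le> a * (c * (a + b))"
  shows "\<bar>2 * d\<bar> \<le> 3 * c * (a\<^sup>2 + b\<^sup>2)"
proof -
  have "2 * (a * (c * (a + b))) = c * (2 * a\<^sup>2 + 2 * a * b)"
    by (simp add: power2_eq_square algebra_simps)
  also have "\<dots> \<le> c * (3 * (a\<^sup>2 + b\<^sup>2))"
    using order_trans[OF sum_squares_bound[of a b], of "a\<^sup>2 + 3 * b\<^sup>2"] assms(3)
    by (intro mult_left_mono) auto
  finally have "2 * (a * (c * (a + b))) \<le> 3 * c * (a\<^sup>2 + b\<^sup>2)" by (simp only: mult_ac)
  with assms(4) show ?thesis by linarith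
qed

lemma rotation_term_diff:
  fixes z w z' w' :: complex and a b C :: real
  assumes "\<bar>a\<bar> \<le> C" "\<bar>b\<bar> \<le> C" "norm w \<le> C" "norm z' \<le> C"
  shows "norm ((a *\<^sub>R w + b *\<^sub>R z + \<i> * complex_of_real (Im w) * z) -
      (a *\<^sub>R w' + b *\<^sub>R z' + \<i> * complex_of_real (Im w') * z')) \<le> 2 * C * (norm (z - z') + norm (w - w'))"
proof -
  have "(a *\<^sub>R w + b *\<^sub>R z + \<i> * complex_of_real (Im w) * z) -
      (a *\<^sub>R w' + b *\<^sub>R z' + \<i> * complex_of_real (Im w') * z')
    = a *\<^sub>R (w - w') + b *\<^sub>R (z - z') + (\<i> * complex_of_real (Im w) * (z - z')
       + \<i> * complex_of_real (Im (w - w')) * z')"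
    by (simp add: algebra_simps)
  also have "norm \<dots> \<le> \<bar>a\<bar> * norm (w - w') + \<bar>b\<bar> * norm (z - z') + (\<bar>Im w\<bar> * norm (z - z') + \<bar>Im (w - w')\<bar> * norm z')"
    by (intro order_trans[OF norm_triangle_ineq] add_mono) (auto simp: norm_mult simp del: minus_complex.sel)
  also have "\<dots> \<le> C * norm (w - w') + C * norm (z - z') + (C * norm (z - z') + norm (w - w') * C)"
    using assms abs_Im_le_cmod[of w] abs_Im_le_cmod[of "w - w'"]
    by (intro add_mono mult_right_mono mult_mono) auto
  finally show ?thesis by (simp add: algebra_simps)
qed

text \<open>
  On a compact set the two solutions and the coefficients are bounded, so that the difference of two
  right-hand sides is bounded by a multiple of the difference of the solutions. The squared
  differences then satisfy the hypotheses of \<open>characteristic_comparison\<close> with initial bound \<open>0\<close>.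
\<close>

lemma char_system_unique_half:
  fixes z w z' w' :: "real \<Rightarrow> real \<Rightarrow> complex"
  defines "D \<equiv> \<lambda>L. {p::real \<times> real. \<bar>fst p\<bar> \<le> L \<and> \<bar>snd p\<bar> \<le> L \<and> fst p + snd p \<ge> 0}"
  assumes cont: "continuous_on (D L) (\<lambda>p. al (fst p) (snd p))" "continuous_on (D L) (\<lambda>p. be (fst p) (snd p))"
      "continuous_on (D L) (\<lambda>p. z (fst p) (snd p))" "continuous_on (D L) (\<lambda>p. w (fst p) (snd p))"
      "continuous_on (D L) (\<lambda>p. z' (fst p) (snd p))" "continuous_on (D L) (\<lambda>p. w' (fst p) (snd p))"
    and sys: "\<And>u v. \<bar>u\<bar> \<le> L \<Longrightarrow> \<bar>v\<bar> \<le> L \<Longrightarrow> u + v > 0 \<Longrightarrow> char_system al be z w u v"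
      "\<And>u v. \<bar>u\<bar> \<le> L \<Longrightarrow> \<bar>v\<bar> \<le> L \<Longrightarrow> u + v > 0 \<Longrightarrow> char_system al be z' w' u v"
    and init: "\<And>v. \<bar>v\<bar> \<le> L \<Longrightarrow> z (-v) v = z' (-v) v \<and> w (-v) v = w' (-v) v"
    and uv: "\<bar>u\<bar> \<le> L" "\<bar>v\<bar> \<le> L" "u + v \<ge> 0"
  shows "z u v = z' u v \<and> w u v = w' u v"
proof -
  have D_eq: "D L = {p \<in> {-L..L} \<times> {-L..L}. fst p + snd p \<ge> 0}"
    by (auto simp: D_def)
  have "compact (D L)"
    unfolding D_eq Collect_conj_eq Collect_mem_eq
    by (intro compact_Int_closed compact_Times closed_Collect_le continuous_intros) auto
  have "continuous_on (D L) (\<lambda>p. \<bar>al (fst p) (snd p)\<bar> + \<bar>be (fst p) (snd p)\<bar> + norm (w (fst p) (snd p)) + norm (z (fst p) (snd p))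
     + norm (w' (fst p) (snd p)) + norm (z' (fst p) (snd p)))"
    by (intro continuous_intros cont)
  then have "bounded ((\<lambda>p. \<bar>al (fst p) (snd p)\<bar> + \<bar>be (fst p) (snd p)\<bar> + norm (w (fst p) (snd p)) + norm (z (fst p) (snd p))
     + norm (w' (fst p) (snd p)) + norm (z' (fst p) (snd p))) ` D L)"
    using \<open>compact (D L)\<close> by (intro compact_imp_bounded compact_continuous_image)
  then obtain C where C: "\<And>p. p \<in> D L \<Longrightarrow> norm (\<bar>al (fst p) (snd p)\<bar> + \<bar>be (fst p) (snd p)\<bar> + norm (w (fst p) (snd p)) + norm (z (fst p) (snd p))
     + norm (w' (fst p) (snd p)) + norm (z' (fst p) (snd p))) \<le> C"
    unfolding bounded_iff by auto
  have bd: "\<bar>al u v\<bar> \<le> C \<and> \<bar>be u v\<bar> \<le> C \<and> norm (w u v) \<le> C \<and> norm (z u v) \<le> C \<and> norm (w' u v) \<le> C \<and> norm (z' u v) \<le> C"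
    if "\<bar>u\<bar> \<le> L" "\<bar>v\<bar> \<le> L" "u + v > 0" for u v
  proof -
    have "norm (\<bar>al u v\<bar> + \<bar>be u v\<bar> + norm (w u v) + norm (z u v) + norm (w' u v) + norm (z' u v)) \<le> C"
      using that C[of "(u, v)"] by (simp add: D_def)
    then show ?thesis
      using norm_ge_zero[of "w u v"] norm_ge_zero[of "z u v"] norm_ge_zero[of "w' u v"] norm_ge_zero[of "z' u v"]
        abs_ge_zero[of "al u v"] abs_ge_zero[of "be u v"]
      unfolding real_norm_def by linarith
  qed
  have C0: "C \<ge> 0" using uv by (intro order_trans[OF norm_ge_zero C[of "(u, v)"]]) (auto simp: D_def)
  define P where "P u v = (norm (z u v - z' u v))\<^sup>2" for u v
  define M where "M u v = (norm (w u v - w' u v))\<^sup>2" for u v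
  have "P u v \<le> 0 * exp ((2*(6*C)+1) * (u + v)) \<and> M u v \<le> 0 * exp ((2*(6*C)+1) * (u + v))"
  proof (rule characteristic_comparison[of _ _ L])
    show "continuous_on {p. \<bar>fst p\<bar> \<le> L \<and> \<bar>snd p\<bar> \<le> L \<and> 0 \<le> fst p + snd p} (\<lambda>p. P (fst p) (snd p))"
      "continuous_on {p. \<bar>fst p\<bar> \<le> L \<and> \<bar>snd p\<bar> \<le> L \<and> 0 \<le> fst p + snd p} (\<lambda>p. M (fst p) (snd p))"
      unfolding P_def M_def by (intro continuous_intros cont[unfolded D_def])+
    fix u v assume uv: "\<bar>u\<bar> \<le> L" "\<bar>v\<bar> \<le> L" "u + v > 0"
    note b = bd[OF uv]
    show "\<exists>D. ((\<lambda>s. P s v) has_real_derivative D) (at u) \<and> D \<le> 6 * C * (P u v + M u v)"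
    proof (intro exI conjI)
      let ?d = "(al u v *\<^sub>R w u v + be u v *\<^sub>R z u v + \<i> * complex_of_real (Im (w u v)) * z u v) -
        (al u v *\<^sub>R w' u v + be u v *\<^sub>R z' u v + \<i> * complex_of_real (Im (w' u v)) * z' u v)"
      show "((\<lambda>s. P s v) has_real_derivative 2 * ((z u v - z' u v) \<bullet> ?d)) (at u)"
        unfolding P_def using sys(1)[OF uv] sys(2)[OF uv]
        by (intro norm_square_derivative has_vector_derivative_diff) (auto simp: char_system_def)
      have "\<bar>(z u v - z' u v) \<bullet> ?d\<bar> \<le> norm (z u v - z' u v) * (2 * C * (norm (z u v - z' u v) + norm (w u v - w' u v)))"
        using b by (intro order_trans[OF Cauchy_Schwarz_ineq2] mult_left_mono rotation_term_diff) auto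
      from quadratic_growth[OF _ _ _ this] C0
      show "2 * ((z u v - z' u v) \<bullet> ?d) \<le> 6 * C * (P u v + M u v)"
        by (simp add: P_def M_def)
    qed
    show "\<exists>D. ((\<lambda>s. M u s) has_real_derivative D) (at v) \<and> D \<le> 6 * C * (P u v + M u v)"
    proof (intro exI conjI)
      let ?d = "(be u v *\<^sub>R z u v + al u v *\<^sub>R w u v + \<i> * complex_of_real (Im (z u v)) * w u v) -
        (be u v *\<^sub>R z' u v + al u v *\<^sub>R w' u v + \<i> * complex_of_real (Im (z' u v)) * w' u v)"
      show "((\<lambda>s. M u s) has_real_derivative 2 * ((w u v - w' u v) \<bullet> ?d)) (at v)"
        unfolding M_def using sys(1)[OF uv] sys(2)[OF uv]
        by (intro norm_square_derivative has_vector_derivative_diff) (auto simp: char_system_def add.commute)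
      have "\<bar>(w u v - w' u v) \<bullet> ?d\<bar> \<le> norm (w u v - w' u v) * (2 * C * (norm (w u v - w' u v) + norm (z u v - z' u v)))"
        using b by (intro order_trans[OF Cauchy_Schwarz_ineq2] mult_left_mono rotation_term_diff) auto
      from quadratic_growth[OF _ _ _ this] C0
      show "2 * ((w u v - w' u v) \<bullet> ?d) \<le> 6 * C * (P u v + M u v)"
        by (simp add: P_def M_def add.commute)
    qed
  qed (use C0 uv init in \<open>auto simp: P_def M_def\<close>)
  then show ?thesis by (simp add: P_def M_def)
qed

text \<open>
  Time reversal maps the system to itself after a change of sign; the sign of \<open>z\<close> and \<open>w\<close>
  makes up for the reversed sense of rotation.
\<close>

lemma char_system_reflect:
  assumes "char_system al be z w (-v) (-u)"
  shows "char_system (\<lambda>u v. - be (-v) (-u)) (\<lambda>u v. - al (-v) (-u)) (\<lambda>u v. - w (-v) (-u)) (\<lambda>u v. - z (-v) (-u)) u v"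
proof -
  have 1: "((\<lambda>s. - w (- v) (- s)) has_vector_derivative
      - ((-1) *\<^sub>R (al (-v) (-u) *\<^sub>R w (-v) (-u) + be (-v) (-u) *\<^sub>R z (-v) (-u) + \<i> * complex_of_real (Im (z (-v) (-u))) * w (-v) (-u)))) (at u)"
    using assms unfolding char_system_def
    by (intro has_vector_derivative_minus vector_diff_chain_at[of uminus, unfolded o_def] derivative_intros)
      (auto intro!: derivative_eq_intros)
  have 2: "((\<lambda>s. - z (- s) (- u)) has_vector_derivative
      - ((-1) *\<^sub>R (al (-v) (-u) *\<^sub>R w (-v) (-u) + be (-v) (-u) *\<^sub>R z (-v) (-u) + \<i> * complex_of_real (Im (w (-v) (-u))) * z (-v) (-u)))) (at v)"
    using assms unfolding char_system_def
    by (intro has_vector_derivative_minus vector_diff_chain_at[of uminus _ _ "\<lambda>s. z s (-u)", unfolded o_def])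
      (auto intro!: derivative_eq_intros)
  show ?thesis using 1 2 by (simp add: char_system_def algebra_simps)
qed

lemma char_system_unique:
  fixes z w z' w' :: "real \<Rightarrow> real \<Rightarrow> complex"
  assumes cont: "C0_plane al" "C0_plane be" "C0_plane z" "C0_plane w" "C0_plane z'" "C0_plane w'"
    and sys: "\<And>u v. \<bar>u\<bar> \<le> L \<Longrightarrow> \<bar>v\<bar> \<le> L \<Longrightarrow> char_system al be z w u v"
      "\<And>u v. \<bar>u\<bar> \<le> L \<Longrightarrow> \<bar>v\<bar> \<le> L \<Longrightarrow> char_system al be z' w' u v"
    and init: "\<And>v. \<bar>v\<bar> \<le> L \<Longrightarrow> z (-v) v = z' (-v) v \<and> w (-v) v = w' (-v) v"
    and uv: "\<bar>u\<bar> \<le> L" "\<bar>v\<bar> \<le> L"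
  shows "z u v = z' u v \<and> w u v = w' u v"
proof (cases "u + v \<ge> 0")
  case True
  show ?thesis
    by (rule char_system_unique_half[where al = al and be = be and L = L])
      (use True init uv sys in \<open>auto intro!: cont[THEN C0_plane_compose] continuous_intros\<close>)
next
  case False
  have "- w (-(-u)) (-(-v)) = - w' (-(-u)) (-(-v)) \<and> - z (-(-u)) (-(-v)) = - z' (-(-u)) (-(-v))"
    by (rule char_system_unique_half[where al = "\<lambda>u v. - be (-v) (-u)" and be = "\<lambda>u v. - al (-v) (-u)" and L = L
        and z = "\<lambda>u v. - w (-v) (-u)" and w = "\<lambda>u v. - z (-v) (-u)" and z' = "\<lambda>u v. - w' (-v) (-u)" and w' = "\<lambda>u v. - z' (-v) (-u)"])
      (use False init uv sys in \<open>auto intro!: char_system_reflect cont[THEN C0_plane_compose] continuous_intros\<close>)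
  then show ?thesis by simp
qed

text \<open>
  Projection onto a ball centred at the origin only rescales vectors. A rotation term that is truncated by this
  projection is therefore still perpendicular to the vector that it acts on.
\<close>

lemma closest_point_cball_0:
  fixes x :: "'a::euclidean_space"
  assumes "M \<ge> 0"
  obtains k where "closest_point (cball 0 M) x = k *\<^sub>R x"
proof (cases "norm x \<le> M")
  case True
  then show ?thesis by (intro that[of 1]) (simp add: closest_point_self)
next
  case False
  have "(M / norm x) *\<^sub>R x = closest_point (cball 0 M) x"
  proof (rule closest_point_unique)
    show "\<forall>y\<in>cball 0 M. dist x ((M / norm x) *\<^sub>R x) \<le> dist x y"
    proof
      fix y :: 'a assume y: "y \<in> cball 0 M"
      have [simp]: "x - (M / norm x) *\<^sub>R x = (1 - M / norm x) *\<^sub>R x" by (simp add: algebra_simps)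
      have "dist x ((M / norm x) *\<^sub>R x) = norm x - M"
      proof -
        have "x \<noteq> 0" "M / norm x \<le> 1" using False assms by (auto simp: divide_le_eq)
        then show ?thesis by (simp add: dist_norm left_diff_distrib)
      qed
      also have "\<dots> \<le> norm x - norm y" using y by simp
      also have "\<dots> \<le> dist x y" by (simp add: dist_norm norm_triangle_ineq2)
      finally show "dist x ((M / norm x) *\<^sub>R x) \<le> dist x y" .
    qed
  qed (use False assms in auto)
  then show ?thesis by (intro that[of "M / norm x"]) simp
qed

text \<open>
  The bound \<open>M\<close> on \<open>|z|\<close> and \<open>|w|\<close> depends on the data and on the linear coefficients only, because
  the rotation terms do not contribute to it, truncated or not. It can therefore be chosen before
  the truncation, which it then renders inactive on the square.
\<close>

lemma char_system_square_exists:
  fixes z0 w0 :: "real \<Rightarrow> complex"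
  assumes al: "C0_plane al" and be: "C0_plane be" and cz0: "continuous_on UNIV z0" and cw0: "continuous_on UNIV w0"
    and L: "L \<ge> 0"
  obtains z w where "C0_plane z" "C0_plane w"
    "\<And>u v. \<bar>u\<bar> \<le> L \<Longrightarrow> \<bar>v\<bar> \<le> L \<Longrightarrow> char_system al be z w u v"
    "\<And>v. \<bar>v\<bar> \<le> L \<Longrightarrow> z (-v) v = z0 v \<and> w (-v) v = w0 v"
proof -
  define c where "c x = max (-L) (min L x)" for x
  have cc: "continuous_on S c" for S unfolding c_def by (intro continuous_intros)
  have cL: "\<bar>c x\<bar> \<le> L" for x using L by (auto simp: c_def)
  have c_id: "c x = x" if "\<bar>x\<bar> \<le> L" for x using that by (auto simp: c_def)
  \<comment> \<open>Clamping makes the coefficients bounded on the plane and changes nothing on the square.\<close>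
  define a where "a u v = al (c u) (c v)" for u v
  define b where "b u v = be (c u) (c v)" for u v
  have comp: "continuous_on S (\<lambda>x. c (f x))" if "continuous_on S f" for S and f :: "'x::topological_space \<Rightarrow> real"
    by (rule continuous_on_compose2[OF cc that]) auto
  have ca: "C0_plane a" and cb: "C0_plane b"
    unfolding C0_plane_def a_def b_def by (intro C0_plane_compose[OF al] C0_plane_compose[OF be] comp continuous_intros)+
  obtain A where A: "\<And>u v. \<bar>a u v\<bar> \<le> A" "\<And>u v. \<bar>b u v\<bar> \<le> A"
  proof -
    have "bounded ((\<lambda>p. \<bar>al (fst p) (snd p)\<bar> + \<bar>be (fst p) (snd p)\<bar>) ` ({-L..L} \<times> {-L..L}))"
      by (intro compact_imp_bounded compact_continuous_image compact_Times continuous_intros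
          C0_plane_compose[OF al] C0_plane_compose[OF be]) auto
    then obtain A where A: "\<And>p. p \<in> {-L..L} \<times> {-L..L} \<Longrightarrow> norm (\<bar>al (fst p) (snd p)\<bar> + \<bar>be (fst p) (snd p)\<bar>) \<le> A"
      unfolding bounded_iff by blast
    have "\<bar>a u v\<bar> + \<bar>b u v\<bar> \<le> A" for u v
    proof -
      have "(c u, c v) \<in> {-L..L} \<times> {-L..L}" using cL[of u] cL[of v] by auto
      from A[OF this] show ?thesis by (simp add: a_def b_def)
    qed
    then show ?thesis
      by (intro that[of A]) (meson abs_ge_zero add_increasing add_increasing2 le_add_same_cancel1 le_add_same_cancel2 order_trans)+
  qed
  have A0: "A \<ge> 0" using A(1)[of 0 0] by linarith
  obtain B where B: "\<And>v. norm (z0 (c v)) \<le> B" "\<And>v. norm (w0 (c v)) \<le> B"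
  proof -
    have "bounded ((\<lambda>p. norm (z0 p) + norm (w0 p)) ` {-L..L})"
      by (intro compact_imp_bounded compact_continuous_image continuous_intros
          continuous_on_subset[OF cz0] continuous_on_subset[OF cw0]) auto
    then obtain A where A: "\<And>p. p \<in> {-L..L} \<Longrightarrow> norm (norm (z0 p) + norm (w0 p)) \<le> A"
      unfolding bounded_iff by blast
    have "norm (z0 (c v)) + norm (w0 (c v)) \<le> A" for v
    proof -
      have "c v \<in> {-L..L}" using cL[of v] by auto
      from A[OF this] show ?thesis by simp
    qed
    then show ?thesis
      by (intro that[of A]) (meson norm_ge_zero le_add_same_cancel1 le_add_same_cancel2 order_trans)+
  qed
  have B0: "B \<ge> 0" by (rule order_trans[OF norm_ge_zero B(1)])
  define K where "K = 3 * A"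
  \<comment> \<open>\<open>M\<^sup>2\<close> is the comparison bound \<open>B\<^sup>2 exp ((2 K + 1) |u + v|)\<close> at the corners, where \<open>|u + v| = 2 L\<close>.\<close>
  define M where "M = B * exp ((2*K+1) * L)"
  have M0: "M \<ge> 0" using B0 by (simp add: M_def)
  define trunc where "trunc = closest_point (cball (0::complex) M)"
  have trunc_lip: "norm (trunc x - trunc y) \<le> norm (x - y)" for x y
    using closest_point_lipschitz[of "cball (0::complex) M" x y] M0 by (simp add: trunc_def dist_norm)
  have trunc_bd: "norm (trunc x) \<le> M" for x
    using closest_point_in_set[of "cball (0::complex) M" x] M0 by (simp add: trunc_def)
  have trunc_id: "trunc x = x" if "norm x \<le> M" for x
    using that by (simp add: trunc_def closest_point_self)
  have trunc_orth: "x \<bullet> (\<i> * complex_of_real r * trunc x) = 0" for x r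
  proof -
    obtain k where "trunc x = k *\<^sub>R x" using closest_point_cball_0[OF M0] unfolding trunc_def by blast
    then show ?thesis by (simp add: inner_complex_def algebra_simps)
  qed
  have trunc_cont: "continuous_on S (\<lambda>x. trunc (f x))" if "continuous_on S f" for S and f :: "'x::topological_space \<Rightarrow> complex"
  proof (rule continuous_on_compose2[OF _ that])
    show "continuous_on UNIV trunc"
      unfolding trunc_def by (rule continuous_on_closest_point) (use M0 in auto)
  qed auto
  have rot_lip: "norm (\<i> * complex_of_real (Im (trunc y)) * trunc x - \<i> * complex_of_real (Im (trunc y')) * trunc x')
      \<le> M * (norm (x - x') + norm (y - y'))" for x y x' y'
  proof -
    have "\<i> * complex_of_real (Im (trunc y)) * trunc x - \<i> * complex_of_real (Im (trunc y')) * trunc x'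
      = \<i> * complex_of_real (Im (trunc y)) * (trunc x - trunc x') + \<i> * complex_of_real (Im (trunc y - trunc y')) * trunc x'"
      by (simp add: algebra_simps)
    also have "norm \<dots> \<le> \<bar>Im (trunc y)\<bar> * norm (trunc x - trunc x') + \<bar>Im (trunc y - trunc y')\<bar> * norm (trunc x')"
      by (intro order_trans[OF norm_triangle_ineq] add_mono) (auto simp: norm_mult simp del: minus_complex.sel)
    also have "\<dots> \<le> M * norm (x - x') + norm (y - y') * M"
      by (intro add_mono mult_mono order_trans[OF abs_Im_le_cmod] trunc_bd trunc_lip) (use M0 in auto)
    finally show ?thesis by (simp add: algebra_simps)
  qed
  define F where "F u v x y = a u v *\<^sub>R y + b u v *\<^sub>R x + \<i> * complex_of_real (Im (trunc y)) * trunc x" for u v x y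
  define G where "G u v x y = a u v *\<^sub>R y + b u v *\<^sub>R x + \<i> * complex_of_real (Im (trunc x)) * trunc y" for u v x y
  have lin_lip: "norm ((a u v *\<^sub>R y + b u v *\<^sub>R x) - (a u v *\<^sub>R y' + b u v *\<^sub>R x')) \<le> A * (norm (x - x') + norm (y - y'))" for u v x y x' y'
  proof -
    have "(a u v *\<^sub>R y + b u v *\<^sub>R x) - (a u v *\<^sub>R y' + b u v *\<^sub>R x') = a u v *\<^sub>R (y - y') + b u v *\<^sub>R (x - x')"
      by (simp add: algebra_simps)
    also have "norm \<dots> \<le> A * norm (y - y') + A * norm (x - x')"
      by (intro order_trans[OF norm_triangle_ineq] add_mono) (auto intro!: mult_right_mono A)
    finally show ?thesis by (simp add: algebra_simps)
  qed
  have FL: "norm (F u v x y - F u v x' y') \<le> (A + M + 1) * (norm (x - x') + norm (y - y'))" for u v x y x' y'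
  proof -
    have "norm (F u v x y - F u v x' y') \<le> A * (norm (x - x') + norm (y - y')) + M * (norm (x - x') + norm (y - y'))"
    proof -
      have "F u v x y - F u v x' y' = ((a u v *\<^sub>R y + b u v *\<^sub>R x) - (a u v *\<^sub>R y' + b u v *\<^sub>R x'))
          + (\<i> * complex_of_real (Im (trunc y)) * trunc x - \<i> * complex_of_real (Im (trunc y')) * trunc x')"
        by (simp add: F_def)
      then show ?thesis
        by (simp only: order_trans[OF norm_triangle_ineq add_mono[OF lin_lip rot_lip]])
    qed
    also have "\<dots> \<le> (A + M + 1) * (norm (x - x') + norm (y - y'))" by (simp add: algebra_simps)
    finally show ?thesis .
  qed
  have GL: "norm (G u v x y - G u v x' y') \<le> (A + M + 1) * (norm (x - x') + norm (y - y'))" for u v x y x' y'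
  proof -
    have "norm (G u v x y - G u v x' y') \<le> A * (norm (x - x') + norm (y - y')) + M * (norm (y - y') + norm (x - x'))"
    proof -
      have "G u v x y - G u v x' y' = ((a u v *\<^sub>R y + b u v *\<^sub>R x) - (a u v *\<^sub>R y' + b u v *\<^sub>R x'))
          + (\<i> * complex_of_real (Im (trunc x)) * trunc y - \<i> * complex_of_real (Im (trunc x')) * trunc y')"
        by (simp add: G_def)
      then show ?thesis
        by (simp only: order_trans[OF norm_triangle_ineq add_mono[OF lin_lip rot_lip]])
    qed
    also have "\<dots> \<le> (A + M + 1) * (norm (x - x') + norm (y - y'))" by (simp add: algebra_simps)
    finally show ?thesis .
  qed
  have cF: "continuous_on UNIV (\<lambda>q. F (fst (fst q)) (snd (fst q)) (fst (snd q)) (snd (snd q)))"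
    and cG: "continuous_on UNIV (\<lambda>q. G (fst (fst q)) (snd (fst q)) (fst (snd q)) (snd (snd q)))"
    unfolding F_def G_def by (intro continuous_intros C0_plane_compose[OF ca] C0_plane_compose[OF cb] trunc_cont)+
  have FG0: "F u v 0 0 = 0" "G u v 0 0 = 0" for u v
    using trunc_id[of 0] M0 by (simp_all add: F_def G_def)
  have cd: "continuous_on UNIV (\<lambda>v. z0 (c v))" "continuous_on UNIV (\<lambda>u. w0 (c (- u)))"
    by (intro continuous_on_compose2[OF cz0] continuous_on_compose2[OF cw0] comp continuous_intros; simp)+
  have pos: "A + M + 1 > 0" using A0 M0 by simp
  obtain z w where zw: "C0_plane z" "C0_plane w"
    and zeq: "\<And>u v. z u v = z0 (c v) + oriented_integral (\<lambda>s. F s v (z s v) (w s v)) (-v) u"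
    and weq: "\<And>u v. w u v = w0 (c (-u)) + oriented_integral (\<lambda>s. G u s (z u s) (w u s)) (-u) v"
    by (rule characteristic_picard[OF cF cG FG0 FL GL pos cd(1) B(1) cd(2) B(2)]) (rule that)
  have zd: "((\<lambda>s. z s v) has_vector_derivative F u v (z u v) (w u v)) (at u)" for u v
  proof -
    have "continuous_on UNIV (\<lambda>s. F s v (z s v) (w s v))"
      unfolding F_def by (intro continuous_intros C0_plane_compose[OF ca] C0_plane_compose[OF cb] trunc_cont C0_plane_compose[OF zw(1)] C0_plane_compose[OF zw(2)])
    then have D: "((\<lambda>u. z0 (c v) + oriented_integral (\<lambda>s. F s v (z s v) (w s v)) (-v) u) has_vector_derivative 0 + F u v (z u v) (w u v)) (at u)"
      by (intro has_vector_derivative_add has_vector_derivative_const oriented_integral_has_derivative)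
    have eq: "(\<lambda>s. z s v) = (\<lambda>u. z0 (c v) + oriented_integral (\<lambda>s. F s v (z s v) (w s v)) (-v) u)"
      by (rule ext) (rule zeq)
    show ?thesis by (subst eq) (use D in \<open>simp only: add_0\<close>)
  qed
  have wd: "((\<lambda>s. w u s) has_vector_derivative G u v (z u v) (w u v)) (at v)" for u v
  proof -
    have "continuous_on UNIV (\<lambda>s. G u s (z u s) (w u s))"
      unfolding G_def by (intro continuous_intros C0_plane_compose[OF ca] C0_plane_compose[OF cb] trunc_cont C0_plane_compose[OF zw(1)] C0_plane_compose[OF zw(2)])
    then have D: "((\<lambda>v. w0 (c (-u)) + oriented_integral (\<lambda>s. G u s (z u s) (w u s)) (-u) v) has_vector_derivative 0 + G u v (z u v) (w u v)) (at v)"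
      by (intro has_vector_derivative_add has_vector_derivative_const oriented_integral_has_derivative)
    have eq: "(\<lambda>s. w u s) = (\<lambda>v. w0 (c (-u)) + oriented_integral (\<lambda>s. G u s (z u s) (w u s)) (-u) v)"
      by (rule ext) (rule weq)
    show ?thesis by (subst eq) (use D in \<open>simp only: add_0\<close>)
  qed
  have lin_bd: "norm (a u v *\<^sub>R y + b u v *\<^sub>R x) \<le> A * (norm x + norm y)" for u v x y
    using lin_lip[of u v y x 0 0] by simp
  \<comment> \<open>By \<open>trunc_orth\<close> only the linear terms contribute to the growth of \<open>|z|\<^sup>2\<close> and \<open>|w|\<^sup>2\<close>.\<close>
  have apriori: "norm (z u v) \<le> M \<and> norm (w u v) \<le> M" if uv: "\<bar>u\<bar> \<le> L" "\<bar>v\<bar> \<le> L" for u v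
  proof -
    have "(norm (z u v))\<^sup>2 \<le> B\<^sup>2 * exp ((2*K+1) * \<bar>u + v\<bar>) \<and> (norm (w u v))\<^sup>2 \<le> B\<^sup>2 * exp ((2*K+1) * \<bar>u + v\<bar>)"
    proof (rule characteristic_comparison_two_sided[OF _ _ _ _ _ _ _ uv])
      show "C0_plane (\<lambda>u v. (norm (z u v))\<^sup>2)" "C0_plane (\<lambda>u v. (norm (w u v))\<^sup>2)"
        unfolding C0_plane_def by (intro continuous_intros C0_plane_compose[OF zw(1)] C0_plane_compose[OF zw(2)])+
      fix u v
      show "\<exists>D. ((\<lambda>s. (norm (z s v))\<^sup>2) has_real_derivative D) (at u) \<and> \<bar>D\<bar> \<le> K * ((norm (z u v))\<^sup>2 + (norm (w u v))\<^sup>2)"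
      proof (intro exI conjI)
        show "((\<lambda>s. (norm (z s v))\<^sup>2) has_real_derivative 2 * (z u v \<bullet> F u v (z u v) (w u v))) (at u)"
          by (rule norm_square_derivative[OF zd])
        have "\<bar>z u v \<bullet> F u v (z u v) (w u v)\<bar> \<le> norm (z u v) * (A * (norm (z u v) + norm (w u v)))"
          unfolding F_def inner_add_right[of "z u v" "_ + _"] trunc_orth
          using order_trans[OF Cauchy_Schwarz_ineq2 mult_left_mono[OF lin_bd]] by simp
        from quadratic_growth[OF _ _ _ this]
        show "\<bar>2 * (z u v \<bullet> F u v (z u v) (w u v))\<bar> \<le> K * ((norm (z u v))\<^sup>2 + (norm (w u v))\<^sup>2)"
          using A0 by (simp add: K_def)
      qed
      show "\<exists>D. ((\<lambda>s. (norm (w u s))\<^sup>2) has_real_derivative D) (at v) \<and> \<bar>D\<bar> \<le> K * ((norm (z u v))\<^sup>2 + (norm (w u v))\<^sup>2)"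
      proof (intro exI conjI)
        show "((\<lambda>s. (norm (w u s))\<^sup>2) has_real_derivative 2 * (w u v \<bullet> G u v (z u v) (w u v))) (at v)"
          by (rule norm_square_derivative[OF wd])
        have "\<bar>w u v \<bullet> G u v (z u v) (w u v)\<bar> \<le> norm (w u v) * (A * (norm (w u v) + norm (z u v)))"
          unfolding G_def inner_add_right[of "w u v" "_ + _"] trunc_orth
          using order_trans[OF Cauchy_Schwarz_ineq2 mult_left_mono[OF lin_bd]] by (simp add: add.commute)
        from quadratic_growth[OF _ _ _ this]
        show "\<bar>2 * (w u v \<bullet> G u v (z u v) (w u v))\<bar> \<le> K * ((norm (z u v))\<^sup>2 + (norm (w u v))\<^sup>2)"
          using A0 by (simp add: K_def add.commute)
      qed
      show "(norm (z (- v) v))\<^sup>2 \<le> B\<^sup>2 \<and> (norm (w (- v) v))\<^sup>2 \<le> B\<^sup>2"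
        using zeq[of "-v" v] weq[of "-v" v] B by (simp add: power_mono)
    qed (use A0 in \<open>auto simp: K_def\<close>)
    moreover have "B\<^sup>2 * exp ((2*K+1) * \<bar>u + v\<bar>) \<le> M\<^sup>2"
    proof -
      have "B\<^sup>2 * exp ((2*K+1) * \<bar>u + v\<bar>) \<le> B\<^sup>2 * exp ((2*K+1) * (2 * L))"
        using uv A0 by (intro mult_left_mono) (auto simp: K_def intro!: mult_left_mono)
      also have "\<dots> = M\<^sup>2"
        by (simp add: M_def power_mult_distrib mult_ac flip: exp_of_nat_mult)
      finally show ?thesis .
    qed
    ultimately show ?thesis using M0 by (meson order_trans power2_le_imp_le)
  qed
  show ?thesis
  proof (rule that[OF zw])
    show "char_system al be z w u v" if "\<bar>u\<bar> \<le> L" "\<bar>v\<bar> \<le> L" for u v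
      using zd[of v u] wd[of u v] apriori[OF that] that
      by (simp add: char_system_def F_def G_def trunc_id a_def b_def c_id)
    show "z (- v) v = z0 v \<and> w (- v) v = w0 v" if "\<bar>v\<bar> \<le> L" for v
      using zeq[of "-v" v] weq[of "-v" v] that by (simp add: c_id)
  qed
qed

text \<open>
  Solutions on different squares agree on the smaller one, which makes it possible to use at each
  point any square that contains it in its interior.
\<close>

lemma char_system_exists:
  fixes z0 w0 :: "real \<Rightarrow> complex"
  assumes al: "C0_plane al" and be: "C0_plane be" and cz0: "continuous_on UNIV z0" and cw0: "continuous_on UNIV w0"
  obtains z w where "C0_plane z" "C0_plane w" "\<And>u v. char_system al be z w u v"
    "\<And>v. z (-v) v = z0 v" "\<And>v. w (-v) v = w0 v"
proof -
  have "\<forall>n::nat. \<exists>z w. C0_plane z \<and> C0_plane w \<and> (\<forall>u v. \<bar>u\<bar> \<le> real n \<longrightarrow> \<bar>v\<bar> \<le> real n \<longrightarrow> char_system al be z w u v)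
      \<and> (\<forall>v. \<bar>v\<bar> \<le> real n \<longrightarrow> z (-v) v = z0 v \<and> w (-v) v = w0 v)"
  proof
    fix n
    show "\<exists>z w. C0_plane z \<and> C0_plane w \<and> (\<forall>u v. \<bar>u\<bar> \<le> real n \<longrightarrow> \<bar>v\<bar> \<le> real n \<longrightarrow> char_system al be z w u v)
      \<and> (\<forall>v. \<bar>v\<bar> \<le> real n \<longrightarrow> z (-v) v = z0 v \<and> w (-v) v = w0 v)"
    proof (rule char_system_square_exists[OF assms, of "real n"])
      fix z w
      assume a: "C0_plane z" "C0_plane w"
        "\<And>u v. \<bar>u\<bar> \<le> real n \<Longrightarrow> \<bar>v\<bar> \<le> real n \<Longrightarrow> char_system al be z w u v"
        "\<And>v. \<bar>v\<bar> \<le> real n \<Longrightarrow> z (-v) v = z0 v \<and> w (-v) v = w0 v"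
      show ?thesis
        by (intro exI[of _ z] exI[of _ w] conjI allI impI a a(4)[THEN conjunct1] a(4)[THEN conjunct2])
    qed simp
  qed
  then obtain Z W where Z: "\<And>n. C0_plane (Z n)" and W: "\<And>n. C0_plane (W n)"
    and sys: "\<And>n u v. \<bar>u\<bar> \<le> real n \<Longrightarrow> \<bar>v\<bar> \<le> real n \<Longrightarrow> char_system al be (Z n) (W n) u v"
    and init: "\<And>n v. \<bar>v\<bar> \<le> real n \<Longrightarrow> Z n (-v) v = z0 v \<and> W n (-v) v = w0 v"
    by metis
  define N where "N u v = nat \<lceil>max \<bar>u\<bar> \<bar>v\<bar>\<rceil> + 1" for u v :: real
  have N: "\<bar>u\<bar> < real (N u v) \<and> \<bar>v\<bar> < real (N u v)" for u v
  proof -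
    have "max \<bar>u\<bar> \<bar>v\<bar> \<le> real (nat \<lceil>max \<bar>u\<bar> \<bar>v\<bar>\<rceil>)" by (rule of_nat_ceiling)
    then have "\<bar>u\<bar> \<le> real (nat \<lceil>max \<bar>u\<bar> \<bar>v\<bar>\<rceil>)" "\<bar>v\<bar> \<le> real (nat \<lceil>max \<bar>u\<bar> \<bar>v\<bar>\<rceil>)"
      unfolding max.bounded_iff by blast+
    moreover have "real (nat \<lceil>max \<bar>u\<bar> \<bar>v\<bar>\<rceil>) < real (N u v)" unfolding N_def by simp
    ultimately show ?thesis by (blast intro: le_less_trans)
  qed
  define z where "z u v = Z (N u v) u v" for u v
  define w where "w u v = W (N u v) u v" for u v
  have agree: "z u v = Z n u v \<and> w u v = W n u v" if "\<bar>u\<bar> \<le> real n" "\<bar>v\<bar> \<le> real n" for n u v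
    unfolding z_def w_def
  proof (rule char_system_unique[where al = al and be = be and z = "Z (N u v)" and w = "W (N u v)"
        and z' = "Z n" and w' = "W n" and L = "min (real n) (real (N u v))"])
    show "C0_plane al" "C0_plane be" "C0_plane (Z (N u v))" "C0_plane (W (N u v))" "C0_plane (Z n)" "C0_plane (W n)"
      by (fact al be Z W)+
  qed (use that N[of u v] sys init in \<open>auto simp: less_imp_le\<close>)
  have cz: "C0_plane z" and cw: "C0_plane w"
  proof -
    have "isCont (\<lambda>p. z (fst p) (snd p)) p \<and> isCont (\<lambda>p. w (fst p) (snd p)) p" for p
    proof -
      define n where "n = N (fst p) (snd p)"
      let ?S = "{-real n<..<real n} \<times> {-real n<..<real n}"
      have "open ?S" "p \<in> ?S"
        using N[of "fst p" "snd p"] by (auto simp: n_def open_Times mem_Times_iff abs_less_iff)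
      moreover have "z (fst q) (snd q) = Z n (fst q) (snd q)" "w (fst q) (snd q) = W n (fst q) (snd q)" if "q \<in> ?S" for q
        using agree[of "fst q" n "snd q"] that by auto
      ultimately have "\<forall>\<^sub>F q in nhds p. z (fst q) (snd q) = Z n (fst q) (snd q)" "\<forall>\<^sub>F q in nhds p. w (fst q) (snd q) = W n (fst q) (snd q)"
        by (auto elim!: eventually_mono[OF eventually_nhds_in_open])
      moreover have "isCont (\<lambda>p. Z n (fst p) (snd p)) p" "isCont (\<lambda>p. W n (fst p) (snd p)) p"
        using Z W unfolding C0_plane_def continuous_on_eq_continuous_at[OF open_UNIV] by blast+
      ultimately show ?thesis by (simp add: isCont_cong)
    qed
    then show "C0_plane z" "C0_plane w" by (simp_all add: C0_plane_def continuous_on_eq_continuous_at)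
  qed
  have "char_system al be z w u v" for u v
  proof -
    define n where "n = N u v"
    have n: "\<bar>u\<bar> < real n" "\<bar>v\<bar> < real n" using N by (simp_all add: n_def)
    have eq: "z u v = Z n u v" "w u v = W n u v" using agree[of u n v] n by auto
    have s: "char_system al be (Z n) (W n) u v" using sys n by (simp add: less_imp_le)
    have "((\<lambda>s. z s v) has_vector_derivative
        al u v *\<^sub>R W n u v + be u v *\<^sub>R Z n u v + \<i> * complex_of_real (Im (W n u v)) * Z n u v) (at u)"
      by (rule has_vector_derivative_transform_within_open[where f = "\<lambda>s. Z n s v" and S = "{-real n<..<real n}"])
          (use s n agree[of _ n v] in \<open>auto simp: char_system_def abs_less_iff\<close>)
    moreover have "((\<lambda>s. w u s) has_vector_derivative
        al u v *\<^sub>R W n u v + be u v *\<^sub>R Z n u v + \<i> * complex_of_real (Im (Z n u v)) * W n u v) (at v)"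
        by (rule has_vector_derivative_transform_within_open[where f = "\<lambda>s. W n u s" and S = "{-real n<..<real n}"])
          (use s n agree[of u n] in \<open>auto simp: char_system_def abs_less_iff\<close>)
    ultimately show ?thesis by (simp add: char_system_def eq)
  qed
  moreover have "z (-v) v = z0 v" "w (-v) v = w0 v" for v
    using init[of v "N (-v) v"] N[of "-v" v] by (auto simp: z_def w_def less_imp_le)
  ultimately show ?thesis using that cz cw by blast
qed

section \<open>Differentiability of solutions of the characteristic system\<close>

lemma C1_plane_swap:
  assumes "C1_plane f f1 f2"
  shows "C1_plane (\<lambda>u v. f v u) (\<lambda>u v. f2 v u) (\<lambda>u v. f1 v u)"
proof (rule C1_planeI)
  have "C0_plane f1" "C0_plane f2" using assms by (auto simp: C1_plane_def)
  then show "C0_plane (\<lambda>u v. f2 v u)" "C0_plane (\<lambda>u v. f1 v u)"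
    unfolding C0_plane_def[of "\<lambda>u v. f2 v u"] C0_plane_def[of "\<lambda>u v. f1 v u"]
    by (auto intro!: C0_plane_compose continuous_intros)
qed (rule C1_plane_partials[OF assms])+

lemma C1_plane_linear:
  assumes "C1_plane f f1 f2" "bounded_linear L"
  shows "C1_plane (\<lambda>u v. L (f u v)) (\<lambda>u v. L (f1 u v)) (\<lambda>u v. L (f2 u v))"
proof (rule C1_planeI)
  show "C0_plane (\<lambda>u v. L (f1 u v))" "C0_plane (\<lambda>u v. L (f2 u v))"
    using assms(1) unfolding C1_plane_def C0_plane_def
    by (auto intro!: bounded_linear.continuous_on[OF assms(2)])
qed (intro bounded_linear.has_vector_derivative[OF assms(2)] C1_plane_partials[OF assms(1)])+

lemma C1_plane_add:
  assumes "C1_plane f f1 f2" "C1_plane g g1 g2"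
  shows "C1_plane (\<lambda>u v. f u v + g u v) (\<lambda>u v. f1 u v + g1 u v) (\<lambda>u v. f2 u v + g2 u v)"
proof (rule C1_planeI)
  show "C0_plane (\<lambda>u v. f1 u v + g1 u v)" "C0_plane (\<lambda>u v. f2 u v + g2 u v)"
    using assms unfolding C1_plane_def C0_plane_def by (auto intro!: continuous_intros)
qed (intro has_vector_derivative_add C1_plane_partials[OF assms(1)] C1_plane_partials[OF assms(2)])+

lemma C1_plane_diff:
  assumes "C1_plane f f1 f2" "C1_plane g g1 g2"
  shows "C1_plane (\<lambda>u v. f u v - g u v) (\<lambda>u v. f1 u v - g1 u v) (\<lambda>u v. f2 u v - g2 u v)"
proof (rule C1_planeI)
  show "C0_plane (\<lambda>u v. f1 u v - g1 u v)" "C0_plane (\<lambda>u v. f2 u v - g2 u v)"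
    using assms unfolding C1_plane_def C0_plane_def by (auto intro!: continuous_intros)
qed (intro has_vector_derivative_diff C1_plane_partials[OF assms(1)] C1_plane_partials[OF assms(2)])+

lemma C1_plane_mult:
  fixes f g :: "real \<Rightarrow> real \<Rightarrow> 'a::real_normed_algebra"
  assumes "C1_plane f f1 f2" "C1_plane g g1 g2"
  shows "C1_plane (\<lambda>u v. f u v * g u v) (\<lambda>u v. f u v * g1 u v + f1 u v * g u v)
    (\<lambda>u v. f u v * g2 u v + f2 u v * g u v)"
proof (rule C1_planeI)
  show "C0_plane (\<lambda>u v. f u v * g1 u v + f1 u v * g u v)" "C0_plane (\<lambda>u v. f u v * g2 u v + f2 u v * g u v)"
    using assms C1_plane_imp_C0_plane[OF assms(1)] C1_plane_imp_C0_plane[OF assms(2)] unfolding C1_plane_def C0_plane_def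
    by (auto intro!: continuous_intros)
qed (intro has_vector_derivative_mult C1_plane_partials[OF assms(1)] C1_plane_partials[OF assms(2)])+

lemma C1_plane_chain:
  fixes f :: "real \<Rightarrow> real \<Rightarrow> 'a::real_normed_field"
  assumes f: "C1_plane f f1 f2"
    and g: "\<And>x. (g has_field_derivative g' x) (at x)" and g': "continuous_on UNIV g'"
  shows "C1_plane (\<lambda>u v. g (f u v)) (\<lambda>u v. f1 u v * g' (f u v)) (\<lambda>u v. f2 u v * g' (f u v))"
proof (rule C1_planeI)
  show "C0_plane (\<lambda>u v. f1 u v * g' (f u v))" "C0_plane (\<lambda>u v. f2 u v * g' (f u v))"
    using f C1_plane_imp_C0_plane[OF f] unfolding C1_plane_def C0_plane_def
    by (auto intro!: continuous_intros continuous_on_compose2[OF g'])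
  show "((\<lambda>s. g (f s v)) has_vector_derivative f1 u v * g' (f u v)) (at u)" for u v
    using field_vector_diff_chain_at[OF C1_plane_partials(1)[OF f] g] by (simp add: o_def)
  show "((\<lambda>s. g (f u s)) has_vector_derivative f2 u v * g' (f u v)) (at v)" for u v
    using field_vector_diff_chain_at[OF C1_plane_partials(2)[OF f] g] by (simp add: o_def)
qed

lemmas C1_plane_exp = C1_plane_chain[OF _ DERIV_exp continuous_on_exp[OF continuous_on_id]]

lemma C1_plane_oriented_integral:
  assumes "C0_plane f" "C0_plane f2" "\<And>u v. ((\<lambda>v. f u v) has_vector_derivative f2 u v) (at v)"
  shows "C1_plane (\<lambda>u v. oriented_integral (\<lambda>s. f s v) 0 u) f (\<lambda>u v. oriented_integral (\<lambda>s. f2 s v) 0 u)"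
proof (rule C1_planeI)
  show "C0_plane (\<lambda>u v. oriented_integral (\<lambda>s. f2 s v) 0 u)"
    unfolding C0_plane_def by (intro continuous_oriented_integral C0_plane_compose[OF assms(2)] continuous_intros)
  show "((\<lambda>s. oriented_integral (\<lambda>s. f s v) 0 s) has_vector_derivative f u v) (at u)" for u v
    by (intro oriented_integral_has_derivative C0_plane_compose[OF assms(1)] continuous_intros)
  show "((\<lambda>s. oriented_integral (\<lambda>r. f r s) 0 u) has_vector_derivative oriented_integral (\<lambda>s. f2 s v) 0 u) (at v)" for u v
    by (rule oriented_integral_param_derivative[OF assms])
qed (rule assms)

text \<open>
  With the integrating factor \<open>exp (- E)\<close>, where \<open>E\<close> is an integral of \<open>A\<close> in \<open>u\<close>, the solution has
  an explicit form in which everything can be differentiated with respect to \<open>v\<close>.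
\<close>

lemma linear_transport_C1:
  fixes z :: "real \<Rightarrow> real \<Rightarrow> complex"
  assumes A: "C0_plane A" "C0_plane A'" "\<And>u v. ((\<lambda>s. A u s) has_vector_derivative A' u v) (at v)"
    and B: "C0_plane B" "C0_plane B'" "\<And>u v. ((\<lambda>s. B u s) has_vector_derivative B' u v) (at v)"
    and z: "\<And>u v. ((\<lambda>s. z s v) has_vector_derivative A u v * z u v + B u v) (at u)"
    and d: "\<And>v. z (-v) v = d v" "\<And>v. (d has_vector_derivative d' v) (at v)" "continuous_on UNIV d'"
  shows "\<exists>z1 z2. C1_plane z z1 z2"
proof -
  \<comment> \<open>Integrals start at \<open>u = 0\<close> and not on the initial line \<open>u = -v\<close>, so that only \<open>k\<close> below involves
    limits that depend on \<open>v\<close>.\<close>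
  define E where "E u v = oriented_integral (\<lambda>s. A s v) 0 u" for u v
  define E2 where "E2 u v = oriented_integral (\<lambda>s. A' s v) 0 u" for u v
  have E: "C1_plane E A E2" unfolding E_def E2_def by (rule C1_plane_oriented_integral[OF A])
  have nE: "C1_plane (\<lambda>u v. - E u v) (\<lambda>u v. - A u v) (\<lambda>u v. - E2 u v)"
    by (rule C1_plane_linear[OF E bounded_linear_minus[OF bounded_linear_ident]])
  note eE = C1_plane_exp[OF E] and enE = C1_plane_exp[OF nE]
  define f where "f u v = exp (- E u v) * B u v" for u v
  define f2 where "f2 u v = exp (- E u v) * B' u v + (- E2 u v * exp (- E u v)) * B u v" for u v
  have cE: "C0_plane E" and cE2: "C0_plane E2" using E C1_plane_imp_C0_plane by (auto simp: C1_plane_def)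
  have f: "C0_plane f" "C0_plane f2"
    using cE cE2 B unfolding f_def f2_def C0_plane_def by (auto intro!: continuous_intros)
  have df: "((\<lambda>s. f u s) has_vector_derivative f2 u v) (at v)" for u v
    unfolding f_def f2_def by (intro has_vector_derivative_mult C1_plane_partials(2)[OF enE] B)
  define H where "H u v = oriented_integral (\<lambda>s. f s v) 0 u" for u v
  define H2 where "H2 u v = oriented_integral (\<lambda>s. f2 s v) 0 u" for u v
  have H: "C1_plane H f H2" unfolding H_def H2_def by (rule C1_plane_oriented_integral[OF f df])
  define k where "k v = exp (- E (-v) v) * d v - H (-v) v" for v
  define dE where "dE v = (-1) *\<^sub>R (- A (-v) v * exp (- E (-v) v)) + 1 *\<^sub>R (- E2 (-v) v * exp (- E (-v) v))" for v
  define dH where "dH v = (-1) *\<^sub>R f (-v) v + 1 *\<^sub>R H2 (-v) v" for v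
  have neg: "(uminus has_vector_derivative - 1) (at v)" "((\<lambda>x. x) has_vector_derivative 1) (at v)" for v :: real
    by (auto intro!: derivative_eq_intros)
  have dk: "(k has_vector_derivative (exp (- E (-v) v) * d' v + dE v * d v) - dH v) (at v)" for v
    unfolding k_def dE_def dH_def
    by (intro has_vector_derivative_diff has_vector_derivative_mult d C1_plane_path[OF enE] C1_plane_path[OF H] neg)
  have cd: "continuous_on UNIV d"
    using d(2) by (meson continuous_at_imp_continuous_on has_vector_derivative_continuous)
  have ck: "continuous_on UNIV (\<lambda>v. (exp (- E (-v) v) * d' v + dE v * d v) - dH v)"
  proof -
    have "C0_plane H2" using H by (simp add: C1_plane_def)
    then show ?thesis unfolding dE_def dH_def
      by (intro continuous_intros d(3) cd C0_plane_compose[OF cE] C0_plane_compose[OF cE2] C0_plane_compose[OF A(1)]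
          C0_plane_compose[OF f(1)] C0_plane_compose)
  qed
  have k_plane: "C1_plane (\<lambda>u v. k v) (\<lambda>u v. 0) (\<lambda>u v. (exp (- E (-v) v) * d' v + dE v * d v) - dH v)"
  proof (rule C1_planeI)
    show "C0_plane (\<lambda>u v. (exp (- E (-v) v) * d' v + dE v * d v) - dH v)"
      unfolding C0_plane_def by (rule continuous_on_compose2[OF ck continuous_on_snd[OF continuous_on_id]]) simp
  qed (auto intro: dk simp: C0_plane_def)
  have "z u v = exp (E u v) * (H u v + k v)" for u v
  proof -
    have "((\<lambda>s. exp (- E s v) * z s v - H s v) has_vector_derivative
        (exp (- E u v) * (A u v * z u v + B u v) + (- A u v * exp (- E u v)) * z u v) - f u v) (at u)" for u
      by (intro has_vector_derivative_diff has_vector_derivative_mult z C1_plane_partials(1)[OF enE] C1_plane_partials(1)[OF H])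
    moreover have "(exp (- E u v) * (A u v * z u v + B u v) + (- A u v * exp (- E u v)) * z u v) - f u v = 0" for u
      by (simp add: f_def algebra_simps)
    ultimately have "((\<lambda>s. exp (- E s v) * z s v - H s v) has_vector_derivative 0) (at u within UNIV)" for u
      by simp
    then obtain c where c: "\<And>u. exp (- E u v) * z u v - H u v = c"
      using has_vector_derivative_zero_constant[of UNIV "\<lambda>s. exp (- E s v) * z s v - H s v"] by auto
    have "c = k v" using c[of "-v"] by (simp add: k_def d)
    with c[of u] have "exp (- E u v) * z u v = H u v + k v" by (simp add: algebra_simps)
    then have "exp (E u v) * (exp (- E u v) * z u v) = exp (E u v) * (H u v + k v)" by simp
    then show ?thesis by (simp add: mult.assoc[symmetric] flip: exp_add)
  qed
  then have "z = (\<lambda>u v. exp (E u v) * (H u v + k v))" by (intro ext)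
  then show ?thesis
    using C1_plane_mult[OF eE C1_plane_add[OF H k_plane]] by auto
qed

text \<open>
  The equation for \<open>z\<close> is linear with coefficients that contain \<open>w\<close>, and \<open>w\<close> has the continuous
  \<open>v\<close>-derivative prescribed by its own equation; the equation for \<open>w\<close> is treated in the same way
  after exchanging the variables.
\<close>

lemma char_system_C1:
  fixes z w :: "real \<Rightarrow> real \<Rightarrow> complex"
  assumes al: "C1_plane al al1 al2" and be: "C1_plane be be1 be2"
    and cz: "C0_plane z" and cw: "C0_plane w" and sys: "\<And>u v. char_system al be z w u v"
    and z0: "\<And>v. z (-v) v = z0 v" "\<And>v. (z0 has_vector_derivative z0' v) (at v)" "continuous_on UNIV z0'"
    and w0: "\<And>v. w (-v) v = w0 v" "\<And>v. (w0 has_vector_derivative w0' v) (at v)" "continuous_on UNIV w0'"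
  obtains z1 z2 w1 w2 where "C1_plane z z1 z2" "C1_plane w w1 w2"
proof -
  define f where "f u v = al u v *\<^sub>R w u v + be u v *\<^sub>R z u v + \<i> * complex_of_real (Im (w u v)) * z u v" for u v
  define g where "g u v = al u v *\<^sub>R w u v + be u v *\<^sub>R z u v + \<i> * complex_of_real (Im (z u v)) * w u v" for u v
  have dz: "((\<lambda>s. z s v) has_vector_derivative f u v) (at u)"
    and dw: "((\<lambda>s. w u s) has_vector_derivative g u v) (at v)" for u v
    using sys[of u v] by (auto simp: char_system_def f_def g_def)
  have C: "C0_plane al" "C0_plane al1" "C0_plane al2" "C0_plane be" "C0_plane be1" "C0_plane be2"
    using al be C1_plane_imp_C0_plane[OF al] C1_plane_imp_C0_plane[OF be] by (simp_all add: C1_plane_def)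
  note comp = C[THEN C0_plane_compose] C0_plane_compose[OF cz] C0_plane_compose[OF cw]
  have cf: "C0_plane f" and cg: "C0_plane g"
    unfolding C0_plane_def f_def g_def by (intro continuous_intros comp)+
  note comp = comp C0_plane_compose[OF cf] C0_plane_compose[OF cg]
  note linear = bounded_linear.has_vector_derivative[OF bounded_linear_of_real]
    bounded_linear.has_vector_derivative[OF bounded_linear_Im]
    bounded_linear.has_vector_derivative[OF bounded_linear_mult_right]
  have "\<exists>z1 z2. C1_plane z z1 z2"
  proof (rule linear_transport_C1[where z = z and d = z0 and d' = z0'
        and A = "\<lambda>u v. complex_of_real (be u v) + \<i> * complex_of_real (Im (w u v))"
        and A' = "\<lambda>u v. complex_of_real (be2 u v) + \<i> * complex_of_real (Im (g u v))"
        and B = "\<lambda>u v. complex_of_real (al u v) * w u v"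
        and B' = "\<lambda>u v. complex_of_real (al u v) * g u v + complex_of_real (al2 u v) * w u v"])
    show "C0_plane (\<lambda>u v. complex_of_real (be u v) + \<i> * complex_of_real (Im (w u v)))"
      "C0_plane (\<lambda>u v. complex_of_real (be2 u v) + \<i> * complex_of_real (Im (g u v)))"
      "C0_plane (\<lambda>u v. complex_of_real (al u v) * w u v)"
      "C0_plane (\<lambda>u v. complex_of_real (al u v) * g u v + complex_of_real (al2 u v) * w u v)"
      unfolding C0_plane_def by (intro continuous_intros comp)+
    fix u v
    show "((\<lambda>s. complex_of_real (be u s) + \<i> * complex_of_real (Im (w u s))) has_vector_derivative
        complex_of_real (be2 u v) + \<i> * complex_of_real (Im (g u v))) (at v)"
      by (intro has_vector_derivative_add linear C1_plane_partials(2)[OF be] dw)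
    show "((\<lambda>s. complex_of_real (al u s) * w u s) has_vector_derivative
        complex_of_real (al u v) * g u v + complex_of_real (al2 u v) * w u v) (at v)"
      by (intro has_vector_derivative_mult linear C1_plane_partials(2)[OF al] dw)
    show "((\<lambda>s. z s v) has_vector_derivative (complex_of_real (be u v) + \<i> * complex_of_real (Im (w u v))) * z u v
        + complex_of_real (al u v) * w u v) (at u)"
      using dz[where u=u and v=v] by (simp add: f_def scaleR_conv_of_real algebra_simps)
  qed (fact z0)+
  moreover have "\<exists>y1 y2. C1_plane (\<lambda>u v. w v u) y1 y2"
  proof (rule linear_transport_C1[where z = "\<lambda>u v. w v u" and d = "\<lambda>v. w0 (-v)" and d' = "\<lambda>v. - w0' (-v)"
        and A = "\<lambda>u v. complex_of_real (al v u) + \<i> * complex_of_real (Im (z v u))"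
        and A' = "\<lambda>u v. complex_of_real (al1 v u) + \<i> * complex_of_real (Im (f v u))"
        and B = "\<lambda>u v. complex_of_real (be v u) * z v u"
        and B' = "\<lambda>u v. complex_of_real (be v u) * f v u + complex_of_real (be1 v u) * z v u"])
    show "C0_plane (\<lambda>u v. complex_of_real (al v u) + \<i> * complex_of_real (Im (z v u)))"
      "C0_plane (\<lambda>u v. complex_of_real (al1 v u) + \<i> * complex_of_real (Im (f v u)))"
      "C0_plane (\<lambda>u v. complex_of_real (be v u) * z v u)"
      "C0_plane (\<lambda>u v. complex_of_real (be v u) * f v u + complex_of_real (be1 v u) * z v u)"
      unfolding C0_plane_def by (intro continuous_intros comp)+
    fix u v
    show "((\<lambda>s. complex_of_real (al s u) + \<i> * complex_of_real (Im (z s u))) has_vector_derivative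
        complex_of_real (al1 v u) + \<i> * complex_of_real (Im (f v u))) (at v)"
      by (intro has_vector_derivative_add linear C1_plane_partials(1)[OF al] dz)
    show "((\<lambda>s. complex_of_real (be s u) * z s u) has_vector_derivative
        complex_of_real (be v u) * f v u + complex_of_real (be1 v u) * z v u) (at v)"
      by (intro has_vector_derivative_mult linear C1_plane_partials(1)[OF be] dz)
    show "((\<lambda>s. w v s) has_vector_derivative (complex_of_real (al v u) + \<i> * complex_of_real (Im (z v u))) * w v u
        + complex_of_real (be v u) * z v u) (at u)"
      using dw[where u=v and v=u] by (simp add: g_def scaleR_conv_of_real algebra_simps)
    show "w v (- v) = w0 (- v)" using w0(1)[of "-v"] by simp
    show "((\<lambda>v. w0 (- v)) has_vector_derivative - w0' (- v)) (at v)"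
    proof -
      have "(uminus has_vector_derivative -1) (at v)" by (auto intro!: derivative_eq_intros)
      from vector_diff_chain_at[OF this w0(2)] show ?thesis by (simp add: o_def)
    qed
    show "continuous_on UNIV (\<lambda>v. - w0' (- v))"
      by (intro continuous_intros continuous_on_compose2[OF w0(3)]) auto
  qed
  ultimately show ?thesis using that C1_plane_swap[of "\<lambda>u v. w v u"] by blast
qed

text \<open>
  A gradient is prescribed whose mixed derivatives agree: integrate \<open>f\<close> in the first
  variable and differentiate under the integral sign.
\<close>

lemma potential_exists:
  fixes f g :: "real \<Rightarrow> real \<Rightarrow> real"
  assumes f: "C1_plane f f1 f2" and g: "C1_plane g f2 g2"
    and h: "\<And>x. (h has_real_derivative g 0 x) (at x)"
  obtains \<Phi> where "C1_plane \<Phi> f g" "\<And>x. \<Phi> 0 x = h x"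
proof
  define \<Phi> where "\<Phi> t x = h x + oriented_integral (\<lambda>s. f s x) 0 t" for t x
  have cf: "C0_plane f" "C0_plane f2" and cg: "C0_plane g"
    using C1_plane_imp_C0_plane[OF f] C1_plane_imp_C0_plane[OF g] f by (auto simp: C1_plane_def)
  have eq: "oriented_integral (\<lambda>s. f2 s x) 0 t = g t x - g 0 x" for t x
    by (rule oriented_integral_antiderivative) (rule C1_plane_partials(1)[OF g])
  have I: "C1_plane (\<lambda>u v. oriented_integral (\<lambda>s. f s v) 0 u) f (\<lambda>u v. oriented_integral (\<lambda>s. f2 s v) 0 u)"
    by (rule C1_plane_oriented_integral[OF cf C1_plane_partials(2)[OF f]])
  show "C1_plane \<Phi> f g"
  proof (rule C1_planeI[OF cf(1) cg])
    show "((\<lambda>s. \<Phi> s x) has_vector_derivative f t x) (at t)" for t x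
      unfolding \<Phi>_def using has_vector_derivative_add[OF has_vector_derivative_const C1_plane_partials(1)[OF I]] by simp
    show "((\<lambda>s. \<Phi> t s) has_vector_derivative g t x) (at x)" for t x
      unfolding \<Phi>_def
      using has_vector_derivative_add[OF h[unfolded has_real_derivative_iff_has_vector_derivative] C1_plane_partials(2)[OF I]]
      by (simp add: eq)
  qed
  show "\<Phi> 0 x = h x" for x by (simp add: \<Phi>_def)
qed

lemma C1_plane_null_coordinates:
  assumes "C1_plane f f1 f2"
  shows "C1_plane (\<lambda>t x. f (t - x) (t + x)) (\<lambda>t x. f1 (t - x) (t + x) + f2 (t - x) (t + x))
    (\<lambda>t x. f2 (t - x) (t + x) - f1 (t - x) (t + x))"
proof (rule C1_planeI)
  show "C0_plane (\<lambda>t x. f1 (t - x) (t + x) + f2 (t - x) (t + x))" "C0_plane (\<lambda>t x. f2 (t - x) (t + x) - f1 (t - x) (t + x))"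
    using assms unfolding C1_plane_def C0_plane_def[of "\<lambda>t x. f1 (t - x) (t + x) + f2 (t - x) (t + x)"]
      C0_plane_def[of "\<lambda>t x. f2 (t - x) (t + x) - f1 (t - x) (t + x)"]
    by (auto intro!: continuous_intros C0_plane_compose)
  fix t x :: real
  have "((\<lambda>s. s - x) has_vector_derivative 1) (at t)" "((\<lambda>s. s + x) has_vector_derivative 1) (at t)"
    "((\<lambda>s. t - s) has_vector_derivative -1) (at x)" "((\<lambda>s. t + s) has_vector_derivative 1) (at x)"
    by (auto intro!: derivative_eq_intros)
  from C1_plane_path[OF assms this(1,2)] C1_plane_path[OF assms this(3,4)]
  show "((\<lambda>s. f (s - x) (s + x)) has_vector_derivative f1 (t - x) (t + x) + f2 (t - x) (t + x)) (at t)"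
    "((\<lambda>s. f (t - s) (t + s)) has_vector_derivative f2 (t - x) (t + x) - f1 (t - x) (t + x)) (at x)"
    by (simp_all add: algebra_simps)
qed

section \<open>Functions on the closed half-plane\<close>

lemma vector_derivative_within_halfline:
  assumes "(f has_vector_derivative f') (at t within {0..})" "t \<ge> (0::real)"
  shows "vector_derivative f (at t within {0..}) = f'"
proof (rule vector_derivative_within[OF _ assms(1)])
  have "at_right t \<le> at t within {0..}" by (rule at_le) (use assms(2) in auto)
  then show "at t within {0..} \<noteq> bot"
    using trivial_limit_at_right_real[of t] by (auto simp: bot_unique)
qed

lemma dt_eqI:
  assumes "((\<lambda>s. f s x) has_vector_derivative f') (at t within {0..})" "t \<ge> 0"
  shows "dt f t x = f'"
  using vector_derivative_within_halfline[OF assms] by (simp add: dt_def)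

lemma dx_eqI:
  assumes "((\<lambda>y. f t y) has_vector_derivative f') (at x)"
  shows "dx f t x = f'"
  using assms by (auto simp: dx_def has_real_derivative_iff_has_vector_derivative[symmetric] DERIV_imp_deriv)

lemma dt_cong:
  assumes "\<And>t x. t \<ge> 0 \<Longrightarrow> f t x = g t x" "t \<ge> 0"
  shows "dt f t x = dt g t x"
  unfolding dt_def using assms by (intro vector_derivative_cong_eq) auto

lemma dx_cong:
  assumes "\<And>t x. t \<ge> 0 \<Longrightarrow> f t x = g t x" "t \<ge> 0"
  shows "dx f t x = dx g t x"
  using assms by (simp add: dx_def)

text \<open>
  The values for negative \<open>t\<close> do not matter. This allows \<open>dt f\<close>, whose values there are
  arbitrary, to be replaced by an honest partial derivative on the plane.
\<close>

lemma Ck_halfplane_cong: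
  assumes "\<And>t x. t \<ge> 0 \<Longrightarrow> f t x = g t x"
  shows "Ck_halfplane k f \<longleftrightarrow> Ck_halfplane k g"
  using assms
proof (induction k arbitrary: f g)
  case 0
  then show ?case by (auto intro!: continuous_on_cong)
next
  case (Suc k)
  have "Ck_halfplane k (dt f) \<longleftrightarrow> Ck_halfplane k (dt g)"
    by (rule Suc.IH) (rule dt_cong[OF Suc.prems])
  moreover have "Ck_halfplane k (dx f) \<longleftrightarrow> Ck_halfplane k (dx g)"
    by (rule Suc.IH) (rule dx_cong[OF Suc.prems])
  moreover have "continuous_on ({0..} \<times> UNIV) (\<lambda>(t, x). f t x) \<longleftrightarrow> continuous_on ({0..} \<times> UNIV) (\<lambda>(t, x). g t x)"
    using Suc.prems by (auto intro!: continuous_on_cong)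
  moreover have "(\<lambda>s. f s x) differentiable (at t within {0..}) \<longleftrightarrow> (\<lambda>s. g s x) differentiable (at t within {0..})"
    if "t \<ge> 0" for t x
    using that Suc.prems differentiable_transform_within[of "\<lambda>s. f s x" t "{0..}" 1 "\<lambda>s. g s x"]
      differentiable_transform_within[of "\<lambda>s. g s x" t "{0..}" 1 "\<lambda>s. f s x"] by auto
  moreover have "(\<lambda>y. f t y) = (\<lambda>y. g t y)" if "t \<ge> 0" for t
    using that Suc.prems by auto
  ultimately show ?case by simp
qed

lemma C1_plane_dt:
  assumes "C1_plane f f1 f2" "t \<ge> 0"
  shows "dt f t x = f1 t x"
  by (rule dt_eqI[OF C1_plane_partials(1)[OF assms(1)] assms(2)])

lemma C1_plane_dx:
  assumes "C1_plane f f1 f2"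
  shows "dx f t x = f2 t x"
  by (rule dx_eqI[OF C1_plane_partials(2)[OF assms]])

lemma C0_plane_imp_Ck_halfplane_0: "C0_plane f \<Longrightarrow> Ck_halfplane 0 f"
  by (auto simp: C0_plane_def case_prod_unfold intro: continuous_on_subset)

lemma Ck_halfplane_SucI:
  assumes f: "C1_plane f f1 f2" and "Ck_halfplane k f1" "Ck_halfplane k f2"
  shows "Ck_halfplane (Suc k) f"
proof -
  have "Ck_halfplane k (dt f)" "Ck_halfplane k (dx f)"
    using Ck_halfplane_cong[of "dt f" f1 k, OF C1_plane_dt[OF f]] Ck_halfplane_cong[of "dx f" f2 k, OF C1_plane_dx[OF f]] assms
    by auto
  then show ?thesis
    using C0_plane_imp_Ck_halfplane_0[OF C1_plane_imp_C0_plane[OF f]] C1_plane_partials[OF f]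
    by (auto intro!: differentiableI_vector)
qed

lemma C2_plane_halfplane:
  assumes f: "C1_plane f f1 f2" and f1: "C1_plane f1 f11 f12" and f2: "C1_plane f2 f21 f22"
  shows "Ck_halfplane 2 f"
    and "t \<ge> 0 \<Longrightarrow> dt (dt f) t x = f11 t x"
    and "t \<ge> 0 \<Longrightarrow> dx (dx f) t x = f22 t x"
proof -
  have "C0_plane f11" "C0_plane f12" "C0_plane f21" "C0_plane f22" using f1 f2 by (auto simp: C1_plane_def)
  then have "Ck_halfplane (Suc (Suc 0)) f"
    using f f1 f2 by (intro Ck_halfplane_SucI[OF f] Ck_halfplane_SucI[OF f1] Ck_halfplane_SucI[OF f2] C0_plane_imp_Ck_halfplane_0)
  then show "Ck_halfplane 2 f" by (simp add: numeral_2_eq_2)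
  show "dt (dt f) t x = f11 t x" if "t \<ge> 0"
    using dt_cong[of "dt f" f1, OF C1_plane_dt[OF f] that] C1_plane_dt[OF f1 that] by simp
  show "dx (dx f) t x = f22 t x" if "t \<ge> 0"
    using dx_cong[of "dx f" f2, OF C1_plane_dx[OF f] that] C1_plane_dx[OF f2] by simp
qed

lemma Ck_halfplane_partials:
  assumes "Ck_halfplane (Suc k) f" "t \<ge> 0"
  shows "((\<lambda>s. f s x) has_vector_derivative dt f t x) (at t within {0..})"
    and "((\<lambda>y. f t y) has_vector_derivative dx f t x) (at x)"
  using assms
  by (auto simp: dt_def dx_def vector_derivative_works DERIV_deriv_iff_real_differentiable
      simp flip: has_real_derivative_iff_has_vector_derivative)

lemma Ck_halfplane_continuous:
  assumes "Ck_halfplane k f"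
  shows "continuous_on ({0..} \<times> UNIV) (\<lambda>p. f (fst p) (snd p))"
  using assms by (cases k) (auto simp: case_prod_unfold)

lemma Ck_halfplane_compose:
  assumes "Ck_halfplane k f" "continuous_on S g" "continuous_on S h" "\<And>x. x \<in> S \<Longrightarrow> g x \<ge> 0"
  shows "continuous_on S (\<lambda>x. f (g x) (h x))"
proof -
  have "continuous_on S (\<lambda>x. (g x, h x))"
    by (intro continuous_intros assms)
  from continuous_on_compose2[OF Ck_halfplane_continuous[OF assms(1)] this] assms(4) show ?thesis by auto
qed

lemma Ck_halfplane_has_derivative:
  assumes f: "Ck_halfplane (Suc k) f" and t: "t > 0"
  shows "((\<lambda>p. f (fst p) (snd p)) has_derivative (\<lambda>h. fst h *\<^sub>R dt f t x + snd h *\<^sub>R dx f t x)) (at (t, x))"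
proof -
  define F where "F u v = blinfun_scaleR_left (dx f u v)" for u v
  have "((\<lambda>(x, y). f x y) has_derivative (\<lambda>(tx, ty). tx *\<^sub>R dt f t x + F t x ty)) (at (t, x) within {0<..} \<times> UNIV)"
  proof (rule has_derivative_partialsI)
    have "((\<lambda>s. f s x) has_vector_derivative dt f t x) (at t within {0<..})"
      by (rule has_vector_derivative_within_subset[OF Ck_halfplane_partials(1)[OF f]]) (use t in auto)
    then show "((\<lambda>s. f s x) has_derivative (\<lambda>tx. tx *\<^sub>R dt f t x)) (at t within {0<..})"
      by (simp add: has_vector_derivative_def)
    show "((\<lambda>y. f s y) has_derivative blinfun_apply (F s y)) (at y)" if "s \<in> {0<..}" for s y
      using Ck_halfplane_partials(2)[OF f, of s y] that by (simp add: has_vector_derivative_def F_def)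
    have "continuous_on ({0<..} \<times> UNIV) (\<lambda>p. F (fst p) (snd p))"
      unfolding F_def using f
      by (intro bounded_linear.continuous_on[OF bounded_linear_blinfun_scaleR_left] Ck_halfplane_compose[of k "dx f"] continuous_intros)
        auto
    then show "continuous (at (t, x) within {0<..} \<times> UNIV) (\<lambda>(x, y). F x y)"
      using t by (simp add: case_prod_unfold continuous_on_eq_continuous_within)
  qed auto
  moreover have "at (t, x) within {0<..} \<times> UNIV = at (t, x)"
    using t by (intro at_within_open) (auto intro: open_Times)
  ultimately show ?thesis
    by (simp add: case_prod_unfold F_def)
qed

lemma Ck_halfplane_path:
  assumes f: "Ck_halfplane (Suc k) f" and "g t > 0"
    and "(g has_vector_derivative g') (at t)" "(h has_vector_derivative h') (at t)"
  shows "((\<lambda>t. f (g t) (h t)) has_vector_derivative g' * dt f (g t) (h t) + h' * dx f (g t) (h t)) (at t)"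
proof -
  have "((\<lambda>t. (g t, h t)) has_derivative (\<lambda>x. (x *\<^sub>R g', x *\<^sub>R h'))) (at t)"
    using assms(3,4) by (auto intro!: derivative_eq_intros simp: has_vector_derivative_def)
  from has_derivative_compose[OF this Ck_halfplane_has_derivative[OF f assms(2)]]
  show ?thesis by (simp add: has_vector_derivative_def algebra_simps)
qed

text \<open>
  Differentiate \<open>f(t, x) = f(0, x) + \<integral>\<^sub>0\<^sup>t \<partial>\<^sub>t f(s, x) ds\<close> first in \<open>x\<close> and then in \<open>t\<close>. The integrand
  is extended to negative times by its value at time \<open>0\<close>.
\<close>

lemma Ck_halfplane_mixed_partials:
  assumes f: "Ck_halfplane 2 f" and t: "t > 0"
  shows "dt (dx f) t x = dx (dt f) t x"
proof -
  have f': "Ck_halfplane (Suc 1) f" using f by (simp add: numeral_2_eq_2)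
  then have ft: "Ck_halfplane (Suc 0) (dt f)" and fx: "Ck_halfplane (Suc 0) (dx f)" by auto
  define F where "F s x = dt f (max s 0) x" for s x
  define F2 where "F2 s x = dx (dt f) (max s 0) x" for s x
  have "C0_plane F" "C0_plane F2"
    unfolding C0_plane_def F_def F2_def using ft
    by (intro Ck_halfplane_compose[OF ft] Ck_halfplane_compose[of 0 "dx (dt f)"] continuous_intros; simp)+
  moreover have "((\<lambda>v. F u v) has_vector_derivative F2 u v) (at v)" for u v
    unfolding F_def F2_def by (rule Ck_halfplane_partials(2)[OF ft]) simp
  ultimately have Phi: "C1_plane (\<lambda>u v. oriented_integral (\<lambda>s. F s v) 0 u) F (\<lambda>u v. oriented_integral (\<lambda>s. F2 s v) 0 u)"
    by (rule C1_plane_oriented_integral)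
  have f_eq: "f s y = f 0 y + oriented_integral (\<lambda>s. F s y) 0 s" if s: "s \<ge> 0" for s y
  proof -
    have "((\<lambda>s. f s y - oriented_integral (\<lambda>s. F s y) 0 s) has_vector_derivative 0) (at s within {0..})" if "s \<in> {0..}" for s
    proof -
      have "((\<lambda>s. f s y - oriented_integral (\<lambda>s. F s y) 0 s) has_vector_derivative dt f s y - F s y) (at s within {0..})"
        using that by (intro has_vector_derivative_diff Ck_halfplane_partials(1)[OF f'] C1_plane_partials(1)[OF Phi]) auto
      then show ?thesis using that by (simp add: F_def max_def)
    qed
    then obtain c where "\<And>s. s \<in> {0..} \<Longrightarrow> f s y - oriented_integral (\<lambda>s. F s y) 0 s = c"
      using has_vector_derivative_zero_constant[of "{0..}" "\<lambda>s. f s y - oriented_integral (\<lambda>s. F s y) 0 s"] by auto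
    from this[of 0] this[of s] s show ?thesis by simp
  qed
  have dx_eq: "dx f s y = dx f 0 y + oriented_integral (\<lambda>s. F2 s y) 0 s" if "s \<ge> 0" for s y
  proof (rule dx_eqI)
    have "((\<lambda>y. f 0 y + oriented_integral (\<lambda>s. F s y) 0 s) has_vector_derivative dx f 0 y + oriented_integral (\<lambda>s. F2 s y) 0 s) (at y)"
      by (intro has_vector_derivative_add Ck_halfplane_partials(2)[OF f'] C1_plane_partials(2)[OF Phi]) simp
    then show "((\<lambda>y. f s y) has_vector_derivative dx f 0 y + oriented_integral (\<lambda>s. F2 s y) 0 s) (at y)"
      using f_eq[OF that] by simp
  qed
  have "((\<lambda>s. dx f 0 x + oriented_integral (\<lambda>s. F2 s x) 0 s) has_vector_derivative 0 + F2 t x) (at t within {0..})"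
    by (intro has_vector_derivative_add has_vector_derivative_const has_vector_derivative_at_within[OF oriented_integral_has_derivative]
        C0_plane_compose[OF \<open>C0_plane F2\<close>] continuous_intros)
  from has_vector_derivative_transform[OF _ _ this, of "\<lambda>s. dx f s x"] t
  have "((\<lambda>s. dx f s x) has_vector_derivative F2 t x) (at t within {0..})"
    by (simp add: dx_eq[symmetric])
  then show ?thesis using t by (simp add: dt_eqI F2_def max_def)
qed

section \<open>Uniqueness\<close>

text \<open>
  Since \<open>\<partial>\<^sub>u = (\<partial>\<^sub>t - \<partial>\<^sub>x) / 2\<close> and \<open>\<partial>\<^sub>v = (\<partial>\<^sub>t + \<partial>\<^sub>x) / 2\<close>, the mixed derivatives cancel and both
  null components have half the wave operator as their derivative along the other characteristic.
\<close>

lemma null_derivatives: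
  assumes f: "Ck_halfplane 2 f" and uv: "u + v > 0"
  defines "t \<equiv> (u + v) / 2" and "x \<equiv> (v - u) / 2"
  shows "((\<lambda>s. dt f ((s + v) / 2) ((v - s) / 2) + dx f ((s + v) / 2) ((v - s) / 2))
      has_real_derivative (dt (dt f) t x - dx (dx f) t x) / 2) (at u)"
    and "((\<lambda>s. dt f ((u + s) / 2) ((s - u) / 2) - dx f ((u + s) / 2) ((s - u) / 2))
      has_real_derivative (dt (dt f) t x - dx (dx f) t x) / 2) (at v)"
    and "((\<lambda>s. f ((s + v) / 2) ((v - s) / 2)) has_real_derivative (dt f t x - dx f t x) / 2) (at u)"
    and "((\<lambda>s. f ((u + s) / 2) ((s - u) / 2)) has_real_derivative (dt f t x + dx f t x) / 2) (at v)"
proof -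
  have f': "Ck_halfplane (Suc 1) f" using f by (simp add: numeral_2_eq_2)
  then have ft: "Ck_halfplane (Suc 0) (dt f)" and fx: "Ck_halfplane (Suc 0) (dx f)" by auto
  have t: "t > 0" using uv by (simp add: t_def)
  have l: "((\<lambda>s. (s + v) / 2) has_vector_derivative 1/2) (at u)" "((\<lambda>s. (v - s) / 2) has_vector_derivative -1/2) (at u)"
    "((\<lambda>s. (u + s) / 2) has_vector_derivative 1/2) (at v)" "((\<lambda>s. (s - u) / 2) has_vector_derivative 1/2) (at v)"
    by (auto intro!: derivative_eq_intros simp flip: has_real_derivative_iff_has_vector_derivative)
  have m: "dt (dx f) t x = dx (dt f) t x" by (rule Ck_halfplane_mixed_partials[OF f t])
  note path = Ck_halfplane_path[where g = "\<lambda>s. (s + v) / 2" and h = "\<lambda>s. (v - s) / 2" and t = u, OF _ _ l(1,2)]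
    Ck_halfplane_path[where g = "\<lambda>s. (u + s) / 2" and h = "\<lambda>s. (s - u) / 2" and t = v, OF _ _ l(3,4)]
  note path = path[folded t_def x_def, folded has_real_derivative_iff_has_vector_derivative, OF _ t]
  show "((\<lambda>s. dt f ((s + v) / 2) ((v - s) / 2) + dx f ((s + v) / 2) ((v - s) / 2))
      has_real_derivative (dt (dt f) t x - dx (dx f) t x) / 2) (at u)"
    by (rule DERIV_cong[OF DERIV_add[OF path(1)[OF ft] path(1)[OF fx]]]) (simp add: m field_simps)
  show "((\<lambda>s. dt f ((u + s) / 2) ((s - u) / 2) - dx f ((u + s) / 2) ((s - u) / 2))
      has_real_derivative (dt (dt f) t x - dx (dx f) t x) / 2) (at v)"
    by (rule DERIV_cong[OF DERIV_diff[OF path(2)[OF ft] path(2)[OF fx]]]) (simp add: m field_simps)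
  show "((\<lambda>s. f ((s + v) / 2) ((v - s) / 2)) has_real_derivative (dt f t x - dx f t x) / 2) (at u)"
    by (rule DERIV_cong[OF path(1)[OF f']]) (simp add: field_simps)
  show "((\<lambda>s. f ((u + s) / 2) ((s - u) / 2)) has_real_derivative (dt f t x + dx f t x) / 2) (at v)"
    by (rule DERIV_cong[OF path(2)[OF f']]) (simp add: field_simps)
qed

lemma has_vector_derivative_Complex:
  assumes "(a has_real_derivative a') (at x)" "(b has_real_derivative b') (at x)"
  shows "((\<lambda>s. Complex (a s) (b s)) has_vector_derivative Complex a' b') (at x)"
  unfolding Complex_eq
  using assms
  by (auto intro!: has_vector_derivative_add bounded_linear.has_vector_derivative[OF bounded_linear_of_real]
    bounded_linear.has_vector_derivative[OF bounded_linear_mult_right]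
    simp: has_real_derivative_iff_has_vector_derivative)

lemma halfplane_eq_if_dt_eq:
  assumes f: "Ck_halfplane (Suc k) f" and g: "Ck_halfplane (Suc k) g"
    and d: "\<And>t x. t \<ge> 0 \<Longrightarrow> dt f t x = dt g t x" and i: "\<And>x. f 0 x = g 0 x" and t: "t \<ge> 0"
  shows "f t x = g t x"
proof -
  have "((\<lambda>s. f s x - g s x) has_vector_derivative 0) (at s within {0..})" if "s \<in> {0..}" for s
    using has_vector_derivative_diff[OF Ck_halfplane_partials(1)[OF f, of s x] Ck_halfplane_partials(1)[OF g, of s x]] d[of s x] that by simp
  then obtain c where "\<And>s. s \<in> {0..} \<Longrightarrow> f s x - g s x = c"
    using has_vector_derivative_zero_constant[of "{0..}" "\<lambda>s. f s x - g s x"] by auto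
  from this[of 0] this[of t] i t show ?thesis by simp
qed

lemma char_system_unique_halfplane:
  fixes z w z' w' :: "real \<Rightarrow> real \<Rightarrow> complex"
  assumes cont: "continuous_on {p. fst p + snd p \<ge> 0} (\<lambda>p. al (fst p) (snd p))" "continuous_on {p. fst p + snd p \<ge> 0} (\<lambda>p. be (fst p) (snd p))"
      "continuous_on {p. fst p + snd p \<ge> 0} (\<lambda>p. z (fst p) (snd p))" "continuous_on {p. fst p + snd p \<ge> 0} (\<lambda>p. w (fst p) (snd p))"
      "continuous_on {p. fst p + snd p \<ge> 0} (\<lambda>p. z' (fst p) (snd p))" "continuous_on {p. fst p + snd p \<ge> 0} (\<lambda>p. w' (fst p) (snd p))"
    and sys: "\<And>u v. u + v > 0 \<Longrightarrow> char_system al be z w u v"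
      "\<And>u v. u + v > 0 \<Longrightarrow> char_system al be z' w' u v"
    and init: "\<And>v. z (-v) v = z' (-v) v \<and> w (-v) v = w' (-v) v"
    and uv: "u + v \<ge> 0"
  shows "z u v = z' u v \<and> w u v = w' u v"
proof (rule char_system_unique_half)
  show "\<bar>u\<bar> \<le> max \<bar>u\<bar> \<bar>v\<bar>" "\<bar>v\<bar> \<le> max \<bar>u\<bar> \<bar>v\<bar>" by simp_all
qed (rule cont[THEN continuous_on_subset] sys init uv; force)+

text \<open>
  The null derivatives of \<open>f\<close> solve the characteristic system without coefficients; being real,
  they have no rotation terms either.
\<close>

lemma wave_equation_unique:
  assumes f: "Ck_halfplane 2 f" and g: "Ck_halfplane 2 g"
    and wf: "\<And>t x. t \<ge> 0 \<Longrightarrow> dx (dx f) t x = dt (dt f) t x" and wg: "\<And>t x. t \<ge> 0 \<Longrightarrow> dx (dx g) t x = dt (dt g) t x"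
    and i: "\<And>x. f 0 x = g 0 x" "\<And>x. dt f 0 x = dt g 0 x" and t: "t \<ge> 0"
  shows "f t x = g t x"
proof -
  have f': "Ck_halfplane (Suc 1) f" and g': "Ck_halfplane (Suc 1) g" using f g by (simp_all add: numeral_2_eq_2)
  define z where "z f u v = Complex (dt f ((u + v) / 2) ((v - u) / 2) + dx f ((u + v) / 2) ((v - u) / 2)) 0" for f u v
  define w where "w f u v = Complex (dt f ((u + v) / 2) ((v - u) / 2) - dx f ((u + v) / 2) ((v - u) / 2)) 0" for f u v
  have sys: "char_system (\<lambda>u v. 0) (\<lambda>u v. 0) (z f) (w f) u v"
    if "Ck_halfplane 2 f" "\<And>t x. t \<ge> 0 \<Longrightarrow> dx (dx f) t x = dt (dt f) t x" "u + v > 0" for f u v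
  proof -
    have [simp]: "dx (dx f) ((u + v) / 2) ((v - u) / 2) = dt (dt f) ((u + v) / 2) ((v - u) / 2)"
      using that by simp
    show ?thesis
      using has_vector_derivative_Complex[OF null_derivatives(1)[OF that(1,3)] DERIV_const[of 0]]
        has_vector_derivative_Complex[OF null_derivatives(2)[OF that(1,3)] DERIV_const[of 0]]
      by (simp add: char_system_def z_def w_def zero_complex.code[symmetric])
  qed
  have c: "continuous_on {p. fst p + snd p \<ge> 0} (\<lambda>p. z f (fst p) (snd p))" "continuous_on {p. fst p + snd p \<ge> 0} (\<lambda>p. w f (fst p) (snd p))"
    if "Ck_halfplane (Suc 1) f" for f
    unfolding z_def w_def Complex_eq using that
    by (intro continuous_intros Ck_halfplane_compose[of 1 "dt f"] Ck_halfplane_compose[of 1 "dx f"]; simp)+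
  have dx0: "dx f 0 x = dx g 0 x" for x using i(1) by (simp add: dx_def)
  have eq: "z f u v = z g u v \<and> w f u v = w g u v" if "u + v \<ge> 0" for u v
    by (rule char_system_unique_halfplane[OF continuous_on_const continuous_on_const c[OF f'] c[OF g'] sys[OF f wf] sys[OF g wg] _ that])
      (simp_all add: z_def w_def i dx0)
  have "dt f t x = dt g t x" if "t \<ge> 0" for t x
  proof -
    have [simp]: "((t - x) + (t + x)) / 2 = t" "((t + x) - (t - x)) / 2 = x" by simp_all
    show ?thesis using eq[of "t - x" "t + x"] that by (simp add: z_def w_def)
  qed
  then show ?thesis by (rule halfplane_eq_if_dt_eq[OF f' g' _ i(1) t])
qed

text \<open>
  The passage from the second order equations to the characteristic system at one point: \<open>DW\<close> and
  \<open>DQ\<close> are the wave operator applied to \<open>W\<close> and \<open>q\<close>, and \<open>E\<close> stands for \<open>exp (-2 W)\<close>.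
\<close>

lemma null_components_algebra:
  fixes r Rt Rx Wt Wx Qt Qx E DW DQ :: real
  assumes r: "r \<noteq> 0"
    and DW: "DW = - (Rt * Wt - Rx * Wx) / r - (Qt\<^sup>2 - Qx\<^sup>2) / 2 * (E * E)"
    and DQ: "DQ = - (Rt * Qt - Rx * Qx) / r + 4 * Qt * Wt - 4 * Qx * Wx"
  defines "al \<equiv> - (Rt + Rx) / (4 * r)" and "be \<equiv> - (Rt - Rx) / (4 * r)"
    and "z \<equiv> Complex (Wt + Wx) (E / 2 * (Qt + Qx))" and "w \<equiv> Complex (Wt - Wx) (E / 2 * (Qt - Qx))"
  shows "Complex (DW / 2) (E / 2 * (DQ / 2) + E * (- 2 * ((Wt - Wx) / 2)) / 2 * (Qt + Qx))
      = al *\<^sub>R w + be *\<^sub>R z + \<i> * complex_of_real (Im w) * z"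
    and "Complex (DW / 2) (E / 2 * (DQ / 2) + E * (- 2 * ((Wt + Wx) / 2)) / 2 * (Qt - Qx))
      = al *\<^sub>R w + be *\<^sub>R z + \<i> * complex_of_real (Im z) * w"
  using r unfolding complex_eq_iff al_def be_def z_def w_def DW DQ
  by (simp_all add: field_simps power2_eq_square)

text \<open>
  Only interior points \<open>t > 0\<close> are considered, where the derivatives of a solution on the half-plane
  are two-sided; this is all that the comparison argument asks for.
\<close>

lemma solution_char_system:
  assumes R: "Ck_halfplane 2 R" and W: "Ck_halfplane 2 W" and q: "Ck_halfplane 2 q"
    and sol: "solves_system R W q" and uv: "u + v > 0"
  defines "T \<equiv> \<lambda>u v. (u + v) / 2" and "X \<equiv> \<lambda>u v. (v - u) / 2"
  shows "char_system (\<lambda>u v. - (dt R (T u v) (X u v) + dx R (T u v) (X u v)) / (4 * R (T u v) (X u v)))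
    (\<lambda>u v. - (dt R (T u v) (X u v) - dx R (T u v) (X u v)) / (4 * R (T u v) (X u v)))
    (\<lambda>u v. Complex (dt W (T u v) (X u v) + dx W (T u v) (X u v))
       (exp (- 2 * W (T u v) (X u v)) / 2 * (dt q (T u v) (X u v) + dx q (T u v) (X u v))))
    (\<lambda>u v. Complex (dt W (T u v) (X u v) - dx W (T u v) (X u v))
       (exp (- 2 * W (T u v) (X u v)) / 2 * (dt q (T u v) (X u v) - dx q (T u v) (X u v)))) u v"
proof -
  define t x where "t = (u + v) / 2" and "x = (v - u) / 2"
  have t: "t \<ge> 0" using uv by (simp add: t_def)
  have R0: "R t x \<noteq> 0"
    and Weq: "dt (dt W) t x - dx (dx W) t x
       = - (dt R t x * dt W t x - dx R t x * dx W t x) / R t x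
       - ((dt q t x)\<^sup>2 - (dx q t x)\<^sup>2) / 2 * exp (- 4 * W t x)"
    and qeq: "dt (dt q) t x - dx (dx q) t x
       = - (dt R t x * dt q t x - dx R t x * dx q t x) / R t x
       + 4 * dt q t x * dt W t x - 4 * dx q t x * dx W t x"
    using sol t unfolding solves_system_def by (auto simp: diff_divide_distrib algebra_simps dest!: spec[of _ t] spec[of _ x])
  have e4: "exp (- 4 * W t x) = exp (- 2 * W t x) * exp (- 2 * W t x)"
    by (simp flip: exp_add)
  note nW = null_derivatives[OF W uv, folded t_def x_def]
  note nq = null_derivatives[OF q uv, folded t_def x_def]
  have z: "((\<lambda>s. Complex (dt W ((s + v) / 2) ((v - s) / 2) + dx W ((s + v) / 2) ((v - s) / 2))
       (exp (- 2 * W ((s + v) / 2) ((v - s) / 2)) / 2 * (dt q ((s + v) / 2) ((v - s) / 2) + dx q ((s + v) / 2) ((v - s) / 2))))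
     has_vector_derivative Complex ((dt (dt W) t x - dx (dx W) t x) / 2)
       (exp (- 2 * W t x) / 2 * ((dt (dt q) t x - dx (dx q) t x) / 2)
         + exp (- 2 * W t x) * (- 2 * ((dt W t x - dx W t x) / 2)) / 2 * (dt q t x + dx q t x))) (at u)"
    by (intro has_vector_derivative_Complex nW(1))
      (rule nW(3) nq(1) derivative_eq_intros refl | simp add: t_def x_def field_simps)+
  have w: "((\<lambda>s. Complex (dt W ((u + s) / 2) ((s - u) / 2) - dx W ((u + s) / 2) ((s - u) / 2))
       (exp (- 2 * W ((u + s) / 2) ((s - u) / 2)) / 2 * (dt q ((u + s) / 2) ((s - u) / 2) - dx q ((u + s) / 2) ((s - u) / 2))))
     has_vector_derivative Complex ((dt (dt W) t x - dx (dx W) t x) / 2)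
       (exp (- 2 * W t x) / 2 * ((dt (dt q) t x - dx (dx q) t x) / 2)
         + exp (- 2 * W t x) * (- 2 * ((dt W t x + dx W t x) / 2)) / 2 * (dt q t x - dx q t x))) (at v)"
    by (intro has_vector_derivative_Complex nW(2))
      (rule nW(4) nq(2) derivative_eq_intros refl | simp add: t_def x_def field_simps)+
  note alg = null_components_algebra[OF R0 Weq[unfolded e4] qeq]
  show ?thesis unfolding char_system_def T_def X_def t_def[symmetric] x_def[symmetric]
    using has_vector_derivative_eq_rhs[OF z alg(1)] has_vector_derivative_eq_rhs[OF w alg(2)] by simp
qed

text \<open>
  First \<open>R\<close> is determined by the wave equation and with it the coefficients of the characteristic
  system. The null components then determine \<open>W\<^sub>t\<close>, hence \<open>W\<close>, and only after that \<open>q\<^sub>t\<close>, in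
  which \<open>exp (2 W)\<close> occurs as a factor.
\<close>

lemma solution_unique:
  assumes "C2_solution_with_data r\<^sub>0 r\<^sub>1 w\<^sub>0 w\<^sub>1 q\<^sub>0 q\<^sub>1 R W q"
    and "C2_solution_with_data r\<^sub>0 r\<^sub>1 w\<^sub>0 w\<^sub>1 q\<^sub>0 q\<^sub>1 R' W' q'" and t: "t \<ge> 0"
  shows "R t x = R' t x \<and> W t x = W' t x \<and> q t x = q' t x"
proof -
  have C2: "Ck_halfplane 2 R" "Ck_halfplane 2 W" "Ck_halfplane 2 q" "Ck_halfplane 2 R'" "Ck_halfplane 2 W'" "Ck_halfplane 2 q'"
    and sol: "solves_system R W q" "solves_system R' W' q'"
    using assms by (auto simp: C2_solution_with_data_def)
  have init: "R 0 x = R' 0 x" "W 0 x = W' 0 x" "q 0 x = q' 0 x"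
    "dt R 0 x = dt R' 0 x" "dt W 0 x = dt W' 0 x" "dt q 0 x = dt q' 0 x" for x
    using assms by (auto simp: C2_solution_with_data_def has_initial_data_def)
  have init_dx: "dx W 0 x = dx W' 0 x" "dx q 0 x = dx q' 0 x" for x using init by (simp_all add: dx_def)
  have wave: "dx (dx R) t x = dt (dt R) t x" "dx (dx R') t x = dt (dt R') t x" if "t \<ge> 0" for t x
    using sol that by (auto simp: solves_system_def)
  have R: "R t x = R' t x" if "t \<ge> 0" for t x
    by (rule wave_equation_unique[OF C2(1) C2(4) wave init(1) init(4) that])
  have dR: "dt R t x = dt R' t x" "dx R t x = dx R' t x" if "t \<ge> 0" for t x
    using dt_cong[of R R', OF R that] dx_cong[of R R', OF R that] by auto
  define al where "al u v = - (dt R ((u + v) / 2) ((v - u) / 2) + dx R ((u + v) / 2) ((v - u) / 2)) / (4 * R ((u + v) / 2) ((v - u) / 2))" for u v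
  define be where "be u v = - (dt R ((u + v) / 2) ((v - u) / 2) - dx R ((u + v) / 2) ((v - u) / 2)) / (4 * R ((u + v) / 2) ((v - u) / 2))" for u v
  define z where "z W q u v = Complex (dt W ((u + v) / 2) ((v - u) / 2) + dx W ((u + v) / 2) ((v - u) / 2))
       (exp (- 2 * W ((u + v) / 2) ((v - u) / 2)) / 2 * (dt q ((u + v) / 2) ((v - u) / 2) + dx q ((u + v) / 2) ((v - u) / 2)))" for W q u v
  define w where "w W q u v = Complex (dt W ((u + v) / 2) ((v - u) / 2) - dx W ((u + v) / 2) ((v - u) / 2))
       (exp (- 2 * W ((u + v) / 2) ((v - u) / 2)) / 2 * (dt q ((u + v) / 2) ((v - u) / 2) - dx q ((u + v) / 2) ((v - u) / 2)))" for W q u v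
  have sys: "char_system al be (z W q) (w W q) u v" if "u + v > 0" for u v
    using solution_char_system[OF C2(1-3) sol(1) that] unfolding al_def be_def z_def w_def .
  have "char_system al be (z W' q') (w W' q') u v" if "u + v > 0" for u v
  proof -
    have "R ((u + v) / 2) ((v - u) / 2) = R' ((u + v) / 2) ((v - u) / 2)"
      "dt R ((u + v) / 2) ((v - u) / 2) = dt R' ((u + v) / 2) ((v - u) / 2)"
      "dx R ((u + v) / 2) ((v - u) / 2) = dx R' ((u + v) / 2) ((v - u) / 2)"
      using R dR that by auto
    then show ?thesis
      using solution_char_system[OF C2(4-6) sol(2) that] unfolding char_system_def al_def be_def z_def w_def by simp
  qed
  note sys' = this
  have C1: "Ck_halfplane (Suc 1) R" "Ck_halfplane (Suc 1) W" "Ck_halfplane (Suc 1) q" "Ck_halfplane (Suc 1) W'" "Ck_halfplane (Suc 1) q'"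
    using C2 by (simp_all add: numeral_2_eq_2)
  have "R t x \<noteq> 0" if "t \<ge> 0" for t x using sol(1) that by (auto simp: solves_system_def)
  then have cal: "continuous_on {p. fst p + snd p \<ge> 0} (\<lambda>p. al (fst p) (snd p))" "continuous_on {p. fst p + snd p \<ge> 0} (\<lambda>p. be (fst p) (snd p))"
    unfolding al_def be_def using C1(1)
    by (intro continuous_intros Ck_halfplane_compose[of 2 R] Ck_halfplane_compose[of 1 "dt R"] Ck_halfplane_compose[of 1 "dx R"] C2; simp)+
  have c: "continuous_on {p. fst p + snd p \<ge> 0} (\<lambda>p. z W q (fst p) (snd p))" "continuous_on {p. fst p + snd p \<ge> 0} (\<lambda>p. w W q (fst p) (snd p))"
    if "Ck_halfplane (Suc 1) W" "Ck_halfplane (Suc 1) q" for W q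
    unfolding z_def w_def Complex_eq using that
    by (intro continuous_intros Ck_halfplane_compose[OF that(1)] Ck_halfplane_compose[of 1 "dt W"] Ck_halfplane_compose[of 1 "dx W"]
        Ck_halfplane_compose[of 1 "dt q"] Ck_halfplane_compose[of 1 "dx q"]; simp)+
  have "z W q u v = z W' q' u v \<and> w W q u v = w W' q' u v" if "u + v \<ge> 0" for u v
    by (rule char_system_unique_halfplane[OF cal c[OF C1(2,3)] c[OF C1(4,5)] sys sys' _ that])
      (simp_all add: z_def w_def init init_dx)
  note eq = this
  have eq': "dt W t x + dx W t x = dt W' t x + dx W' t x" "dt W t x - dx W t x = dt W' t x - dx W' t x"
    "exp (- 2 * W t x) / 2 * (dt q t x + dx q t x) = exp (- 2 * W' t x) / 2 * (dt q' t x + dx q' t x)"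
    "exp (- 2 * W t x) / 2 * (dt q t x - dx q t x) = exp (- 2 * W' t x) / 2 * (dt q' t x - dx q' t x)"
    if "t \<ge> 0" for t x
  proof -
    have [simp]: "((t - x) + (t + x)) / 2 = t" "((t + x) - (t - x)) / 2 = x" by simp_all
    show "dt W t x + dx W t x = dt W' t x + dx W' t x" "dt W t x - dx W t x = dt W' t x - dx W' t x"
    "exp (- 2 * W t x) / 2 * (dt q t x + dx q t x) = exp (- 2 * W' t x) / 2 * (dt q' t x + dx q' t x)"
    "exp (- 2 * W t x) / 2 * (dt q t x - dx q t x) = exp (- 2 * W' t x) / 2 * (dt q' t x - dx q' t x)"
      using eq[of "t - x" "t + x"] that by (simp_all add: z_def w_def)
  qed
  have "dt W t x = dt W' t x" if "t \<ge> 0" for t x using eq'(1,2)[OF that, of x] by linarith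
  then have W: "W t x = W' t x" if "t \<ge> 0" for t x
    using halfplane_eq_if_dt_eq[OF C1(2) C1(4) _ init(2) that] by blast
  have "dt q t x = dt q' t x" if "t \<ge> 0" for t x
  proof -
    have "dt q t x + dx q t x = dt q' t x + dx q' t x" "dt q t x - dx q t x = dt q' t x - dx q' t x"
      using eq'(3,4)[OF that, of x] W[OF that, of x] by auto
    then show ?thesis by linarith
  qed
  then have "q t x = q' t x" if "t \<ge> 0" for t x
    using halfplane_eq_if_dt_eq[OF C1(3) C1(5) _ init(3) that] by blast
  then show ?thesis using R W t by blast
qed

section \<open>The function R\<close>

lemma Ck_line_1:
  assumes "Ck_line 1 f"
  shows "(f has_real_derivative deriv f x) (at x)" and "continuous_on UNIV (deriv f)"
  using assms by (auto simp: DERIV_deriv_iff_real_differentiable)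

lemma Ck_line_2:
  assumes "Ck_line 2 f"
  shows "(f has_real_derivative deriv f x) (at x)" and "Ck_line 1 (deriv f)"
  using assms by (auto simp: DERIV_deriv_iff_real_differentiable numeral_2_eq_2)

text \<open>
  Take a primitive of \<open>-1 / max(y, c)\<^sup>2\<close>, that is, continue \<open>1 / y\<close> below \<open>c\<close> by its tangent.
\<close>

lemma reciprocal_extension:
  assumes c: "(c::real) > 0"
  obtains \<phi> \<phi>' where "\<And>y. (\<phi> has_real_derivative \<phi>' y) (at y)" "continuous_on UNIV \<phi>'"
    "\<And>y. y \<ge> c \<Longrightarrow> \<phi> y = 1 / y"
proof -
  define \<phi>' where "\<phi>' y = - 1 / (max y c)\<^sup>2" for y
  have cont: "continuous_on UNIV \<phi>'"
    unfolding \<phi>'_def using c by (intro continuous_intros) auto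
  then obtain \<Phi> where \<Phi>: "\<And>y. (\<Phi> has_vector_derivative \<phi>' y) (at y)"
    using continuous_antiderivative by blast
  define \<phi> where "\<phi> y = \<Phi> y - \<Phi> c + 1 / c" for y
  have d: "(\<phi> has_real_derivative \<phi>' y) (at y)" for y
    unfolding \<phi>_def using \<Phi>[folded has_real_derivative_iff_has_vector_derivative]
    by (auto intro!: derivative_eq_intros)
  have "\<phi> y = 1 / y" if y: "y \<ge> c" for y
  proof -
    have "((\<lambda>y. \<phi> y - 1 / y) has_vector_derivative 0) (at y within {c..})" if "y \<in> {c..}" for y
    proof -
      have "((\<lambda>y. \<phi> y - 1 / y) has_real_derivative 0) (at y)"
        using that c by (auto intro!: derivative_eq_intros d simp: \<phi>'_def max_def power2_eq_square)
      then show ?thesis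
        by (simp add: has_real_derivative_iff_has_vector_derivative has_vector_derivative_at_within)
    qed
    then obtain k where "\<And>y. y \<in> {c..} \<Longrightarrow> \<phi> y - 1 / y = k"
      using has_vector_derivative_zero_constant[of "{c..}" "\<lambda>y. \<phi> y - 1 / y"] by auto
    from this[of c] this[of y] y show ?thesis by (simp add: \<phi>_def)
  qed
  with that d cont show ?thesis by blast
qed

text \<open>
  Both summands of \<open>m\<^sub>0\<close> are nonnegative, so a finite bound on the sum makes each of them finite.
\<close>

lemma m_0_bounds:
  assumes "m_0 R\<^sub>0 0 r\<^sub>0 r\<^sub>1 < ereal M"
  obtains a b where "a + b < M" "\<And>x. \<bar>r\<^sub>0 x - R\<^sub>0 * cosh (2 * x)\<bar> \<le> a" "\<And>x. \<bar>r\<^sub>1 x - 2 * R\<^sub>0 * cosh (2 * x)\<bar> \<le> b"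
proof -
  have dRb: "dt (R_b R\<^sub>0) 0 x = 2 * R\<^sub>0 * cosh (2 * x)" for x
  proof (rule dt_eqI)
    have "((\<lambda>s. R_b R\<^sub>0 s x) has_real_derivative 2 * R\<^sub>0 * cosh (2 * x)) (at 0)"
      unfolding R_b_def by (auto intro!: derivative_eq_intros)
    then show "((\<lambda>s. R_b R\<^sub>0 s x) has_vector_derivative 2 * R\<^sub>0 * cosh (2 * x)) (at 0 within {0..})"
      by (simp add: has_real_derivative_iff_has_vector_derivative has_vector_derivative_at_within)
  qed simp
  define f where "f x = r\<^sub>0 x - R\<^sub>0 * cosh (2 * x)" for x
  define g where "g x = r\<^sub>1 x - 2 * R\<^sub>0 * cosh (2 * x)" for x
  have m: "m_0 R\<^sub>0 0 r\<^sub>0 r\<^sub>1 = C0_norm f + C0_norm g"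
    by (simp add: m_0_def dRb f_def[abs_def] g_def[abs_def] R_b_def)
  have up: "ereal \<bar>h x\<bar> \<le> C0_norm h" for h x
    unfolding C0_norm_def by (rule SUP_upper) simp
  have ge0: "0 \<le> C0_norm h" for h
    using order_trans[OF _ up[of h 0]] by simp
  have "C0_norm f < \<infinity>" "C0_norm g < \<infinity>"
    using assms ge0[of f] ge0[of g] unfolding m by (cases "C0_norm f"; cases "C0_norm g"; simp)+
  then obtain a b where ab: "C0_norm f = ereal a" "C0_norm g = ereal b"
    using ge0[of f] ge0[of g] by (cases "C0_norm f"; cases "C0_norm g") auto
  show ?thesis
    using that[of a b] up[of f] up[of g] assms unfolding m ab by (simp add: f_def g_def)
qed

text \<open>
  Write \<open>R = R\<^sub>b + error\<close>. The explicit \<open>R\<^sub>b\<close> solves the wave equation and is at least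
  \<open>R\<^sub>0 (1 + 2 t)\<close>, whereas the error is at most \<open>a + b t\<close> when \<open>a\<close> and \<open>b\<close> bound the deviations of the two initial
  data; \<open>a + b < 2 R\<^sub>0 / 3\<close> leaves at least \<open>R\<^sub>0 / 3\<close>.
\<close>

lemma dAlembert_lower_bound:
  assumes R0: "R\<^sub>0 > 0" and m: "m_0 R\<^sub>0 0 r\<^sub>0 r\<^sub>1 < ereal (2 * R\<^sub>0 / 3)"
    and rho: "\<And>x. (\<rho> has_real_derivative r\<^sub>1 x) (at x)" and t: "t \<ge> 0"
  shows "R\<^sub>0 / 3 \<le> (r\<^sub>0 (x + t) + r\<^sub>0 (x - t)) / 2 + (\<rho> (x + t) - \<rho> (x - t)) / 2"
proof -
  obtain a b where ab: "a + b < 2 * R\<^sub>0 / 3" and a: "\<And>x. \<bar>r\<^sub>0 x - R\<^sub>0 * cosh (2 * x)\<bar> \<le> a"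
    and b: "\<And>x. \<bar>r\<^sub>1 x - 2 * R\<^sub>0 * cosh (2 * x)\<bar> \<le> b"
    using m_0_bounds[OF m] by blast
  have a0: "a \<ge> 0" and b0: "b \<ge> 0" using a[of 0] b[of 0] by linarith+
  define h where "h x = \<rho> x - R\<^sub>0 * sinh (2 * x)" for x
  have dh: "(h has_field_derivative r\<^sub>1 x - 2 * R\<^sub>0 * cosh (2 * x)) (at x)" for x
    unfolding h_def by (auto intro!: derivative_eq_intros rho)
  have "norm (h (x - t) - h (x + t)) \<le> b * norm ((x - t) - (x + t))"
    by (rule field_differentiable_bound[of UNIV h]) (use dh b in auto)
  then have h: "\<bar>h (x + t) - h (x - t)\<bar> \<le> b * (2 * t)" using t by simp
  \<comment> \<open>D'Alembert's formula for \<open>R\<^sub>b\<close>.\<close>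
  have main: "(R\<^sub>0 * cosh (2 * (x + t)) + R\<^sub>0 * cosh (2 * (x - t))) / 2 + (R\<^sub>0 * sinh (2 * (x + t)) - R\<^sub>0 * sinh (2 * (x - t))) / 2
      = R\<^sub>0 * exp (2 * t) * cosh (2 * x)"
    by (simp add: cosh_field_def sinh_field_def field_simps exp_diff exp_add exp_minus)
  have "R\<^sub>0 * (1 + 2 * t) * 1 \<le> R\<^sub>0 * exp (2 * t) * cosh (2 * x)"
    using R0 t cosh_real_ge_1 exp_ge_add_one_self[of "2 * t"] by (intro mult_mono) auto
  then have low: "R\<^sub>0 + 2 * (R\<^sub>0 * t) \<le> R\<^sub>0 * exp (2 * t) * cosh (2 * x)" by (simp add: algebra_simps)
  have "b * t \<le> (2 * R\<^sub>0 / 3) * t" using ab a0 t by (intro mult_right_mono) auto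
  then have bt: "3 * (b * t) \<le> 2 * (R\<^sub>0 * t)" by simp
  have Rt: "R\<^sub>0 * t \<ge> 0" using R0 t by simp
  have h': "- (2 * (b * t)) \<le> h (x + t) - h (x - t)" using h by (simp add: abs_le_iff)
  have "- a \<le> r\<^sub>0 (x + t) - R\<^sub>0 * cosh (2 * (x + t))" "- a \<le> r\<^sub>0 (x - t) - R\<^sub>0 * cosh (2 * (x - t))"
    using a[of "x + t"] a[of "x - t"] unfolding abs_le_iff by linarith+
  with low bt Rt h' main ab b0 R0 show ?thesis unfolding h_def by argo
qed

lemma C1_plane_snd:
  assumes "\<And>x. (f has_real_derivative f' x) (at x)" "continuous_on UNIV f'"
  shows "C1_plane (\<lambda>u v. f v) (\<lambda>u v. 0) (\<lambda>u v. f' v)"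
proof (rule C1_planeI)
  show "C0_plane (\<lambda>u v. f' v)"
    unfolding C0_plane_def by (rule continuous_on_compose2[OF assms(2) continuous_on_snd[OF continuous_on_id]]) simp
qed (use assms in \<open>auto simp: C0_plane_def has_real_derivative_iff_has_vector_derivative\<close>)

lemma C1_plane_fst:
  assumes "\<And>x. (f has_real_derivative f' x) (at x)" "continuous_on UNIV f'"
  shows "C1_plane (\<lambda>u v. f u) (\<lambda>u v. f' u) (\<lambda>u v. 0)"
  using C1_plane_swap[OF C1_plane_snd[OF assms]] .

section \<open>Existence\<close>

text \<open>
  Here \<open>z = a + i b\<close> and \<open>w = c + i d\<close> are viewed as functions of \<open>t\<close> and \<open>x\<close>, so that
  \<open>\<partial>\<^sub>t - \<partial>\<^sub>x = 2 \<partial>\<^sub>u\<close> and \<open>\<partial>\<^sub>t + \<partial>\<^sub>x = 2 \<partial>\<^sub>v\<close>. That \<open>(a + c) / 2\<close> and \<open>(a - c) / 2\<close> are the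
  derivatives of a function \<open>W\<close> amounts to the equality of the right-hand sides for \<open>a\<close> and \<open>c\<close>.
  The derivatives of \<open>q\<close> contain \<open>exp (2 W)\<close>, and the terms produced by differentiating it are matched
  by the difference of the two rotation terms.
\<close>

lemma wave_map_from_null_components:
  fixes a b c d al be :: "real \<Rightarrow> real \<Rightarrow> real"
  assumes a: "C1_plane a a1 a2" and b: "C1_plane b b1 b2" and c: "C1_plane c c1 c2" and d: "C1_plane d d1 d2"
    and ea: "\<And>t x. a1 t x - a2 t x = 2 * (al t x * c t x + be t x * a t x) - 2 * b t x * d t x"
    and eb: "\<And>t x. b1 t x - b2 t x = 2 * (al t x * d t x + be t x * b t x) + 2 * a t x * d t x"
    and ec: "\<And>t x. c1 t x + c2 t x = 2 * (al t x * c t x + be t x * a t x) - 2 * b t x * d t x"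
    and ed: "\<And>t x. d1 t x + d2 t x = 2 * (al t x * d t x + be t x * b t x) + 2 * b t x * c t x"
    and w0: "\<And>x. (w\<^sub>0 has_real_derivative (a 0 x - c 0 x) / 2) (at x)"
    and q0: "\<And>x. (q\<^sub>0 has_real_derivative exp (2 * w\<^sub>0 x) * (b 0 x - d 0 x)) (at x)"
  obtains W q where
    "Ck_halfplane 2 W" "Ck_halfplane 2 q" "\<And>x. W 0 x = w\<^sub>0 x" "\<And>x. q 0 x = q\<^sub>0 x"
    "\<And>t x. t \<ge> 0 \<Longrightarrow> dt W t x = (a t x + c t x) / 2" "\<And>t x. t \<ge> 0 \<Longrightarrow> dx W t x = (a t x - c t x) / 2"
    "\<And>t x. t \<ge> 0 \<Longrightarrow> dt q t x = exp (2 * W t x) * (b t x + d t x)"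
    "\<And>t x. t \<ge> 0 \<Longrightarrow> dx q t x = exp (2 * W t x) * (b t x - d t x)"
    "\<And>t x. t \<ge> 0 \<Longrightarrow> dt (dt W) t x - dx (dx W) t x = 2 * (al t x * c t x + be t x * a t x) - 2 * b t x * d t x"
    "\<And>t x. t \<ge> 0 \<Longrightarrow> dt (dt q) t x - dx (dx q) t x =
      exp (2 * W t x) * (4 * (al t x * d t x + be t x * b t x) + 4 * (a t x * d t x + b t x * c t x))"
proof -
  define Wt where "Wt t x = (a t x + c t x) / 2" for t x
  define Wx where "Wx t x = (a t x - c t x) / 2" for t x
  define Wtx where "Wtx t x = (a2 t x + c2 t x) / 2" for t x
  have Wt: "C1_plane Wt (\<lambda>t x. (a1 t x + c1 t x) / 2) Wtx"
    unfolding Wt_def Wtx_def by (rule C1_plane_linear[OF C1_plane_add[OF a c] bounded_linear_divide])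
  have "Wtx = (\<lambda>t x. (a1 t x - c1 t x) / 2)"
    unfolding Wtx_def using ea ec by (intro ext) (simp add: field_simps, smt (verit))
  then have Wx: "C1_plane Wx Wtx (\<lambda>t x. (a2 t x - c2 t x) / 2)"
    unfolding Wx_def by (auto intro!: C1_plane_linear[OF C1_plane_diff[OF a c] bounded_linear_divide])
  obtain W where W: "C1_plane W Wt Wx" and W0: "\<And>x. W 0 x = w\<^sub>0 x"
    by (rule potential_exists[OF Wt Wx, of w\<^sub>0]) (use w0 in \<open>auto simp: Wx_def\<close>)
  have E: "C1_plane (\<lambda>t x. exp (2 * W t x)) (\<lambda>t x. (2 * Wt t x) * exp (2 * W t x)) (\<lambda>t x. (2 * Wx t x) * exp (2 * W t x))"
    by (rule C1_plane_exp[OF C1_plane_linear[OF W bounded_linear_mult_right]])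
  define qt where "qt t x = exp (2 * W t x) * (b t x + d t x)" for t x
  define qx where "qx t x = exp (2 * W t x) * (b t x - d t x)" for t x
  define qtx where "qtx t x = exp (2 * W t x) * (b2 t x + d2 t x) + (2 * Wx t x) * exp (2 * W t x) * (b t x + d t x)" for t x
  have qt: "C1_plane qt (\<lambda>t x. exp (2 * W t x) * (b1 t x + d1 t x) + (2 * Wt t x) * exp (2 * W t x) * (b t x + d t x)) qtx"
    unfolding qt_def qtx_def by (rule C1_plane_mult[OF E C1_plane_add[OF b d]])
  have "qtx = (\<lambda>t x. exp (2 * W t x) * (b1 t x - d1 t x) + (2 * Wt t x) * exp (2 * W t x) * (b t x - d t x))"
  proof (intro ext)
    fix t x
    have [simp]: "2 * Wx t x = a t x - c t x" "2 * Wt t x = a t x + c t x" by (simp_all add: Wx_def Wt_def)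
    have "(b2 t x + d2 t x) + 2 * Wx t x * (b t x + d t x) = (b1 t x - d1 t x) + 2 * Wt t x * (b t x - d t x)"
      using eb[of t x] ed[of t x] by (simp add: algebra_simps)
    then have "exp (2 * W t x) * ((b2 t x + d2 t x) + 2 * Wx t x * (b t x + d t x)) = exp (2 * W t x) * ((b1 t x - d1 t x) + 2 * Wt t x * (b t x - d t x))"
      by simp
    then show "qtx t x = exp (2 * W t x) * (b1 t x - d1 t x) + (2 * Wt t x) * exp (2 * W t x) * (b t x - d t x)"
      by (simp add: qtx_def algebra_simps)
  qed
  then have qx: "C1_plane qx qtx (\<lambda>t x. exp (2 * W t x) * (b2 t x - d2 t x) + (2 * Wx t x) * exp (2 * W t x) * (b t x - d t x))"
    unfolding qx_def by (auto intro!: C1_plane_mult[OF E C1_plane_diff[OF b d]])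
  obtain q where q: "C1_plane q qt qx" and q0': "\<And>x. q 0 x = q\<^sub>0 x"
    by (rule potential_exists[OF qt qx, of q\<^sub>0]) (use q0 in \<open>auto simp: qx_def W0\<close>)
  note CW = C2_plane_halfplane[OF W Wt Wx] and Cq = C2_plane_halfplane[OF q qt qx]
  show ?thesis
  proof (rule that[OF CW(1) Cq(1) W0 q0'])
    fix t x :: real assume t: "t \<ge> 0"
    show "dt W t x = (a t x + c t x) / 2" "dx W t x = (a t x - c t x) / 2"
      "dt q t x = exp (2 * W t x) * (b t x + d t x)" "dx q t x = exp (2 * W t x) * (b t x - d t x)"
      using C1_plane_dt[OF W t] C1_plane_dx[OF W] C1_plane_dt[OF q t] C1_plane_dx[OF q]
      by (simp_all add: Wt_def Wx_def qt_def qx_def)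
    show "dt (dt W) t x - dx (dx W) t x = 2 * (al t x * c t x + be t x * a t x) - 2 * b t x * d t x"
      using CW(2,3)[OF t, of x] ea[of t x] ec[of t x] by (simp add: field_simps)
    have [simp]: "2 * Wx t x = a t x - c t x" "2 * Wt t x = a t x + c t x" by (simp_all add: Wx_def Wt_def)
    have "(b1 t x + d1 t x) + 2 * Wt t x * (b t x + d t x) - ((b2 t x - d2 t x) + 2 * Wx t x * (b t x - d t x))
      = 4 * (al t x * d t x + be t x * b t x) + 4 * (a t x * d t x + b t x * c t x)"
      using eb[of t x] ed[of t x] by (simp add: algebra_simps)
    then have "exp (2 * W t x) * ((b1 t x + d1 t x) + 2 * Wt t x * (b t x + d t x) - ((b2 t x - d2 t x) + 2 * Wx t x * (b t x - d t x)))
      = exp (2 * W t x) * (4 * (al t x * d t x + be t x * b t x) + 4 * (a t x * d t x + b t x * c t x))" by simp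
    then show "dt (dt q) t x - dx (dx q) t x =
      exp (2 * W t x) * (4 * (al t x * d t x + be t x * b t x) + 4 * (a t x * d t x + b t x * c t x))"
      using Cq(2,3)[OF t, of x] by (simp add: algebra_simps)
  qed
qed

text \<open>
  On the line \<open>t = 0\<close> the data of \<open>z\<close> and \<open>w\<close> are the null derivatives of \<open>W\<close> and \<open>q\<close> read off from
  the initial data.
\<close>

lemma solution_exists:
  fixes R\<^sub>0 :: real and r\<^sub>0 r\<^sub>1 w\<^sub>0 w\<^sub>1 q\<^sub>0 q\<^sub>1 :: "real \<Rightarrow> real"
  assumes R0: "R\<^sub>0 > 0"
    and r0: "Ck_line 2 r\<^sub>0" and w0: "Ck_line 2 w\<^sub>0" and q0: "Ck_line 2 q\<^sub>0"
    and r1: "Ck_line 1 r\<^sub>1" and w1: "Ck_line 1 w\<^sub>1" and q1: "Ck_line 1 q\<^sub>1"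
    and m: "m_0 R\<^sub>0 0 r\<^sub>0 r\<^sub>1 < ereal (2 * R\<^sub>0 / 3)"
  shows "\<exists>R W q. C2_solution_with_data r\<^sub>0 r\<^sub>1 w\<^sub>0 w\<^sub>1 q\<^sub>0 q\<^sub>1 R W q"
proof -
  note r0d = Ck_line_2(1)[OF r0] Ck_line_1[OF Ck_line_2(2)[OF r0]]
  note w0d = Ck_line_2(1)[OF w0] Ck_line_1[OF Ck_line_2(2)[OF w0]]
  note q0d = Ck_line_2(1)[OF q0] Ck_line_1[OF Ck_line_2(2)[OF q0]]
  note r1d = Ck_line_1[OF r1] and w1d = Ck_line_1[OF w1] and q1d = Ck_line_1[OF q1]
  have cont: "continuous_on UNIV f" if "\<And>x. (f has_real_derivative f' x) (at x)" for f f' :: "real \<Rightarrow> real"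
    using that by (meson DERIV_isCont continuous_at_imp_continuous_on)
  note conts = r0d(3) w0d(3) q0d(3) r1d(2) w1d(2) q1d(2) cont[OF r0d(1)] cont[OF r0d(2)] cont[OF w0d(1)] cont[OF w0d(2)]
    cont[OF q0d(1)] cont[OF q0d(2)] cont[OF r1d(1)] cont[OF w1d(1)] cont[OF q1d(1)]
  obtain \<rho> where "\<And>x. (\<rho> has_vector_derivative r\<^sub>1 x) (at x)"
    using continuous_antiderivative[OF cont[OF r1d(1)]] by blast
  then have rho: "(\<rho> has_real_derivative r\<^sub>1 x) (at x)" for x
    by (simp add: has_real_derivative_iff_has_vector_derivative)
  define F where "F v = (r\<^sub>0 v + \<rho> v) / 2" for v
  define F1 where "F1 v = (deriv r\<^sub>0 v + r\<^sub>1 v) / 2" for v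
  define F2 where "F2 v = (deriv (deriv r\<^sub>0) v + deriv r\<^sub>1 v) / 2" for v
  define G where "G u = (r\<^sub>0 (-u) - \<rho> (-u)) / 2" for u
  define G1 where "G1 u = (r\<^sub>1 (-u) - deriv r\<^sub>0 (-u)) / 2" for u
  define G2 where "G2 u = (deriv (deriv r\<^sub>0) (-u) - deriv r\<^sub>1 (-u)) / 2" for u
  have neg: "((\<lambda>x. f (- x)) has_real_derivative - f' (- x)) (at x)" if "\<And>x. (f has_real_derivative f' x) (at x)"
    for f f' :: "real \<Rightarrow> real" and x
    using that[of "- x"] DERIV_mirror[of f] by blast
  have dF: "(F has_real_derivative F1 v) (at v)" for v
    unfolding F_def F1_def by (auto intro!: derivative_eq_intros r0d rho)
  have dF1: "(F1 has_real_derivative F2 v) (at v)" for v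
    unfolding F1_def F2_def by (auto intro!: derivative_eq_intros r0d r1d)
  have dG: "(G has_real_derivative G1 v) (at v)" for v
    unfolding G_def G1_def by (auto intro!: derivative_eq_intros neg[OF r0d(1)] neg[OF rho])
  have dG1: "(G1 has_real_derivative G2 v) (at v)" for v
    unfolding G1_def G2_def by (auto intro!: derivative_eq_intros neg[OF r0d(2)] neg[OF r1d(1)])
  have cF: "continuous_on UNIV F1" "continuous_on UNIV F2" "continuous_on UNIV G1" "continuous_on UNIV G2"
    unfolding F1_def F2_def G1_def G2_def
    by (intro continuous_intros conts conts[THEN continuous_on_compose2]; simp)+
  define P where "P u v = F v + G u" for u v
  have P: "C1_plane P (\<lambda>u v. G1 u) (\<lambda>u v. F1 v)"
    using C1_plane_add[OF C1_plane_snd[OF dF cF(1)] C1_plane_fst[OF dG cF(3)]] unfolding P_def by simp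
  note P2 = C1_plane_snd[OF dF1 cF(2)] and P1 = C1_plane_fst[OF dG1 cF(4)]
  define R where "R t x = P (t - x) (t + x)" for t x
  define Rt where "Rt t x = G1 (t - x) + F1 (t + x)" for t x
  define Rx where "Rx t x = F1 (t + x) - G1 (t - x)" for t x
  have R: "C1_plane R Rt Rx"
    using C1_plane_null_coordinates[OF P] unfolding R_def Rt_def Rx_def .
  have Rt: "C1_plane Rt (\<lambda>t x. G2 (t - x) + F2 (t + x)) (\<lambda>t x. F2 (t + x) - G2 (t - x))"
    using C1_plane_null_coordinates[OF C1_plane_add[OF P1 P2]] unfolding Rt_def by simp
  have Rx: "C1_plane Rx (\<lambda>t x. F2 (t + x) - G2 (t - x)) (\<lambda>t x. G2 (t - x) + F2 (t + x))"
    using C1_plane_null_coordinates[OF C1_plane_diff[OF P2 P1]] unfolding Rx_def by (simp add: add.commute)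
  note CR = C2_plane_halfplane[OF R Rt Rx]
  have Rlow: "R\<^sub>0 / 3 \<le> R t x" if "t \<ge> 0" for t x
    using dAlembert_lower_bound[OF R0 m rho that, of x] by (simp add: R_def P_def F_def G_def add.commute field_simps)
  \<comment> \<open>The coefficients have to be \<open>C\<^sup>1\<close> on the whole plane, and \<open>R\<close> may vanish for negative \<open>t\<close>.\<close>
  obtain \<phi> \<phi>' where phi: "\<And>y. (\<phi> has_real_derivative \<phi>' y) (at y)" "continuous_on UNIV \<phi>'"
    and phi_eq: "\<And>y. y \<ge> R\<^sub>0 / 3 \<Longrightarrow> \<phi> y = 1 / y"
    using reciprocal_extension[of "R\<^sub>0 / 3"] R0 by auto
  define al where "al u v = (- 1 / 2) * (\<phi> (P u v) * F1 v)" for u v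
  define be where "be u v = (- 1 / 2) * (\<phi> (P u v) * G1 u)" for u v
  obtain al1 al2 be1 be2 where al: "C1_plane al al1 al2" and be: "C1_plane be be1 be2"
    using C1_plane_linear[OF C1_plane_mult[OF C1_plane_chain[OF P phi] P2] bounded_linear_mult_right[of "- 1 / 2"]]
      C1_plane_linear[OF C1_plane_mult[OF C1_plane_chain[OF P phi] P1] bounded_linear_mult_right[of "- 1 / 2"]]
    unfolding al_def be_def by blast
  define z0 where "z0 x = Complex (w\<^sub>1 x + deriv w\<^sub>0 x) (exp (- 2 * w\<^sub>0 x) / 2 * (q\<^sub>1 x + deriv q\<^sub>0 x))" for x
  define v0 where "v0 x = Complex (w\<^sub>1 x - deriv w\<^sub>0 x) (exp (- 2 * w\<^sub>0 x) / 2 * (q\<^sub>1 x - deriv q\<^sub>0 x))" for x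
  define z0' where "z0' x = Complex (deriv w\<^sub>1 x + deriv (deriv w\<^sub>0) x)
    (exp (- 2 * w\<^sub>0 x) / 2 * (deriv q\<^sub>1 x + deriv (deriv q\<^sub>0) x) + (- 2 * deriv w\<^sub>0 x * exp (- 2 * w\<^sub>0 x) / 2) * (q\<^sub>1 x + deriv q\<^sub>0 x))" for x
  define v0' where "v0' x = Complex (deriv w\<^sub>1 x - deriv (deriv w\<^sub>0) x)
    (exp (- 2 * w\<^sub>0 x) / 2 * (deriv q\<^sub>1 x - deriv (deriv q\<^sub>0) x) + (- 2 * deriv w\<^sub>0 x * exp (- 2 * w\<^sub>0 x) / 2) * (q\<^sub>1 x - deriv q\<^sub>0 x))" for x
  have dz0: "(z0 has_vector_derivative z0' x) (at x)" and dv0: "(v0 has_vector_derivative v0' x) (at x)" for x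
    unfolding z0_def z0'_def v0_def v0'_def
    by (intro has_vector_derivative_Complex; (rule w0d q0d w1d q1d derivative_eq_intros refl | simp)+)+
  have cz0: "continuous_on UNIV z0" "continuous_on UNIV z0'" "continuous_on UNIV v0" "continuous_on UNIV v0'"
    unfolding z0_def z0'_def v0_def v0'_def Complex_eq by (intro continuous_intros conts; simp)+
  obtain z w where zw: "C0_plane z" "C0_plane w" and sys: "\<And>u v. char_system al be z w u v"
    and zi: "\<And>v. z (-v) v = z0 v" and wi: "\<And>v. w (-v) v = v0 v"
    using char_system_exists[OF C1_plane_imp_C0_plane[OF al] C1_plane_imp_C0_plane[OF be] cz0(1,3)] by metis
  obtain z1 z2 w1 w2 where z: "C1_plane z z1 z2" and w: "C1_plane w w1 w2"
    using char_system_C1[OF al be zw sys zi dz0 cz0(2) wi dv0 cz0(4)] by metis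
  have z1: "z1 u v = al u v *\<^sub>R w u v + be u v *\<^sub>R z u v + \<i> * complex_of_real (Im (w u v)) * z u v" for u v
    using sys[of u v] C1_plane_partials(1)[OF z, of v u UNIV] by (auto simp: char_system_def intro: vector_derivative_unique_at)
  have w2: "w2 u v = al u v *\<^sub>R w u v + be u v *\<^sub>R z u v + \<i> * complex_of_real (Im (z u v)) * w u v" for u v
    using sys[of u v] C1_plane_partials(2)[OF w, of u v UNIV] by (auto simp: char_system_def intro: vector_derivative_unique_at)
  note Z = C1_plane_null_coordinates[OF z] and V = C1_plane_null_coordinates[OF w]
  have e: "exp (2 * y) * (exp (- 2 * y) / 2 * k) = k / 2" for y k :: real
  proof -
    have "exp (2 * y) * (exp (- 2 * y) / 2 * k) = (exp (2 * y) * exp (- 2 * y)) * (k / 2)" by simp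
    also have "exp (2 * y) * exp (- 2 * y) = 1" by (simp flip: exp_add)
    finally show ?thesis by simp
  qed
  have init: "Re (z (0 - x) (0 + x)) = w\<^sub>1 x + deriv w\<^sub>0 x" "Re (w (0 - x) (0 + x)) = w\<^sub>1 x - deriv w\<^sub>0 x"
    "Im (z (0 - x) (0 + x)) = exp (- 2 * w\<^sub>0 x) / 2 * (q\<^sub>1 x + deriv q\<^sub>0 x)"
    "Im (w (0 - x) (0 + x)) = exp (- 2 * w\<^sub>0 x) / 2 * (q\<^sub>1 x - deriv q\<^sub>0 x)" for x
    using zi[of x] wi[of x] by (simp_all add: z0_def v0_def)
  obtain W q where Wq: "Ck_halfplane 2 W" "Ck_halfplane 2 q" "\<And>x. W 0 x = w\<^sub>0 x" "\<And>x. q 0 x = q\<^sub>0 x"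
    and dW: "\<And>t x. t \<ge> 0 \<Longrightarrow> dt W t x = (Re (z (t - x) (t + x)) + Re (w (t - x) (t + x))) / 2"
      "\<And>t x. t \<ge> 0 \<Longrightarrow> dx W t x = (Re (z (t - x) (t + x)) - Re (w (t - x) (t + x))) / 2"
    and dq: "\<And>t x. t \<ge> 0 \<Longrightarrow> dt q t x = exp (2 * W t x) * (Im (z (t - x) (t + x)) + Im (w (t - x) (t + x)))"
      "\<And>t x. t \<ge> 0 \<Longrightarrow> dx q t x = exp (2 * W t x) * (Im (z (t - x) (t + x)) - Im (w (t - x) (t + x)))"
    and Weq: "\<And>t x. t \<ge> 0 \<Longrightarrow> dt (dt W) t x - dx (dx W) t x = 2 * (al (t - x) (t + x) * Re (w (t - x) (t + x))
      + be (t - x) (t + x) * Re (z (t - x) (t + x))) - 2 * Im (z (t - x) (t + x)) * Im (w (t - x) (t + x))"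
    and qeq: "\<And>t x. t \<ge> 0 \<Longrightarrow> dt (dt q) t x - dx (dx q) t x =
      exp (2 * W t x) * (4 * (al (t - x) (t + x) * Im (w (t - x) (t + x)) + be (t - x) (t + x) * Im (z (t - x) (t + x)))
       + 4 * (Re (z (t - x) (t + x)) * Im (w (t - x) (t + x)) + Im (z (t - x) (t + x)) * Re (w (t - x) (t + x))))"
  proof (rule wave_map_from_null_components[OF C1_plane_linear[OF Z bounded_linear_Re] C1_plane_linear[OF Z bounded_linear_Im]
        C1_plane_linear[OF V bounded_linear_Re] C1_plane_linear[OF V bounded_linear_Im],
        where al = "\<lambda>t x. al (t - x) (t + x)" and be = "\<lambda>t x. be (t - x) (t + x)" and w\<^sub>0 = w\<^sub>0 and q\<^sub>0 = q\<^sub>0])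
    show "(w\<^sub>0 has_real_derivative (Re (z (0 - x) (0 + x)) - Re (w (0 - x) (0 + x))) / 2) (at x)" for x
      unfolding init using w0d(1) by simp
    show "(q\<^sub>0 has_real_derivative exp (2 * w\<^sub>0 x) * (Im (z (0 - x) (0 + x)) - Im (w (0 - x) (0 + x)))) (at x)" for x
    proof -
      have "exp (2 * w\<^sub>0 x) * (Im (z (0 - x) (0 + x)) - Im (w (0 - x) (0 + x))) = deriv q\<^sub>0 x"
        unfolding init right_diff_distrib[of "exp (2 * w\<^sub>0 x)"] e by (simp add: field_simps)
      then show ?thesis using q0d(1)[of x] by (simp only:)
    qed
  qed (simp_all add: z1 w2 algebra_simps)
  have "solves_system R W q"
    unfolding solves_system_def
  proof (intro allI impI conjI)
    fix t x :: real assume t: "t \<ge> 0"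
    have Rpos: "R t x > 0" using Rlow[OF t, of x] R0 by simp
    then show "R t x \<noteq> 0" by simp
    show "dx (dx R) t x - dt (dt R) t x = 0" using CR(2,3)[OF t, of x] by simp
    have dR: "dt R t x = Rt t x" "dx R t x = Rx t x" using C1_plane_dt[OF R t] C1_plane_dx[OF R] by auto
    have phi_R: "\<phi> (P (t - x) (t + x)) = 1 / R t x" using phi_eq[OF Rlow[OF t]] by (simp add: R_def)
    have albe: "al (t - x) (t + x) = - (Rt t x + Rx t x) / (4 * R t x)" "be (t - x) (t + x) = - (Rt t x - Rx t x) / (4 * R t x)"
      by (simp_all add: al_def be_def phi_R Rt_def Rx_def)
    have e4: "exp (2 * W t x) * exp (2 * W t x) * exp (- 4 * W t x) = 1" by (simp flip: exp_add)
    define a b c d where "a = Re (z (t - x) (t + x))" and "b = Im (z (t - x) (t + x))"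
      and "c = Re (w (t - x) (t + x))" and "d = Im (w (t - x) (t + x))"
    have nonlin: "((dt q t x)\<^sup>2 - (dx q t x)\<^sup>2) / 2 * exp (- 4 * W t x) = 2 * b * d"
    proof -
      have "((dt q t x)\<^sup>2 - (dx q t x)\<^sup>2) / 2 * exp (- 4 * W t x)
          = (exp (2 * W t x) * exp (2 * W t x) * exp (- 4 * W t x)) * (2 * b * d)"
        unfolding dq[OF t] b_def d_def by (simp add: power2_eq_square field_simps)
      then show ?thesis unfolding e4 by simp
    qed
    have "dt (dt W) t x - dx (dx W) t x = 2 * (al (t - x) (t + x) * c + be (t - x) (t + x) * a) - 2 * b * d"
      using Weq[OF t, of x] by (simp add: a_def b_def c_def d_def)
    also have "2 * (al (t - x) (t + x) * c + be (t - x) (t + x) * a)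
        = - (Rt t x / R t x * dt W t x - Rx t x / R t x * dx W t x)"
      unfolding albe dW[OF t] a_def[symmetric] c_def[symmetric] using Rpos by (simp add: field_simps)
    finally show "dt (dt W) t x - dx (dx W) t x + dt R t x / R t x * dt W t x - dx R t x / R t x * dx W t x +
        ((dt q t x)\<^sup>2 - (dx q t x)\<^sup>2) / 2 * exp (- 4 * W t x) = 0"
      unfolding nonlin dR by simp
    have "dt (dt q) t x - dx (dx q) t x
        = exp (2 * W t x) * (4 * (al (t - x) (t + x) * d + be (t - x) (t + x) * b)) + exp (2 * W t x) * (4 * (a * d + b * c))"
      using qeq[OF t, of x] by (simp add: a_def b_def c_def d_def distrib_left)
    also have "exp (2 * W t x) * (4 * (al (t - x) (t + x) * d + be (t - x) (t + x) * b))
        = - (Rt t x / R t x * dt q t x - Rx t x / R t x * dx q t x)"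
      unfolding albe dq[OF t] b_def[symmetric] d_def[symmetric] using Rpos by (simp add: field_simps)
    also have "exp (2 * W t x) * (4 * (a * d + b * c)) = 4 * dt q t x * dt W t x - 4 * dx q t x * dx W t x"
      unfolding dq[OF t] dW[OF t] a_def[symmetric] b_def[symmetric] c_def[symmetric] d_def[symmetric] by (simp add: field_simps)
    finally show "dt (dt q) t x - dx (dx q) t x + dt R t x / R t x * dt q t x - dx R t x / R t x * dx q t x -
        4 * dt q t x * dt W t x + 4 * dx q t x * dx W t x = 0"
      unfolding dR by simp
  qed
  moreover have "has_initial_data R r\<^sub>0 r\<^sub>1"
    unfolding has_initial_data_def
    using C1_plane_dt[OF R, of 0] by (simp add: R_def Rt_def P_def F_def G_def F1_def G1_def field_simps)
  moreover have "has_initial_data W w\<^sub>0 w\<^sub>1"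
    unfolding has_initial_data_def using dW(1)[of 0] Wq(3) init by simp
  moreover have "has_initial_data q q\<^sub>0 q\<^sub>1"
    unfolding has_initial_data_def
  proof (intro allI conjI Wq(4))
    fix x
    show "dt q 0 x = q\<^sub>1 x"
      unfolding dq(1)[OF order_refl] Wq(3) init distrib_left[of "exp (2 * w\<^sub>0 x)"] e by (simp add: field_simps)
  qed
  ultimately show ?thesis
    using CR(1) Wq(1,2) unfolding C2_solution_with_data_def by blast
qed

theorem theorem3p1:
  fixes R\<^sub>0 :: real and r\<^sub>0 r\<^sub>1 w\<^sub>0 w\<^sub>1 q\<^sub>0 q\<^sub>1 :: "real \<Rightarrow> real"
  assumes "R\<^sub>0 > 0"
    and "Ck_line 2 r\<^sub>0" and "Ck_line 2 w\<^sub>0" and "Ck_line 2 q\<^sub>0"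
    and "Ck_line 1 r\<^sub>1" and "Ck_line 1 w\<^sub>1" and "Ck_line 1 q\<^sub>1"
    and "m_0 R\<^sub>0 0 r\<^sub>0 r\<^sub>1 < ereal (2 * R\<^sub>0 / 3)"
  shows "(\<exists>R W q. C2_solution_with_data r\<^sub>0 r\<^sub>1 w\<^sub>0 w\<^sub>1 q\<^sub>0 q\<^sub>1 R W q) \<and>
    (\<forall>R W q R' W' q'.
       C2_solution_with_data r\<^sub>0 r\<^sub>1 w\<^sub>0 w\<^sub>1 q\<^sub>0 q\<^sub>1 R W q \<longrightarrow>
       C2_solution_with_data r\<^sub>0 r\<^sub>1 w\<^sub>0 w\<^sub>1 q\<^sub>0 q\<^sub>1 R' W' q' \<longrightarrow>
       (\<forall>t\<ge>0. \<forall>x. R t x = R' t x \<and> W t x = W' t x \<and> q t x = q' t x))"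
  using solution_exists[OF assms] solution_unique by blast

end
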